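(* Let $r,s\in\mathbb{C}^*$ be such that $r^ms^n=1$ (with $m,n\in\mathbb{Z}$) implies $m=n=0$, and let $U^+=U^+_{r,s}(G_2)$. Then every $\mathbb{C}$-derivation $D$ of $U^+$ can be uniquely written as $$D=\mathrm{ad}_g+\mu_5D_5+\mu_6D_6,$$ where $g\in U^+$ and $\mu_5,\mu_6\in\mathbb{C}$ (uniqueness meaning that the derivation $\mathrm{ad}_g$ and the scalars $\mu_5,\mu_6$ are uniquely determined by $D$).
   Context: $\mathbb{C}^*=\mathbb{C}\setminus\{0\}$. $U^+=U^+_{r,s}(G_2)$ is the associative unital $\mathbb{C}$-algebra generated by $e_1,e_2$ subject to the relations $$e_2^2e_1-(r^{-3}+s^{-3})e_2e_1e_2+(rs)^{-3}e_1e_2^2=0,$$ $$e_1^4e_2-(r+s)(r^2+s^2)e_1^3e_2e_1+rs(r^2+s^2)(r^2+rs+s^2)e_1^2e_2e_1^2-(rs)^3(r+s)(r^2+s^2)e_1e_2e_1^3+(rs)^6e_2e_1^4=0.$$ Put $X_1=e_1$, $X_6=e_2$, $X_5=e_1e_2-s^3e_2e_1$, $X_3=e_1X_5-rs^2X_5e_1$, $X_2=e_1X_3-r^2sX_3e_1$, $X_4=X_3X_5-r^2sX_5X_3$. For $g\in U^+$, $\mathrm{ad}_g$ is the inner derivation $x\mapsto gx-xg$. $D_5$ and $D_6$ are the derivations of $U^+$ determined by $D_5(X_1)=X_1$, $D_5(X_2)=3X_2$, $D_5(X_3)=2X_3$, $D_5(X_4)=3X_4$, $D_5(X_5)=X_5$,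 $D_5(X_6)=0$; $D_6(X_1)=-X_1$, $D_6(X_2)=-2X_2$, $D_6(X_3)=-X_3$, $D_6(X_4)=-X_4$, $D_6(X_5)=0$, $D_6(X_6)=X_6$. *)

theory Defs
  imports Complex_Main "HOL-Library.Poly_Mapping" "HOL-Algebra.QuotRing" "HOL-Algebra.Module"
begin

text \<open>
  Lists form the free monoid under concatenation, written additively as the
  convolution product of \<^theory>\<open>HOL-Library.Poly_Mapping\<close> requires. Hence
  \<open>'x list \<Rightarrow>\<^sub>0 complex\<close> is the free associative unital \<open>\<complex>\<close>-algebra on \<open>'x\<close>:
  finitely supported functions on words, multiplied by concatenating words.
\<close>

instantiation list :: (type) monoid_add
begin

definition zero_list :: "'a list" where "zero_list = []"

definition plus_list :: "'a list \<Rightarrow> 'a list \<Rightarrow> 'a list" where "plus_list = (@)"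

instance by standard (simp_all add: zero_list_def plus_list_def)

end

definition free_algebra :: "(complex, 'x list \<Rightarrow>\<^sub>0 complex) module" where
  "free_algebra = \<lparr>carrier = UNIV, mult = (*), one = 1, zero = 0, add = (+),
     smult = (\<lambda>c. Poly_Mapping.map ((*) c))\<rparr>"

definition quotient_algebra ::
    "(complex, 'a, 'm) module_scheme \<Rightarrow> 'a set \<Rightarrow> (complex, 'a set) module" where
  "quotient_algebra A I = ring.extend (A Quot I)
     (module.fields (\<lambda>c X. \<Union>x\<in>X. I +>\<^bsub>A\<^esub> (c \<odot>\<^bsub>A\<^esub> x)))"

text \<open>
  Derivations are extensional, i.e. \<open>undefined\<close> outside the carrier, so that equality
  of derivations is equality of functions.
\<close>

definition derivations :: "(complex, 'a, 'm) module_scheme \<Rightarrow> ('a \<Rightarrow> 'a) set" where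
  "derivations A = {D \<in> carrier A \<rightarrow>\<^sub>E carrier A.
     (\<forall>x\<in>carrier A. \<forall>y\<in>carrier A. D (x \<oplus>\<^bsub>A\<^esub> y) = D x \<oplus>\<^bsub>A\<^esub> D y) \<and>
     (\<forall>c. \<forall>x\<in>carrier A. D (c \<odot>\<^bsub>A\<^esub> x) = c \<odot>\<^bsub>A\<^esub> D x) \<and>
     (\<forall>x\<in>carrier A. \<forall>y\<in>carrier A. D (x \<otimes>\<^bsub>A\<^esub> y) = D x \<otimes>\<^bsub>A\<^esub> y \<oplus>\<^bsub>A\<^esub> x \<otimes>\<^bsub>A\<^esub> D y)}"

definition ad :: "(complex, 'a, 'm) module_scheme \<Rightarrow> 'a \<Rightarrow> 'a \<Rightarrow> 'a" where
  "ad A g = (\<lambda>x\<in>carrier A. g \<otimes>\<^bsub>A\<^esub> x \<ominus>\<^bsub>A\<^esub> x \<otimes>\<^bsub>A\<^esub> g)"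

datatype letter = E1 | E2

type_synonym free2 = "letter list \<Rightarrow>\<^sub>0 complex"

definition gen :: "letter \<Rightarrow> free2" where
  "gen x = Poly_Mapping.single [x] 1"

definition scalar :: "complex \<Rightarrow> free2" where
  "scalar c = Poly_Mapping.single [] c"

definition serre_relations :: "complex \<Rightarrow> complex \<Rightarrow> free2 set" where
  "serre_relations r s = (let e1 = gen E1; e2 = gen E2 in
     {e2^2 * e1
        - scalar (1 / r^3 + 1 / s^3) * (e2 * e1 * e2)
        + scalar (1 / (r * s)^3) * (e1 * e2^2),
      e1^4 * e2
        - scalar ((r + s) * (r^2 + s^2)) * (e1^3 * e2 * e1)
        + scalar (r * s * (r^2 + s^2) * (r^2 + r * s + s^2)) * (e1^2 * e2 * e1^2)
        - scalar ((r * s)^3 * (r + s) * (r^2 + s^2)) * (e1 * e2 * e1^3)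
        + scalar ((r * s)^6) * (e2 * e1^4)})"

definition serre_ideal :: "complex \<Rightarrow> complex \<Rightarrow> free2 set" where
  "serre_ideal r s = Idl\<^bsub>free_algebra\<^esub> (serre_relations r s)"

definition U :: "complex \<Rightarrow> complex \<Rightarrow> (complex, free2 set) module" where
  "U r s = quotient_algebra free_algebra (serre_ideal r s)"

definition X1 :: "complex \<Rightarrow> complex \<Rightarrow> free2 set" where
  "X1 r s = serre_ideal r s +>\<^bsub>free_algebra\<^esub> gen E1"

definition X6 :: "complex \<Rightarrow> complex \<Rightarrow> free2 set" where
  "X6 r s = serre_ideal r s +>\<^bsub>free_algebra\<^esub> gen E2"

definition X5 :: "complex \<Rightarrow> complex \<Rightarrow> free2 set" where
  "X5 r s = X1 r s \<otimes>\<^bsub>U r s\<^esub> X6 r s \<ominus>\<^bsub>U r s\<^esub> s^3 \<odot>\<^bsub>U r s\<^esub> (X6 r s \<otimes>\<^bsub>U r s\<^esub> X1 r s)"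

definition X3 :: "complex \<Rightarrow> complex \<Rightarrow> free2 set" where
  "X3 r s = X1 r s \<otimes>\<^bsub>U r s\<^esub> X5 r s \<ominus>\<^bsub>U r s\<^esub> (r * s^2) \<odot>\<^bsub>U r s\<^esub> (X5 r s \<otimes>\<^bsub>U r s\<^esub> X1 r s)"

definition X2 :: "complex \<Rightarrow> complex \<Rightarrow> free2 set" where
  "X2 r s = X1 r s \<otimes>\<^bsub>U r s\<^esub> X3 r s \<ominus>\<^bsub>U r s\<^esub> (r^2 * s) \<odot>\<^bsub>U r s\<^esub> (X3 r s \<otimes>\<^bsub>U r s\<^esub> X1 r s)"

definition X4 :: "complex \<Rightarrow> complex \<Rightarrow> free2 set" where
  "X4 r s = X3 r s \<otimes>\<^bsub>U r s\<^esub> X5 r s \<ominus>\<^bsub>U r s\<^esub> (r^2 * s) \<odot>\<^bsub>U r s\<^esub> (X5 r s \<otimes>\<^bsub>U r s\<^esub> X3 r s)"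

text \<open>
  The descriptions below are proper: uniqueness holds because \<open>X1\<close> and \<open>X6\<close> generate
  \<open>U\<close>, existence because the defining relations are homogeneous in each generator.
\<close>

definition D5 :: "complex \<Rightarrow> complex \<Rightarrow> free2 set \<Rightarrow> free2 set" where
  "D5 r s = (THE D. D \<in> derivations (U r s) \<and>
     D (X1 r s) = X1 r s \<and>
     D (X2 r s) = 3 \<odot>\<^bsub>U r s\<^esub> X2 r s \<and>
     D (X3 r s) = 2 \<odot>\<^bsub>U r s\<^esub> X3 r s \<and>
     D (X4 r s) = 3 \<odot>\<^bsub>U r s\<^esub> X4 r s \<and>
     D (X5 r s) = X5 r s \<and>
     D (X6 r s) = \<zero>\<^bsub>U r s\<^esub>)"

definition D6 :: "complex \<Rightarrow> complex \<Rightarrow> free2 set \<Rightarrow> free2 set" where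
  "D6 r s = (THE D. D \<in> derivations (U r s) \<and>
     D (X1 r s) = (- 1) \<odot>\<^bsub>U r s\<^esub> X1 r s \<and>
     D (X2 r s) = (- 2) \<odot>\<^bsub>U r s\<^esub> X2 r s \<and>
     D (X3 r s) = (- 1) \<odot>\<^bsub>U r s\<^esub> X3 r s \<and>
     D (X4 r s) = (- 1) \<odot>\<^bsub>U r s\<^esub> X4 r s \<and>
     D (X5 r s) = \<zero>\<^bsub>U r s\<^esub> \<and>
     D (X6 r s) = X6 r s)"

definition decomposes ::
    "complex \<Rightarrow> complex \<Rightarrow> (free2 set \<Rightarrow> free2 set) \<Rightarrow> free2 set \<Rightarrow> complex \<Rightarrow> complex \<Rightarrow> bool" where
  "decomposes r s D g a b \<longleftrightarrow> g \<in> carrier (U r s) \<and>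
     D = (\<lambda>x\<in>carrier (U r s). ad (U r s) g x \<oplus>\<^bsub>U r s\<^esub>
            a \<odot>\<^bsub>U r s\<^esub> D5 r s x \<oplus>\<^bsub>U r s\<^esub> b \<odot>\<^bsub>U r s\<^esub> D6 r s x)"

end

theory Submission
  imports Defs "HOL-Library.Product_Plus" "HOL-Library.Product_Lexorder"
begin

text \<open>
  The algebra is realised on the space of ordered monomials \<open>X\<^sub>6\<^sup>a\<^sup>6 \<dots> X\<^sub>1\<^sup>a\<^sup>1\<close>: explicit difference
  operators satisfy the Serre relations, and straightening shows that nothing else is killed. Leading
  monomials in the lexicographic order multiply up to nonzero scalars.

  There are two normal elements \<open>z\<close>, with leading monomials \<open>X\<^sub>5 X\<^sub>3 X\<^sub>1\<close> and \<open>X\<^sub>6 X\<^sub>4 X\<^sub>2\<close>, such that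
  \<open>z x = \<chi>(deg x) x z\<close> for homogeneous \<open>x\<close>, where \<open>\<chi>\<close> is a character of \<open>\<int>\<^sup>2\<close>. If \<open>D\<close> is a
  derivation of degree \<open>c\<close>, applying \<open>D\<close> to this relation gives
  \<open>D(z) x - \<chi>(deg x) x D(z) = \<chi>(deg x) (1 - \<chi>(c)) D(x) z\<close>. Comparing leading terms, the left-hand
  side can lie in the ideal of \<open>z\<close> for all \<open>x\<close> only if \<open>D(z) = u z\<close> or \<open>c = 0\<close>; in the former case
  \<open>D = ad (u / (1 - \<chi>(c)))\<close>. The two characters have no common nonzero \<open>c\<close> with \<open>\<chi>(c) = 1\<close>, so
  every homogeneous derivation of nonzero degree is inner. A derivation of degree zero scales the
  two generators, hence is a combination of \<open>D\<^sub>5\<close> and \<open>D\<^sub>6\<close>.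
\<close>

subsection \<open>Linear maps between spaces of finitely supported functions\<close>

text \<open>The argument depends on the two normal elements not being central. Both characters take
  their values in the powers of \<open>r * s\<close>, which is not a root of unity; at
  \<open>r * s = 1\<close> they would be trivial, and the division by \<open>1 - \<chi>(c)\<close>
  impossible. That leading terms decide the matter is due to the multiplicative independence of
  \<open>r\<close> and \<open>s\<close>. Modulo lower terms the \<open>X\<^sub>i\<close> commute up
  to monomials in \<open>r\<close> and \<open>s\<close>. If a remainder of \<open>D(z)\<close>
  modulo \<open>z\<close> has a leading monomial not divisible by that of \<open>z\<close>, this
  monomial must commute with every \<open>X\<^sub>i\<close> absent from the leading monomial of
  \<open>z\<close> by the same scalar as \<open>z\<close> does. For each such
  \<open>X\<^sub>i\<close> the exponents of \<open>r\<close> and of \<open>s\<close> give two linear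
  equations. Three generators are absent, and the six equations force the degree of
  \<open>D(z)\<close> to be that of \<open>z\<close>, hence \<open>c = 0\<close>. The basis is
  indispensable because \<open>U\<close> is given by generators and relations: neither leading terms
  nor the absence of zero divisors are visible until the ordered monomials are known to be
  independent.\<close>

abbreviation lookup :: "('a \<Rightarrow>\<^sub>0 complex) \<Rightarrow> 'a \<Rightarrow> complex" where
  "lookup \<equiv> Poly_Mapping.lookup"

abbreviation keys :: "('a \<Rightarrow>\<^sub>0 complex) \<Rightarrow> 'a set" where
  "keys \<equiv> Poly_Mapping.keys"

definition scale :: "complex \<Rightarrow> ('a \<Rightarrow>\<^sub>0 complex) \<Rightarrow> 'a \<Rightarrow>\<^sub>0 complex" where
  "scale c v = Poly_Mapping.map ((*) c) v"

abbreviation delta :: "'a \<Rightarrow> 'a \<Rightarrow>\<^sub>0 complex" where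
  "delta k \<equiv> Poly_Mapping.single k 1"

lemma lookup_scale [simp]: "lookup (scale c v) k = c * lookup v k"
  by (cases "lookup v k = 0") (simp_all add: scale_def Poly_Mapping.map.rep_eq)

lemma scale_single: "scale c (Poly_Mapping.single k d) = Poly_Mapping.single k (c * d)"
  by (rule poly_mapping_eqI) (simp add: lookup_single when_def)

lemma scale_delta: "scale c (delta k) = Poly_Mapping.single k c"
  by (simp add: scale_single)

lemma scale_simps [simp]:
  "scale 0 v = 0" "scale c 0 = 0" "scale 1 v = v" "scale c (scale d v) = scale (c * d) v"
  by (auto intro: poly_mapping_eqI)

lemma scale_distrib:
  "scale c (u + v) = scale c u + scale c v" "scale c (u - v) = scale c u - scale c v"
  "scale (c + d) v = scale c v + scale d v" "scale (c - d) v = scale c v - scale d v"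
  "scale c (- v) = - scale c v" "scale (- c) v = - scale c v"
  by (auto intro!: poly_mapping_eqI simp: lookup_add lookup_minus algebra_simps)

lemma scale_sum: "scale c (\<Sum>i\<in>A. f i) = (\<Sum>i\<in>A. scale c (f i))"
  by (rule poly_mapping_eqI) (simp add: lookup_sum sum_distrib_left)

lemma scale_eq_iff: "c \<noteq> 0 \<Longrightarrow> scale c u = scale c v \<longleftrightarrow> u = v"
  by (metis scale_simps(3,4) left_inverse)

definition lin :: "(('a \<Rightarrow>\<^sub>0 complex) \<Rightarrow> 'b \<Rightarrow>\<^sub>0 complex) \<Rightarrow> bool" where
  "lin f \<longleftrightarrow> (\<forall>u v. f (u + v) = f u + f v) \<and> (\<forall>c v. f (scale c v) = scale c (f v))"

lemma lin_add: "lin f \<Longrightarrow> f (u + v) = f u + f v"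
  and lin_scale: "lin f \<Longrightarrow> f (scale c v) = scale c (f v)"
  by (simp_all add: lin_def)

lemma lin_zero: "lin f \<Longrightarrow> f 0 = 0"
  using lin_scale[of f 0 0] by simp

lemma lin_uminus: "lin f \<Longrightarrow> f (- v) = - f v"
  using lin_scale[of f "-1" v] by (simp add: scale_distrib)

lemma lin_diff: "lin f \<Longrightarrow> f (u - v) = f u - f v"
  using lin_add[of f u "- v"] by (simp add: lin_uminus)

lemma lin_sum: "lin f \<Longrightarrow> f (\<Sum>i\<in>A. g i) = (\<Sum>i\<in>A. f (g i))"
  by (induction A rule: infinite_finite_induct) (simp_all add: lin_zero lin_add)

lemmas lin_simps = lin_add lin_scale lin_zero lin_uminus lin_diff

lemma lin_id: "lin (\<lambda>v. v)"
  and lin_comp: "lin f \<Longrightarrow> lin g \<Longrightarrow> lin (\<lambda>v. f (g v))"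
  and lin_plus: "lin g \<Longrightarrow> lin h \<Longrightarrow> lin (\<lambda>v. g v + h v)"
  and lin_minus: "lin g \<Longrightarrow> lin h \<Longrightarrow> lin (\<lambda>v. g v - h v)"
  and lin_scaled: "lin g \<Longrightarrow> lin (\<lambda>v. scale c (g v))"
  by (simp_all add: lin_def scale_distrib algebra_simps)

lemma decompose:
  assumes "finite A" "keys v \<subseteq> A"
  shows "v = (\<Sum>k\<in>A. scale (lookup v k) (delta k))"
proof (rule poly_mapping_eqI)
  fix j
  have "lookup (\<Sum>k\<in>A. scale (lookup v k) (delta k)) j = (\<Sum>k\<in>A. if k = j then lookup v k else 0)"
    by (simp add: lookup_sum lookup_single when_def if_distrib cong: if_cong)
  also have "\<dots> = lookup v j"
    using assms by (auto simp: sum.delta in_keys_iff subset_iff)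
  finally show "lookup v j = lookup (\<Sum>k\<in>A. scale (lookup v k) (delta k)) j" ..
qed

lemma basis_induct [case_names delta add scale zero]:
  assumes "\<And>k. k \<in> keys v \<Longrightarrow> P (delta k)"
    and "\<And>u v. P u \<Longrightarrow> P v \<Longrightarrow> P (u + v)" and "\<And>c v. P v \<Longrightarrow> P (scale c v)" and "P 0"
  shows "P v"
proof -
  have "P (\<Sum>k\<in>A. scale (lookup v k) (delta k))" if "A \<subseteq> keys v" for A
    using finite_subset[OF that finite_keys] that by (induction A) (auto intro: assms)
  then show ?thesis
    using decompose[of "keys v" v] by (metis finite_keys order_refl)
qed

text \<open>Agreement is required only on the support of \<open>v\<close>, so that properties of
  \<open>v\<close> such as homogeneity can be used on each basis vector.\<close>

lemma lin_eqI:
  assumes "lin f" "lin g" "\<And>k. k \<in> keys v \<Longrightarrow> f (delta k) = g (delta k)"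
  shows "f v = g v"
proof -
  have v: "v = (\<Sum>k\<in>keys v. scale (lookup v k) (delta k))"
    by (rule decompose) auto
  show ?thesis
    by (subst (1 2) v) (simp add: lin_sum lin_scale assms)
qed

definition lext :: "('a \<Rightarrow> 'b \<Rightarrow>\<^sub>0 complex) \<Rightarrow> ('a \<Rightarrow>\<^sub>0 complex) \<Rightarrow> 'b \<Rightarrow>\<^sub>0 complex" where
  "lext f v = (\<Sum>k\<in>keys v. scale (lookup v k) (f k))"

lemma lext_superset:
  "finite A \<Longrightarrow> keys v \<subseteq> A \<Longrightarrow> lext f v = (\<Sum>k\<in>A. scale (lookup v k) (f k))"
  unfolding lext_def by (rule sum.mono_neutral_left) (auto simp: in_keys_iff)

lemma lin_lext: "lin (lext f)"
  unfolding lin_def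
proof (intro conjI allI)
  fix u v :: "'a \<Rightarrow>\<^sub>0 complex"
  let ?A = "keys u \<union> keys v"
  have "lext f (u + v) = (\<Sum>k\<in>?A. scale (lookup (u + v) k) (f k))"
    using keys_add[of u v] by (intro lext_superset) auto
  also have "\<dots> = lext f u + lext f v"
    using lext_superset[of ?A u f] lext_superset[of ?A v f]
    by (simp add: lookup_add scale_distrib sum.distrib)
  finally show "lext f (u + v) = lext f u + lext f v" .
next
  fix c and v :: "'a \<Rightarrow>\<^sub>0 complex"
  have "lext f (scale c v) = (\<Sum>k\<in>keys v. scale (lookup (scale c v) k) (f k))"
    by (intro lext_superset) (auto simp: in_keys_iff)
  then show "lext f (scale c v) = scale c (lext f v)"
    by (simp add: lext_def scale_sum)
qed

lemma lext_delta [simp]: "lext f (delta k) = f k"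
  by (simp add: lext_def)

lemma lin_lext_fun:
  assumes "\<And>k. lin (f k)"
  shows "lin (\<lambda>v. lext (\<lambda>k. f k v) x)"
  by (simp add: lin_def lext_def lin_simps[OF assms] scale_distrib scale_sum sum.distrib
      mult.commute)

lemma lin_lext_unique: "lin f \<Longrightarrow> f v = lext (\<lambda>k. f (delta k)) v"
  by (rule lin_eqI) (auto intro: lin_lext)

subsection \<open>Operators that shift exponents\<close>

type_synonym idx = "nat \<times> nat \<times> nat \<times> nat \<times> nat \<times> nat"
type_synonym zidx = "int \<times> int \<times> int \<times> int \<times> int \<times> int"
type_synonym vec = "idx \<Rightarrow>\<^sub>0 complex"
type_synonym opterm = "zidx \<times> (zidx \<Rightarrow> complex)"

declare split_paired_All [simp del] split_paired_Ex [simp del]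

definition zi :: "idx \<Rightarrow> zidx" where
  "zi = (\<lambda>(a1, a2, a3, a4, a5, a6). (int a1, int a2, int a3, int a4, int a5, int a6))"

definition zn :: "zidx \<Rightarrow> idx" where
  "zn = (\<lambda>(a1, a2, a3, a4, a5, a6). (nat a1, nat a2, nat a3, nat a4, nat a5, nat a6))"

definition nonneg :: "zidx \<Rightarrow> bool" where
  "nonneg = (\<lambda>(a1, a2, a3, a4, a5, a6). 0 \<le> a1 \<and> 0 \<le> a2 \<and> 0 \<le> a3 \<and> 0 \<le> a4 \<and> 0 \<le> a5 \<and> 0 \<le> a6)"

lemma zi_zn: "nonneg t \<Longrightarrow> zi (zn t) = t"
  by (auto simp: zi_def zn_def nonneg_def split: prod.splits)

lemma zn_zi [simp]: "zn (zi a) = a"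
  by (auto simp: zi_def zn_def split: prod.splits)

lemma zi_add: "zi (a + b) = zi a + zi b"
  by (auto simp: zi_def split: prod.splits)

lemma zi_less_iff: "zi a < zi b \<longleftrightarrow> a < b"
  by (cases a rule: prod_cases6, cases b rule: prod_cases6) (simp add: zi_def)

lemma zidx_add_less_iff: "(a :: zidx) + b < a + c \<longleftrightarrow> b < c"
  by (cases a rule: prod_cases6, cases b rule: prod_cases6, cases c rule: prod_cases6) simp

lemma idx_add_less_iff: "(a :: idx) + b < a + c \<longleftrightarrow> b < c"
  by (cases a rule: prod_cases6, cases b rule: prod_cases6, cases c rule: prod_cases6) simp

lemma idx_add_le_iff: "(a :: idx) + b \<le> a + c \<longleftrightarrow> b \<le> c"
  by (cases a rule: prod_cases6, cases b rule: prod_cases6, cases c rule: prod_cases6) simp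

lemma idx_add_mono:
  assumes "(a :: idx) \<le> b" "c \<le> d"
  shows "a + c \<le> b + d"
proof -
  have "a + c \<le> a + d" using assms(2) by (simp only: idx_add_le_iff)
  also have "a + d = d + a" by (rule add.commute)
  also have "d + a \<le> d + b" using assms(1) by (simp only: idx_add_le_iff)
  also have "d + b = b + d" by (rule add.commute)
  finally show ?thesis .
qed

text \<open>
  A list of pairs \<open>(t, w)\<close> stands for the operator \<open>\<delta>\<^sub>a \<mapsto> \<Sum> w(a) \<delta>\<^sub>a\<^sub>+\<^sub>t\<close>. Exponents are
  computed with as integers, so that identities between such operators can be checked without
  truncated subtraction; \<open>valid\<close> says that terms leading out of the nonnegative range vanish.
\<close>

definition term_op :: "opterm list \<Rightarrow> vec \<Rightarrow> vec" where
  "term_op ts = lext (\<lambda>b. \<Sum>(t, w)\<leftarrow>ts. Poly_Mapping.single (zn (zi b + t)) (w (zi b)))"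

definition valid :: "opterm list \<Rightarrow> bool" where
  "valid ts \<longleftrightarrow> (\<forall>(t, w)\<in>set ts. \<forall>b. w (zi b) \<noteq> 0 \<longrightarrow> nonneg (zi b + t))"

text \<open>Composition produces lists in which a shift occurs several times. Collecting its weights
  gives a normal form by which lists can be compared; \<open>term_op_coef\<close> shows that the
  operator depends on nothing else.\<close>

definition coef :: "opterm list \<Rightarrow> zidx \<Rightarrow> zidx \<Rightarrow> complex" where
  "coef ts t a = (\<Sum>(t', w)\<leftarrow>ts. if t' = t then w a else 0)"

definition comp_terms :: "opterm list \<Rightarrow> opterm list \<Rightarrow> opterm list" where
  "comp_terms ts us =
     concat (map (\<lambda>(u, v). map (\<lambda>(t, w). (t + u, \<lambda>a. w (a + u) * v a)) ts) us)"

lemma coef_Nil: "coef [] t a = 0"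
  and coef_Cons: "coef ((t', w) # ts) t a = (if t' = t then w a else 0) + coef ts t a"
  and coef_append: "coef (ts @ us) t a = coef ts t a + coef us t a"
  by (simp_all add: coef_def)

lemma coef_comp_terms:
  "coef (comp_terms ts us) t a = (\<Sum>(u, v)\<leftarrow>us. coef ts (t - u) (a + u) * v a)"
proof -
  have *: "coef (map (\<lambda>(t, w). (t + u, \<lambda>a. w (a + u) * v a)) ts) t a
      = coef ts (t - u) (a + u) * v a" for u v
    by (induction ts) (auto simp: coef_def algebra_simps)
  show ?thesis
    unfolding comp_terms_def by (induction us) (auto simp: coef_append * coef_Nil)
qed

lemma comp_terms_shifts:
  "t \<in> fst ` set (comp_terms ts us) \<longleftrightarrow> (\<exists>u\<in>fst ` set us. \<exists>t'\<in>fst ` set ts. t = t' + u)"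
  (is "?l = ?r")
proof -
  have "fst ` set (comp_terms ts us) = (\<Union>x\<in>set us. (\<lambda>y. fst y + fst x) ` set ts)"
    by (simp only: comp_terms_def set_concat set_map image_UN image_image case_prod_unfold fst_conv)
  then have "?l = (\<exists>x\<in>set us. \<exists>y\<in>set ts. t = fst y + fst x)"
    by (simp only: UN_iff image_iff)
  also have "\<dots> = ?r" by (simp only: bex_simps)
  finally show ?thesis .
qed

lemma lin_term_op: "lin (term_op ts)"
  by (simp add: term_op_def lin_lext)

lemma term_op_delta:
  "term_op ts (delta b) = (\<Sum>(t, w)\<leftarrow>ts. Poly_Mapping.single (zn (zi b + t)) (w (zi b)))"
  by (simp add: term_op_def)

lemma term_op_coef:
  assumes "finite T" "fst ` set ts \<subseteq> T"
  shows "term_op ts (delta b) = (\<Sum>t\<in>T. Poly_Mapping.single (zn (zi b + t)) (coef ts t (zi b)))"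
  using assms(2) unfolding term_op_delta
proof (induction ts)
  case (Cons x ts)
  obtain t w where x: "x = (t, w)" by fastforce
  have "(\<Sum>t'\<in>T. Poly_Mapping.single (zn (zi b + t')) (if t = t' then w (zi b) else 0))
      = (\<Sum>t'\<in>T. if t = t' then Poly_Mapping.single (zn (zi b + t')) (w (zi b)) else 0)"
    by (intro sum.cong) auto
  also have "\<dots> = Poly_Mapping.single (zn (zi b + t)) (w (zi b))"
    using Cons.prems x assms(1) by simp
  finally show ?case
    using Cons by (simp add: x coef_Cons single_add sum.distrib)
qed (simp add: coef_Nil)

text \<open>The intermediate exponent passes through \<open>zn\<close>. Where the inner weight is
  nonzero, \<open>valid\<close> keeps that exponent nonnegative and \<open>zn\<close> loses nothing;
  where it is zero, neither side has a contribution.\<close>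

lemma term_op_comp:
  assumes "valid us"
  shows "term_op ts (term_op us v) = term_op (comp_terms ts us) v"
proof (rule lin_eqI[where f = "\<lambda>v. term_op ts (term_op us v)"])
  fix b
  have *: "term_op ts (Poly_Mapping.single (zn (zi b + u)) (c (zi b)))
      = (\<Sum>(t, w)\<leftarrow>ts. Poly_Mapping.single (zn (zi b + (t + u))) (w (zi b + u) * c (zi b)))"
    if "(u, c) \<in> set us" for u c
  proof (cases "c (zi b) = 0")
    case False
    then have "zi (zn (zi b + u)) = zi b + u"
      using assms that by (intro zi_zn) (auto simp: valid_def)
    moreover have "term_op ts (scale (c (zi b)) (delta k))
        = (\<Sum>(t, w)\<leftarrow>ts. Poly_Mapping.single (zn (zi k + t)) (w (zi k) * c (zi b)))" for k
      unfolding lin_scale[OF lin_term_op] term_op_delta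
      by (induction ts) (auto simp: scale_distrib scale_single mult.commute)
    ultimately show ?thesis by (simp add: scale_delta algebra_simps)
  qed (auto simp: lin_zero[OF lin_term_op] case_prod_unfold)
  have "term_op ts (\<Sum>(t, w)\<leftarrow>us'. Poly_Mapping.single (zn (zi b + t)) (w (zi b)))
      = term_op (comp_terms ts us') (delta b)" if "set us' \<subseteq> set us" for us'
    using that
  proof (induction us')
    case (Cons x us')
    then show ?case
      by (cases x) (auto simp: comp_terms_def lin_add[OF lin_term_op] * term_op_delta o_def
          case_prod_unfold)
  qed (simp add: comp_terms_def term_op_delta lin_zero[OF lin_term_op])
  then show "term_op ts (term_op us (delta b)) = term_op (comp_terms ts us) (delta b)"
    by (simp add: term_op_delta)
qed (auto intro: lin_comp lin_term_op)

text \<open>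
  The shifts of \<open>ts\<close> after \<open>us\<close> are those of \<open>us\<close> after \<open>ts\<close>, so only finitely many
  coefficients have to be compared.
\<close>

lemma term_op_commutation:
  assumes "valid ts" "valid us"
    and vs: "\<forall>t\<in>fst ` set vs. \<exists>u\<in>fst ` set us. \<exists>t'\<in>fst ` set ts. t = t' + u"
    and eq: "\<And>a1 a2 a3 a4 a5 a6. \<forall>u\<in>set (map fst us). \<forall>t\<in>set (map fst ts).
      coef (comp_terms ts us) (t + u) (a1, a2, a3, a4, a5, a6)
      = c * coef (comp_terms us ts) (t + u) (a1, a2, a3, a4, a5, a6)
        + d * coef vs (t + u) (a1, a2, a3, a4, a5, a6)"
  shows "term_op ts (term_op us v) = scale c (term_op us (term_op ts v)) + scale d (term_op vs v)"
proof -
  let ?T = "fst ` set (comp_terms ts us)"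
  have us_ts: "fst ` set (comp_terms us ts) = ?T"
  proof (intro equalityI subsetI)
    fix t assume "t \<in> fst ` set (comp_terms us ts)"
    then obtain u t' where "u \<in> fst ` set ts" "t' \<in> fst ` set us" "t = t' + u"
      unfolding comp_terms_shifts by (elim bexE)
    then show "t \<in> ?T"
      unfolding comp_terms_shifts add.commute[of t' u] by (intro bexI)
  next
    fix t assume "t \<in> ?T"
    then obtain u t' where "u \<in> fst ` set us" "t' \<in> fst ` set ts" "t = t' + u"
      unfolding comp_terms_shifts by (elim bexE)
    then show "t \<in> fst ` set (comp_terms us ts)"
      unfolding comp_terms_shifts add.commute[of t' u] by (intro bexI)
  qed
  have vs_T: "fst ` set vs \<subseteq> ?T"
  proof
    fix t assume "t \<in> fst ` set vs"
    then show "t \<in> ?T" unfolding comp_terms_shifts by (rule vs[THEN bspec])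
  qed
  have eq': "coef (comp_terms ts us) t a = c * coef (comp_terms us ts) t a + d * coef vs t a"
    if "t \<in> ?T" for t a
  proof -
    obtain a1 a2 a3 a4 a5 a6 where a: "a = (a1, a2, a3, a4, a5, a6)" by (rule prod_cases6)
    from that obtain u t' where "u \<in> set (map fst us)" "t' \<in> set (map fst ts)" and t: "t = t' + u"
      unfolding comp_terms_shifts set_map by (elim bexE)
    then show ?thesis unfolding a t by (intro eq[THEN bspec, THEN bspec])
  qed
  show ?thesis
    unfolding term_op_comp[OF assms(1)] term_op_comp[OF assms(2)]
  proof (rule lin_eqI[where g = "\<lambda>v. scale c (term_op (comp_terms us ts) v) + scale d (term_op vs v)"])
    fix b
    have "(\<Sum>t\<in>?T. Poly_Mapping.single (zn (zi b + t)) (coef (comp_terms ts us) t (zi b)))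
        = (\<Sum>t\<in>?T. scale c (Poly_Mapping.single (zn (zi b + t)) (coef (comp_terms us ts) t (zi b)))
            + scale d (Poly_Mapping.single (zn (zi b + t)) (coef vs t (zi b))))"
      by (rule sum.cong[OF refl]) (simp only: eq' scale_single single_add)
    then show "term_op (comp_terms ts us) (delta b)
        = scale c (term_op (comp_terms us ts) (delta b)) + scale d (term_op vs (delta b))"
      using term_op_coef[OF finite_imageI[OF finite_set] order_refl, of "comp_terms ts us" b]
        term_op_coef[OF finite_imageI[OF finite_set] vs_T, of b]
        term_op_coef[OF finite_imageI[OF finite_set] eq_refl[OF us_ts], of b]
      by (simp only: scale_sum sum.distrib)
  qed (rule lin_term_op lin_plus lin_scaled)+
qed

lemma keys_sum_list:
  assumes "k \<in> keys (\<Sum>x\<leftarrow>xs. f x)"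
  obtains x where "x \<in> set xs" "k \<in> keys (f x)"
  using assms
proof (induction xs arbitrary: thesis)
  case (Cons x xs)
  then show ?case using keys_add[of "f x" "\<Sum>x\<leftarrow>xs. f x"] by auto
qed simp

lemma keys_lext:
  assumes "j \<in> keys (lext f v)"
  obtains k where "k \<in> keys v" "j \<in> keys (f k)"
proof -
  have "(\<Sum>k\<in>keys v. lookup v k * lookup (f k) j) \<noteq> 0"
    using assms by (simp add: in_keys_iff lext_def lookup_sum)
  then obtain k where "k \<in> keys v" "lookup v k * lookup (f k) j \<noteq> 0"
    by (meson sum.neutral)
  then show thesis using that by (auto simp: in_keys_iff)
qed

lemma keys_term_op:
  assumes "valid ts" "k \<in> keys (term_op ts v)"
  shows "\<exists>a\<in>keys v. \<exists>t\<in>fst ` set ts. zi k = zi a + t"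
proof -
  obtain a where a: "a \<in> keys v"
    and "k \<in> keys (\<Sum>x\<leftarrow>ts. Poly_Mapping.single (zn (zi a + fst x)) (snd x (zi a)))"
    using assms(2) unfolding term_op_def case_prod_unfold by (rule keys_lext)
  then obtain x where x: "x \<in> set ts"
    and "k \<in> keys (Poly_Mapping.single (zn (zi a + fst x)) (snd x (zi a)))"
    by (elim keys_sum_list)
  then have w: "snd x (zi a) \<noteq> 0" and k: "k = zn (zi a + fst x)"
    by (auto split: if_splits)
  have "nonneg (zi a + fst x)"
    using assms(1) x w by (auto simp: valid_def case_prod_unfold)
  then have "zi k = zi a + fst x"
    by (simp add: k zi_zn)
  with a imageI[OF x] show ?thesis by (intro bexI)
qed

subsection \<open>Commutation relations that follow from the Serre relations\<close>

text \<open>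
  \<open>p12\<close> and \<open>p56\<close> are the defects of the two Serre relations. Each further commutation
  relation is exhibited as a two-sided combination of defects found earlier, by applying
  \<open>x \<mapsto> y1 * x - c * x * y1\<close> to a known relation or by resolving the overlap \<open>y2 * y5 * y6\<close>.
\<close>

locale pbw_ring =
  fixes r s y1 y2 y3 y4 y5 y6 p12 p56 :: "'a::ring_1"
  assumes sr: "s * r = r * s"
    and cr: "y1 * r = r * y1" "y2 * r = r * y2" "y3 * r = r * y3" "y4 * r = r * y4" "y5 * r = r * y5"
        "y6 * r = r * y6"
    and cs: "y1 * s = s * y1" "y2 * s = s * y2" "y3 * s = s * y3" "y4 * s = s * y4" "y5 * s = s * y5"
        "y6 * s = s * y6"
    and h16: "y1 * y6 = s^3 * y6 * y1 + (r^3 - s^3) * y5"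
    and h15: "y1 * y5 = r * s^2 * y5 * y1 + (r^2 - s^2) * y3"
    and h13: "y1 * y3 = r^2 * s * y3 * y1 + (r - s) * y2"
    and h35: "y3 * y5 = r^2 * s * y5 * y3 + (r - s) * y4"
    and h12: "y1 * y2 = r^3 * y2 * y1 + p12"
    and h56: "y5 * y6 = r^3 * y6 * y5 + p56"
begin

lemma left_comm:
  assumes "x * y = y * x" shows "x * (y * z) = y * (x * (z::'a))"
  using assms by (metis mult.assoc)

lemmas scalar_rules = sr cr cs left_comm[OF sr] cr[THEN left_comm] cs[THEN left_comm]

lemma apply_left: assumes "x * y = (z::'a)" shows "x * (y * w) = z * w"
  using assms by (metis mult.assoc)

lemmas norm = algebra_simps power2_eq_square power3_eq_cube power_numeral_reduce

text \<open>The scalar \<open>r * s^5\<close> is \<open>r * s^2\<close> times \<open>s^3\<close>,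
  the factors with which \<open>y1\<close> passes \<open>y5\<close> and \<open>y6\<close>. With this
  choice the terms that still contain \<open>y1\<close> cancel, and only the corrections from the
  two brackets remain. The scalars applied to \<open>p36\<close>, \<open>p26\<close>,
  \<open>p25\<close> and \<open>p45\<close> below arise in the same way.\<close>

lemma rel36:
  shows "(r^2 - s^2) * (y3 * y6 - (r^3 * s^3 * y6 * y3 + r * (r^3 - s^3) * y5 * y5))
      = y1 * p56 - r * s^5 * p56 * y1"
proof -
  have p: "p56 = y5 * y6 - r^3 * y6 * y5" using h56 by simp
  show ?thesis unfolding p by (simp add: scalar_rules norm h16 h15 h16[THEN apply_left] h15[THEN apply_left])
qed

lemma rel26:
  assumes h36: "y3 * y6 = r^3 * s^3 * y6 * y3 + r * (r^3 - s^3) * y5 * y5 + p36"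
  shows "(r - s) * (y2 * y6 - (r^3 * s^6 * y6 * y2
      + r^2 * s * (r^2 + r * s + s^2) * (r^3 - s^3) * y5 * y3
          + r * (r^2 - r * s - s^2) * (r^3 - s^3) * y4)) = y1 * p36 - r^2 * s^4 * p36 * y1"
proof -
  have p: "p36 = y3 * y6 - (r^3 * s^3 * y6 * y3 + r * (r^3 - s^3) * y5 * y5)" using h36 by simp
  show ?thesis unfolding p by (simp add: scalar_rules norm h16 h16[THEN apply_left] h15
      h15[THEN apply_left] h13 h13[THEN apply_left] h35 h35[THEN apply_left])
qed

text \<open>When \<open>y1\<close> is applied to the bracket defining \<open>y4\<close>, the two
  corrections \<open>y3 * y3\<close> cancel. The bracket of \<open>y2\<close> with \<open>y5\<close>
  stays unevaluated until \<open>rel25\<close> supplies it; the straightening rule for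
  \<open>y1 * y4\<close> then follows.\<close>

lemma ex14:
  shows "(r - s) * (y1 * y4) = (r - s) * (r^3 * s^3 * y4 * y1 + y2 * y5 - r^3 * s^3 * y5 * y2)"
proof -
  have "(r - s) * (y1 * y4) = y1 * ((r - s) * y4)" by (simp add: scalar_rules norm)
  also have "(r - s) * y4 = y3 * y5 - r^2 * s * y5 * y3" using h35 by simp
  also have "y1 * \<dots> = r^3 * s^3 * ((y3 * y5 - r^2 * s * y5 * y3) * y1)
      + (r - s) * (y2 * y5 - r^3 * s^3 * y5 * y2)"
    by (simp add: scalar_rules norm h15 h13 h15[THEN apply_left] h13[THEN apply_left])
  also have "y3 * y5 - r^2 * s * y5 * y3 = (r - s) * y4" using h35 by simp
  finally show ?thesis by (simp add: scalar_rules norm)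
qed

text \<open>Here \<open>y1\<close> also has to pass \<open>y2\<close>, which it does only up to
  \<open>p12\<close>; this is the source of the terms with \<open>p12\<close>.\<close>

lemma rel25:
  assumes e14: "y1 * y4 = r^3 * s^3 * y4 * y1 + y2 * y5 - r^3 * s^3 * y5 * y2"
      and h26: "y2 * y6 = r^3 * s^6 * y6 * y2 + r^2 * s * (r^2 + r * s + s^2) * (r^3 - s^3) * y5 * y3
          + r * (r^2 - r * s - s^2) * (r^3 - s^3) * y4 + p26"
  shows "r * s * (r + s) * (r^3 - s^3) * (y2 * y5 - (r^3 * s^3 * y5 * y2 + r * (r^3 - s^3) * y3 * y3))
      = y1 * p26 - r^3 * s^3 * p26 * y1 - p12 * y6 + r^3 * s^9 * y6 * p12"
proof -
  have p: "p26 = y2 * y6 - (r^3 * s^6 * y6 * y2 + r^2 * s * (r^2 + r * s + s^2) * (r^3 - s^3) * y5 * y3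
      + r * (r^2 - r * s - s^2) * (r^3 - s^3) * y4)" using h26 by simp
  show ?thesis unfolding p by (simp add: scalar_rules norm h16 h16[THEN apply_left] h15
      h15[THEN apply_left] h13 h13[THEN apply_left] h12 h12[THEN apply_left] e14 e14[THEN apply_left])
qed

lemma rel23:
  assumes h25: "y2 * y5 = r^3 * s^3 * y5 * y2 + r * (r^3 - s^3) * y3 * y3 + p25"
  shows "r * s * (r - s) * (r^2 + s^2) * (y2 * y3 - r^3 * y3 * y2)
      = y1 * p25 - r^4 * s^2 * p25 * y1 - p12 * y5 + r^4 * s^5 * y5 * p12"
proof -
  have p: "p25 = y2 * y5 - (r^3 * s^3 * y5 * y2 + r * (r^3 - s^3) * y3 * y3)" using h25 by simp
  show ?thesis unfolding p by (simp add: scalar_rules norm h15 h15[THEN apply_left] h13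
      h13[THEN apply_left] h12 h12[THEN apply_left])
qed

lemma rel45:
  assumes h25: "y2 * y5 = r^3 * s^3 * y5 * y2 + r * (r^3 - s^3) * y3 * y3 + p25"
      and h26: "y2 * y6 = r^3 * s^6 * y6 * y2 + r^2 * s * (r^2 + r * s + s^2) * (r^3 - s^3) * y5 * y3
          + r * (r^2 - r * s - s^2) * (r^3 - s^3) * y4 + p26" and h36: "y3 * y6
          = r^3 * s^3 * y6 * y3 + r * (r^3 - s^3) * y5 * y5 + p36"
  shows "r^2 * s^2 * (r^2 - r * s + s^2) * (r^3 - s^3) * (y4 * y5 - r^3 * y5 * y4)
    = y2 * p56 + r^3 * p26 * y5 + r^6 * s^6 * y6 * p25 - p25 * y6 - r^3 * s^3 * y5 * p26
        - r^6 * s^9 * p56 * y2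
      - r * (r^3 - s^3) * (y3 * p36 + r^3 * s^3 * p36 * y3)"
proof -
  have "(r^3 * s^3 * y5 * y2 + r * (r^3 - s^3) * y3 * y3 + p25) * y6 = y2 * (r^3 * y6 * y5 + p56)"
    unfolding h25[symmetric] h56[symmetric] by (simp add: mult.assoc)
  then show ?thesis
    by (simp add: scalar_rules norm h25 h26 h36 h35 h56 h25[THEN apply_left] h26[THEN apply_left]
        h36[THEN apply_left] h35[THEN apply_left] h56[THEN apply_left])
qed

lemma rel34:
  assumes h14: "y1 * y4 = r^3 * s^3 * y4 * y1 + r * (r^3 - s^3) * y3 * y3 + p14"
      and h45: "y4 * y5 = r^3 * y5 * y4 + p45"
  shows "r * s * (r - s) * (r^2 + s^2) * (y3 * y4 - r^3 * y4 * y3)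
      = p14 * y5 - r^4 * s^2 * y5 * p14 - y1 * p45 + r^4 * s^5 * p45 * y1"
proof -
  have p: "p45 = y4 * y5 - r^3 * y5 * y4" using h45 by simp
  show ?thesis unfolding p by (simp add: scalar_rules norm h15 h15[THEN apply_left] h14
      h14[THEN apply_left] h35 h35[THEN apply_left])
qed

section \<open>The Serre relations as iterated skew brackets\<close>

lemma serre_quadratic:
  "(r^3 - s^3) * p56 = y1 * y6 * y6 - (r^3 + s^3) * y6 * y1 * y6 + r^3 * s^3 * y6 * y6 * y1"
proof -
  have "(r^3 - s^3) * p56 = ((r^3 - s^3) * y5) * y6 - r^3 * y6 * ((r^3 - s^3) * y5)"
    using h56 by (simp add: scalar_rules norm)
  also have "(r^3 - s^3) * y5 = y1 * y6 - s^3 * y6 * y1"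
    using h16 by simp
  finally show ?thesis by (simp add: scalar_rules norm)
qed

text \<open>The maps sending \<open>x\<close> to \<open>y1 * x - c * x * y1\<close> commute, and the
  quartic Serre polynomial is their product over \<open>c = s^3, r * s^2, r^2 * s, r^3\<close>
  applied to \<open>y6\<close>: its coefficients are, up to sign, the elementary symmetric functions
  of these four scalars. The first three brackets produce \<open>y5\<close>, \<open>y3\<close>,
  \<open>y2\<close> up to scalars, the last one \<open>p12\<close>. The quadratic relation belongs
  in the same way to the scalars \<open>s^3\<close> and \<open>r^3\<close>.\<close>

lemma serre_quartic:
  "(r - s) * (r^2 - s^2) * (r^3 - s^3) * p12
   = y1^4 * y6 - (r + s) * (r^2 + s^2) * y1^3 * y6 * y1
     + r * s * (r^2 + s^2) * (r^2 + r * s + s^2) * y1^2 * y6 * y1^2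
     - (r * s)^3 * (r + s) * (r^2 + s^2) * y1 * y6 * y1^3 + (r * s)^6 * y6 * y1^4"
proof -
  define q5 q3 q2 where "q5 = y1 * y6 - s^3 * y6 * y1" and "q3 = y1 * q5 - r * s^2 * q5 * y1"
    and "q2 = y1 * q3 - r^2 * s * q3 * y1"
  have 5: "q5 = (r^3 - s^3) * y5"
    using h16 by (simp add: q5_def)
  have "q3 = (r^3 - s^3) * (y1 * y5 - r * s^2 * y5 * y1)"
    by (simp add: q3_def 5 scalar_rules norm)
  also have "y1 * y5 - r * s^2 * y5 * y1 = (r^2 - s^2) * y3"
    using h15 by simp
  finally have 3: "q3 = (r^3 - s^3) * ((r^2 - s^2) * y3)" .
  have "q2 = (r^3 - s^3) * ((r^2 - s^2) * (y1 * y3 - r^2 * s * y3 * y1))"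
    by (simp add: q2_def 3 scalar_rules norm)
  also have "y1 * y3 - r^2 * s * y3 * y1 = (r - s) * y2"
    using h13 by simp
  finally have 2: "q2 = (r^3 - s^3) * ((r^2 - s^2) * ((r - s) * y2))" .
  have "(r - s) * (r^2 - s^2) * (r^3 - s^3) * p12 = y1 * q2 - r^3 * q2 * y1"
    using h12 by (simp add: 2 scalar_rules norm)
  also have "\<dots> = y1^4 * y6 - (r + s) * (r^2 + s^2) * y1^3 * y6 * y1
     + r * s * (r^2 + s^2) * (r^2 + r * s + s^2) * y1^2 * y6 * y1^2
     - (r * s)^3 * (r + s) * (r^2 + s^2) * y1 * y6 * y1^3 + (r * s)^6 * y6 * y1^4"
    by (simp add: q2_def q3_def q5_def scalar_rules norm)
  finally show ?thesis .
qed

end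

subsection \<open>The operators of left multiplication\<close>

locale two_param =
  fixes r s :: complex
  assumes r0: "r \<noteq> 0" and s0: "s \<noteq> 0"
    and generic: "\<And>m n :: int. r powi m * s powi n = 1 \<Longrightarrow> m = 0 \<and> n = 0"
begin

abbreviation R :: "int \<Rightarrow> complex" where "R a \<equiv> r powi a"
abbreviation S :: "int \<Rightarrow> complex" where "S a \<equiv> s powi a"

text \<open>
  \<open>terms\<^sub>i\<close> is left multiplication by a rescaled \<open>X\<^sub>i\<close> in the basis of ordered monomials
  \<open>X\<^sub>6\<^sup>a\<^sup>6 \<dots> X\<^sub>1\<^sup>a\<^sup>1\<close>. The rescaling divides \<open>X\<^sub>5\<close>, \<open>X\<^sub>3\<close>, \<open>X\<^sub>2\<close>, \<open>X\<^sub>4\<close> by products of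
  \<open>r - s\<close>, \<open>r\<^sup>2 - s\<^sup>2\<close> and \<open>r\<^sup>3 - s\<^sup>3\<close>, which makes all structure constants Laurent polynomials.
\<close>

definition terms1 :: "opterm list" where
  "terms1 = [
    ((1, 0, 0, 0, 0, 0),
       \<lambda>(a1, a2, a3, a4, a5, a6). S a6^3 * R a5 * S a5^2 * R a4^3 * S a4^3 * R a3^2 * S a3 * R a2^3),
    ((0, 1, -1, 0, 0, 0),
       \<lambda>(a1, a2, a3, a4, a5, a6). S a6^3 * R a5 * S a5^2 * R a4^3 * S a4^3 * R a3^2 * (R a3 - S a3) / r^2),
    ((0, 0, 2, -1, 0, 0),
       \<lambda>(a1, a2, a3, a4, a5, a6). S a6^3 * R a5 * S a5^2 * R a4^3 * (R a4^3 - S a4^3) / r^2),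
    ((0, 0, 1, 0, -1, 0),
       \<lambda>(a1, a2, a3, a4, a5, a6). S a6^3 * R a4^3 * R a5 * S a5 * (R a5 - S a5) * (r + s) / (r * s)),
    ((0, 0, 0, 1, -2, 0),
       \<lambda>(a1, a2, a3, a4, a5, a6). S a6^3 * R a5 * (R a5 - S a5) * (s * R a5 - r * S a5) / (r^3 * s)),
    ((0, 0, 0, 0, 1, -1),
       \<lambda>(a1, a2, a3, a4, a5, a6). R a6^3 - S a6^3)]"

definition terms2 :: "opterm list" where
  "terms2 = [
    ((0, 1, 0, 0, 0, 0),
       \<lambda>(a1, a2, a3, a4, a5, a6). R a3^3 * R a4^6 * S a4^3 * R a5^3 * S a5^3 * R a6^3 * S a6^6),
    ((0, 0, 3, -1, 0, 0),
       \<lambda>(a1, a2, a3, a4, a5, a6). R a4^6 * (R a4^3 - S a4^3) * R a5^3 * S a5^3 * R a6^3 * S a6^6 / r^3),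
    ((0, 0, 2, 0, -1, 0),
       \<lambda>(a1, a2, a3, a4, a5, a6). R a4^6 * R a5^3 * S a5^2 * (R a5 - S a5) * R a6^3 * S
           a6^6 * (r^2 + r * s + s^2) / (r^2 * s^2)),
    ((0, 0, 1, 1, -2, 0),
       \<lambda>(a1, a2, a3, a4, a5, a6). R a4^3 * R a5^3 * S a5 * (R a5 - S a5) * (s * R a5 - r * S a5) * R
           a6^3 * S a6^6 * (r^2 + r * s + s^2) / (r^4 * s^3)),
    ((0, 0, 1, 0, 1, -1),
       \<lambda>(a1, a2, a3, a4, a5, a6). R a4^3 * R a5^2 * S a5 * R a6^3 * S
           a6^3 * (R a6^3 - S a6^3) * (r^2 + r * s + s^2) / (r * s^2)),
    ((0, 0, 0, 2, -3, 0),
       \<lambda>(a1, a2, a3, a4, a5, a6). R a5^3 * (R a5 - S a5) * (s * R a5 - r * S a5)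
           * (s^2 * R a5 - r^2 * S a5) * R a6^3 * S a6^6 / (r^9 * s^3)),
    ((0, 0, 0, 1, 0, -1),
       \<lambda>(a1, a2, a3, a4, a5, a6). R a5^2 * ((r^3 + s^3) * R a5 - s * (r^2 + r * s + s^2) * S a5) * R
           a6^3 * S a6^3 * (R a6^3 - S a6^3) / (r^3 * s^3)),
    ((0, 0, 0, 0, 3, -2),
       \<lambda>(a1, a2, a3, a4, a5, a6). R a6^3 * (R a6^3 - S a6^3) * (s^3 * R a6^3 - r^3 * S a6^3) / (r^6 * s^3))]"

definition terms3 :: "opterm list" where
  "terms3 = [
    ((0, 0, 1, 0, 0, 0),
       \<lambda>(a1, a2, a3, a4, a5, a6). R a6^3 * S a6^3 * R a5^2 * S a5 * R a4^3),
    ((0, 0, 0, 1, -1, 0),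
       \<lambda>(a1, a2, a3, a4, a5, a6). R a6^3 * S a6^3 * R a5^2 * (R a5 - S a5) / r^2),
    ((0, 0, 0, 0, 2, -1),
       \<lambda>(a1, a2, a3, a4, a5, a6). R a6^3 * (R a6^3 - S a6^3) / r^2)]"

definition terms4 :: "opterm list" where
  "terms4 = [
    ((0, 0, 0, 1, 0, 0),
       \<lambda>(a1, a2, a3, a4, a5, a6). R a6^6 * S a6^3 * R a5^3),
    ((0, 0, 0, 0, 3, -1),
       \<lambda>(a1, a2, a3, a4, a5, a6). R a6^6 * (R a6^3 - S a6^3) / r^3)]"

definition terms5 :: "opterm list" where
  "terms5 = [
    ((0, 0, 0, 0, 1, 0),
       \<lambda>(a1, a2, a3, a4, a5, a6). R a6^3)]"

definition terms6 :: "opterm list" where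
  "terms6 = [
    ((0, 0, 0, 0, 0, 1),
       \<lambda>(a1, a2, a3, a4, a5, a6). 1)]"

lemmas terms_defs = terms1_def terms2_def terms3_def terms4_def terms5_def terms6_def

lemma valid_term:
  assumes "\<And>a1 a2 a3 a4 a5 a6. w (int a1, int a2, int a3, int a4, int a5, int a6) \<noteq> 0
    \<Longrightarrow> nonneg (int a1 + t1, int a2 + t2, int a3 + t3, int a4 + t4, int a5 + t5, int a6 + t6)"
    and "valid ts"
  shows "valid (((t1, t2, t3, t4, t5, t6), w) # ts)"
  using assms by (simp add: valid_def split_paired_All zi_def)

lemma not_le_numeral:
  "\<not> 2 \<le> (n :: nat) \<longleftrightarrow> n = 0 \<or> n = 1" "\<not> 3 \<le> n \<longleftrightarrow> n = 0 \<or> n = 1 \<or> n = 2"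
  by auto

lemma valid_Nil: "valid []"
  by (simp add: valid_def)

text \<open>A term that lowers an exponent \<open>a\<close> by \<open>k\<close> carries factors such
  as \<open>R a - S a\<close> and \<open>s * R a - r * S a\<close>, or their analogues with cubes.
  They vanish at \<open>a = 0\<close>, \<open>a = 1\<close> and so on, one for each of the
  \<open>k\<close> values at which the term would leave the nonnegative range.\<close>

lemma valid_terms1: "valid terms1"
  unfolding terms_defs
  by (intro valid_Nil valid_term; simp add: nonneg_def;
      rule ccontr; auto simp: not_le_numeral mult.commute)

lemma valid_terms2: "valid terms2"
  unfolding terms_defs
  by (intro valid_Nil valid_term; simp add: nonneg_def;
      rule ccontr; auto simp: not_le_numeral mult.commute)

lemma valid_terms3: "valid terms3"
  unfolding terms_defs
  by (intro valid_Nil valid_term; simp add: nonneg_def;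
      rule ccontr; auto simp: not_le_numeral mult.commute)

lemma valid_terms4: "valid terms4"
  unfolding terms_defs
  by (intro valid_Nil valid_term; simp add: nonneg_def;
      rule ccontr; auto simp: not_le_numeral mult.commute)

lemma valid_terms5: "valid terms5"
  unfolding terms_defs
  by (intro valid_Nil valid_term; simp add: nonneg_def;
      rule ccontr; auto simp: not_le_numeral mult.commute)

lemma valid_terms6: "valid terms6"
  unfolding terms_defs
  by (intro valid_Nil valid_term; simp add: nonneg_def;
      rule ccontr; auto simp: not_le_numeral mult.commute)

lemmas valid_terms = valid_terms1 valid_terms2 valid_terms3 valid_terms4 valid_terms5 valid_terms6

section \<open>Commutation relations of the operators\<close>

lemmas R_S_shift = power_int_add[OF disjI1, OF r0] power_int_add[OF disjI1, OF s0] power_int_minus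
  power_int_diff[OF disjI1, OF r0] power_int_diff[OF disjI1, OF s0]

lemma ball_set_Cons:
  "(\<forall>x\<in>set (a # xs). P x) \<longleftrightarrow> P a \<and> (\<forall>x\<in>set xs. P x)" "(\<forall>x\<in>set []. P x) \<longleftrightarrow> True"
  by auto

lemma term_op_Nil: "term_op [] v = 0"
  by (simp add: term_op_def lext_def)

text \<open>This and the five relations below are the defining relations of \<open>pbw_ring\<close>
  with zero defects: four of them identify the operators of \<open>terms5\<close>,
  \<open>terms3\<close>, \<open>terms2\<close> and \<open>terms4\<close> as brackets, and the last
  two express the Serre relations.\<close>

lemma op16:
  "term_op terms1 (term_op terms6 v)
      = scale (s^3) (term_op terms6 (term_op terms1 v)) + scale (r^3 - s^3) (term_op terms5 v)"
proof -
  have "term_op terms1 (term_op terms6 v)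
      = scale (s^3) (term_op terms6 (term_op terms1 v)) + scale (r^3 - s^3) (term_op terms5 v)"
    apply (rule term_op_commutation)
       apply (rule valid_terms)+
     apply (simp add: terms_defs)
    apply (unfold terms_defs list.map prod.sel ball_set_Cons add_Pair)
    apply (intro conjI TrueI)
    apply (simp_all only: arith_simps arith_special coef_comp_terms)
    apply (simp_all add: coef_Nil coef_Cons zero_prod_def)
    \<comment> \<open>Powers with shifted exponents split into constants times \<open>R a\<close>
      and \<open>S a\<close>. These can now be treated as indeterminates, so that each goal becomes
      a polynomial identity once denominators are cleared.\<close>
    apply (simp_all add: R_S_shift)
    apply (simp_all add: divide_simps r0 s0)
    apply ((((rule disjI2)+)?, Groebner_Basis.algebra)+)?
    done
  then show ?thesis by (simp add: term_op_Nil)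
qed

lemma op15:
  "term_op terms1 (term_op terms5 v)
      = scale (r * s^2) (term_op terms5 (term_op terms1 v)) + scale (r^2 - s^2) (term_op terms3 v)"
proof -
  have "term_op terms1 (term_op terms5 v)
      = scale (r * s^2) (term_op terms5 (term_op terms1 v)) + scale (r^2 - s^2) (term_op terms3 v)"
    apply (rule term_op_commutation)
       apply (rule valid_terms)+
     apply (simp add: terms_defs)
    apply (unfold terms_defs list.map prod.sel ball_set_Cons add_Pair)
    apply (intro conjI TrueI)
    apply (simp_all only: arith_simps arith_special coef_comp_terms)
    apply (simp_all add: coef_Nil coef_Cons zero_prod_def)
    apply (simp_all add: R_S_shift)
    apply (simp_all add: divide_simps r0 s0)
    apply ((((rule disjI2)+)?, Groebner_Basis.algebra)+)?
    done
  then show ?thesis by (simp add: term_op_Nil)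
qed

lemma op13:
  "term_op terms1 (term_op terms3 v)
      = scale (r^2 * s) (term_op terms3 (term_op terms1 v)) + scale (r - s) (term_op terms2 v)"
proof -
  have "term_op terms1 (term_op terms3 v)
      = scale (r^2 * s) (term_op terms3 (term_op terms1 v)) + scale (r - s) (term_op terms2 v)"
    apply (rule term_op_commutation)
       apply (rule valid_terms)+
     apply (simp add: terms_defs)
    apply (unfold terms_defs list.map prod.sel ball_set_Cons add_Pair)
    apply (intro conjI TrueI)
    apply (simp_all only: arith_simps arith_special coef_comp_terms)
    apply (simp_all add: coef_Nil coef_Cons zero_prod_def)
    apply (simp_all add: R_S_shift)
    apply (simp_all add: divide_simps r0 s0)
    apply ((((rule disjI2)+)?, Groebner_Basis.algebra)+)?
    done
  then show ?thesis by (simp add: term_op_Nil)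
qed

lemma op35:
  "term_op terms3 (term_op terms5 v)
      = scale (r^2 * s) (term_op terms5 (term_op terms3 v)) + scale (r - s) (term_op terms4 v)"
proof -
  have "term_op terms3 (term_op terms5 v)
      = scale (r^2 * s) (term_op terms5 (term_op terms3 v)) + scale (r - s) (term_op terms4 v)"
    apply (rule term_op_commutation)
       apply (rule valid_terms)+
     apply (simp add: terms_defs)
    apply (unfold terms_defs list.map prod.sel ball_set_Cons add_Pair)
    apply (intro conjI TrueI)
    apply (simp_all only: arith_simps arith_special coef_comp_terms)
    apply (simp_all add: coef_Nil coef_Cons zero_prod_def)
    apply (simp_all add: R_S_shift)
    apply (simp_all add: divide_simps r0 s0)
    apply ((((rule disjI2)+)?, Groebner_Basis.algebra)+)?
    done
  then show ?thesis by (simp add: term_op_Nil)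
qed

lemma op56:
  "term_op terms5 (term_op terms6 v) = scale (r^3) (term_op terms6 (term_op terms5 v))"
proof -
  \<comment> \<open>The empty list stands for the zero operator, as there is no correction
    term.\<close>
  have "term_op terms5 (term_op terms6 v)
      = scale (r^3) (term_op terms6 (term_op terms5 v)) + scale (0) (term_op [] v)"
    apply (rule term_op_commutation)
       apply (rule valid_terms)+
     apply (simp add: terms_defs)
    apply (unfold terms_defs list.map prod.sel ball_set_Cons add_Pair)
    apply (intro conjI TrueI)
    apply (simp_all only: arith_simps arith_special coef_comp_terms)
    apply (simp_all add: coef_Nil coef_Cons zero_prod_def)
    apply (simp_all add: R_S_shift)
    apply (simp_all add: divide_simps r0 s0)
    apply ((((rule disjI2)+)?, Groebner_Basis.algebra)+)?
    done
  then show ?thesis by (simp add: term_op_Nil)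
qed

lemma op12:
  "term_op terms1 (term_op terms2 v) = scale (r^3) (term_op terms2 (term_op terms1 v))"
proof -
  have "term_op terms1 (term_op terms2 v)
      = scale (r^3) (term_op terms2 (term_op terms1 v)) + scale (0) (term_op [] v)"
    apply (rule term_op_commutation)
       apply (rule valid_terms)+
     apply (simp add: terms_defs)
    apply (unfold terms_defs list.map prod.sel ball_set_Cons add_Pair)
    apply (intro conjI TrueI)
    apply (simp_all only: arith_simps arith_special coef_comp_terms)
    apply (simp_all add: coef_Nil coef_Cons zero_prod_def)
    apply (simp_all add: R_S_shift)
    apply (simp_all add: divide_simps r0 s0)
    apply ((((rule disjI2)+)?, Groebner_Basis.algebra)+)?
    done
  then show ?thesis by (simp add: term_op_Nil)
qed

end

subsection \<open>The free algebra and its Serre ideal\<close>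

lemma scale_eq_scalar: "scale c x = scalar c * x"
  by (simp add: scale_def mult_map_scale_conv_mult scalar_def zero_list_def)

lemma lin_mult_left: "lin (\<lambda>x :: free2. z * x)" and lin_mult_right: "lin (\<lambda>x :: free2. x * z)"
  and scalar_central: "x * scalar c = scalar c * x"
proof -
  have *: "lin (\<lambda>x :: free2. x * z)" for z
    by (simp add: lin_def scale_eq_scalar distrib_right mult.assoc)
  have c: "x * scalar c = scalar c * x" for c x
  proof -
    have "x * scalar c = scale c x"
    proof (rule lin_eqI[OF * lin_scaled[OF lin_id]])
      show "delta k * scalar c = scale c (delta k)" for k :: "letter list"
        by (simp add: scalar_def mult_single plus_list_def scale_delta)
    qed
    then show ?thesis by (simp add: scale_eq_scalar)
  qed
  then show "x * scalar c = scalar c * x" .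
  show "lin (\<lambda>x :: free2. x * z)" by (rule *)
  show "lin (\<lambda>x :: free2. z * x)"
    by (simp add: lin_def scale_eq_scalar distrib_left mult.assoc[symmetric] c)
qed

lemma scalar_hom:
  "scalar (c + d) = scalar c + scalar d" "scalar (c - d) = scalar c - scalar d"
  "scalar (c * d) = scalar c * scalar d" "scalar 1 = 1" "scalar 0 = 0"
proof -
  show "scalar 1 = 1" by (simp add: scalar_def flip: zero_list_def)
qed (simp_all add: scalar_def single_add single_diff mult_single plus_list_def)

lemma scalar_power: "scalar (c ^ n) = scalar c ^ n"
  by (induction n) (simp_all add: scalar_hom)

lemmas scalar_simps = scalar_hom scalar_power

lemma scalar_cancel: "c \<noteq> 0 \<Longrightarrow> scalar c * x = scalar c * y \<longleftrightarrow> x = y"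
  using scale_eq_iff[of c x y] by (simp add: scale_eq_scalar)

lemma scalar_divide: "c \<noteq> 0 \<Longrightarrow> scalar c * (scalar (1 / c) * x) = x"
  by (simp add: mult.assoc[symmetric] flip: scalar_hom(3)) (simp add: scalar_hom)

lemma ring_free_algebra: "ring (free_algebra :: (complex, free2) module)"
proof (rule ringI)
  show "abelian_group (free_algebra :: (complex, free2) module)"
  proof (rule abelian_groupI)
    show "\<exists>y\<in>carrier free_algebra. y \<oplus>\<^bsub>free_algebra\<^esub> x = \<zero>\<^bsub>free_algebra\<^esub>" for x :: free2
      by (rule bexI[of _ "- x"]) (simp_all add: free_algebra_def)
  qed (simp_all add: free_algebra_def algebra_simps)
  show "Group.monoid (free_algebra :: (complex, free2) module)"
    by (rule monoidI) (simp_all add: free_algebra_def algebra_simps)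
qed (simp_all add: free_algebra_def algebra_simps)

lemma free_algebra_simps [simp]:
  "carrier free_algebra = UNIV" "mult free_algebra = (*)" "one free_algebra = 1"
  "zero free_algebra = 0" "add free_algebra = (+)" "smult free_algebra = (scale :: _ \<Rightarrow> free2 \<Rightarrow> _)"
  by (simp_all add: free_algebra_def scale_def fun_eq_iff)

lemma free_algebra_minus: "a_inv (free_algebra :: (complex, free2) module) x = - x"
proof -
  interpret ring "free_algebra :: (complex, free2) module" by (rule ring_free_algebra)
  show ?thesis by (rule minus_equality) simp_all
qed

definition word_act :: "(vec \<Rightarrow> vec) \<Rightarrow> (vec \<Rightarrow> vec) \<Rightarrow> letter list \<Rightarrow> vec \<Rightarrow> vec" where
  "word_act f g w = foldr (\<lambda>l. case l of E1 \<Rightarrow> f | E2 \<Rightarrow> g) w"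

context two_param
begin

abbreviation J :: "free2 set" where "J \<equiv> serre_ideal r s"

lemma ideal_J: "ideal J (free_algebra :: (complex, free2) module)"
proof -
  interpret ring "free_algebra :: (complex, free2) module" by (rule ring_free_algebra)
  show ?thesis unfolding serre_ideal_def by (rule genideal_ideal) simp
qed

lemma J_0: "0 \<in> J" and J_add: "x \<in> J \<Longrightarrow> y \<in> J \<Longrightarrow> x + y \<in> J"
  and J_left: "x \<in> J \<Longrightarrow> z * x \<in> J" and J_right: "x \<in> J \<Longrightarrow> x * z \<in> J"
  and J_uminus: "x \<in> J \<Longrightarrow> - x \<in> J"
proof -
  interpret ideal J "free_algebra :: (complex, free2) module" by (rule ideal_J)
  show "0 \<in> J" "x \<in> J \<Longrightarrow> y \<in> J \<Longrightarrow> x + y \<in> J"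
    using additive_subgroup.zero_closed[OF is_additive_subgroup]
      additive_subgroup.a_closed[OF is_additive_subgroup, of x y] by simp_all
  show l: "x \<in> J \<Longrightarrow> z * x \<in> J" for z
    using I_l_closed[of x z] by simp
  show "x \<in> J \<Longrightarrow> x * z \<in> J"
    using I_r_closed[of x z] by simp
  show "x \<in> J \<Longrightarrow> - x \<in> J" using l[of "- 1"] by simp
qed

lemma J_diff: "x \<in> J \<Longrightarrow> y \<in> J \<Longrightarrow> x - y \<in> J"
  using J_add[of x "- y"] J_uminus by simp

lemma J_scalar_cancel: "c \<noteq> 0 \<Longrightarrow> scalar c * x \<in> J \<Longrightarrow> x \<in> J"
  using J_left[of "scalar c * x" "scalar (1 / c)"]
  by (simp add: mult.assoc[symmetric] flip: scalar_hom(3)) (simp add: scalar_hom)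

lemma serre_relations_in_J: "serre_relations r s \<subseteq> J"
proof -
  interpret ring "free_algebra :: (complex, free2) module" by (rule ring_free_algebra)
  show ?thesis unfolding serre_ideal_def by (rule genideal_self) simp
qed

lemma power_neq: "r ^ n \<noteq> s ^ n" if "0 < n"
proof
  assume "r ^ n = s ^ n"
  then have "r powi int n * s powi (- int n) = 1"
    using s0 by (simp add: power_int_minus)
  then have "int n = 0" using generic by blast
  with that show False by simp
qed

text \<open>Up to powers of \<open>r\<close> and \<open>s\<close>, the factors that must be
  cancelled in the relations of \<open>pbw_ring\<close> are products of these. Each divides
  \<open>r^n - s^n\<close> for some \<open>n\<close> up to 6.\<close>

lemma nonzero:
  "r - s \<noteq> 0" "r^2 - s^2 \<noteq> 0" "r^3 - s^3 \<noteq> 0" "r + s \<noteq> 0" "r^2 + s^2 \<noteq> 0"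
  "r^2 - r * s + s^2 \<noteq> 0"
proof -
  show "r - s \<noteq> 0" "r^2 - s^2 \<noteq> 0" "r^3 - s^3 \<noteq> 0"
    using power_neq[of 1] power_neq[of 2] power_neq[of 3] by simp_all
  have "(r - s) * (r + s) * (r^2 + s^2) = r^4 - s^4" by Groebner_Basis.algebra
  then show "r + s \<noteq> 0" "r^2 + s^2 \<noteq> 0" using power_neq[of 4] by auto
  have "(r^3 - s^3) * (r + s) * (r^2 - r * s + s^2) = r^6 - s^6" by Groebner_Basis.algebra
  then show "r^2 - r * s + s^2 \<noteq> 0" using power_neq[of 6] by auto
qed

text \<open>Lifts of the rescaled \<open>X\<^sub>5\<close>, \<open>X\<^sub>3\<close>,
  \<open>X\<^sub>2\<close>, \<open>X\<^sub>4\<close> to the free algebra. The defining brackets hold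
  exactly there, so \<open>pbw_ring\<close> can be instantiated before passing to the quotient, with
  \<open>p12\<close> and \<open>p56\<close> as the only defects.\<close>

definition y5 :: free2 where
  "y5 = scalar (1 / (r^3 - s^3)) * (gen E1 * gen E2 - scalar s^3 * gen E2 * gen E1)"
definition y3 :: free2 where
  "y3 = scalar (1 / (r^2 - s^2)) * (gen E1 * y5 - scalar r * scalar s^2 * y5 * gen E1)"
definition y2 :: free2 where
  "y2 = scalar (1 / (r - s)) * (gen E1 * y3 - scalar r^2 * scalar s * y3 * gen E1)"
definition y4 :: free2 where
  "y4 = scalar (1 / (r - s)) * (y3 * y5 - scalar r^2 * scalar s * y5 * y3)"

abbreviation p12 :: free2 where "p12 \<equiv> gen E1 * y2 - scalar r^3 * y2 * gen E1"
abbreviation p56 :: free2 where "p56 \<equiv> y5 * gen E2 - scalar r^3 * gen E2 * y5"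

lemma scalar_nonzero_divide:
  "(scalar r^3 - scalar s^3) * (scalar (1 / (r^3 - s^3)) * x) = x"
  "(scalar r^2 - scalar s^2) * (scalar (1 / (r^2 - s^2)) * x) = x"
  "(scalar r - scalar s) * (scalar (1 / (r - s)) * x) = x"
  using scalar_divide[OF nonzero(3)] scalar_divide[OF nonzero(2)] scalar_divide[OF nonzero(1)]
  by (simp_all add: scalar_hom scalar_power)

sublocale free: pbw_ring "scalar r" "scalar s" "gen E1" y2 y3 y4 y5 "gen E2" p12 p56
proof
  show "gen E1 * gen E2 = scalar s ^ 3 * gen E2 * gen E1 + (scalar r ^ 3 - scalar s ^ 3) * y5"
    by (simp only: y5_def scalar_nonzero_divide) simp
  show "gen E1 * y5 = scalar r * scalar s ^ 2 * y5 * gen E1 + (scalar r ^ 2 - scalar s ^ 2) * y3"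
    by (simp only: y3_def scalar_nonzero_divide) simp
  show "gen E1 * y3 = scalar r ^ 2 * scalar s * y3 * gen E1 + (scalar r - scalar s) * y2"
    by (simp only: y2_def scalar_nonzero_divide) simp
  show "y3 * y5 = scalar r ^ 2 * scalar s * y5 * y3 + (scalar r - scalar s) * y4"
    by (simp only: y4_def scalar_nonzero_divide) simp
qed (rule scalar_central | simp)+

lemma serre_relations_eq:
  "scalar ((r * s)^3) * (gen E2^2 * gen E1 - scalar (1 / r^3 + 1 / s^3) * (gen E2 * gen E1 * gen E2)
     + scalar (1 / (r * s)^3) * (gen E1 * gen E2^2)) = scalar (r^3 - s^3) * p56"
  "gen E1^4 * gen E2 - scalar ((r + s) * (r^2 + s^2)) * (gen E1^3 * gen E2 * gen E1)
     + scalar (r * s * (r^2 + s^2) * (r^2 + r * s + s^2)) * (gen E1^2 * gen E2 * gen E1^2)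
     - scalar ((r * s)^3 * (r + s) * (r^2 + s^2)) * (gen E1 * gen E2 * gen E1^3)
     + scalar ((r * s)^6) * (gen E2 * gen E1^4)
   = scalar ((r - s) * (r^2 - s^2) * (r^3 - s^3)) * p12"
proof -
  have "(r * s)^3 * (1 / r^3 + 1 / s^3) = r^3 + s^3" "(r * s)^3 * (1 / (r * s)^3) = 1"
    using r0 s0 by (simp_all add: field_simps)
  then have c: "scalar ((r * s)^3) * (scalar (1 / r^3 + 1 / s^3) * x) = scalar (r^3 + s^3) * x"
    "scalar ((r * s)^3) * (scalar (1 / (r * s)^3) * x) = x" for x
    by (simp_all only: mult.assoc[symmetric] scalar_hom(3)[symmetric]) (simp_all add: scalar_hom)
  have *: "scalar (r^3 - s^3) * p56 = gen E1 * gen E2 * gen E2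
      - (scalar r^3 + scalar s^3) * gen E2 * gen E1 * gen E2
          + scalar r^3 * scalar s^3 * gen E2 * gen E2 * gen E1"
    unfolding free.serre_quadratic[symmetric] by (simp only: scalar_simps)
  show "scalar ((r * s)^3) * (gen E2^2 * gen E1 - scalar (1 / r^3 + 1 / s^3) * (gen E2 * gen E1 * gen E2)
     + scalar (1 / (r * s)^3) * (gen E1 * gen E2^2)) = scalar (r^3 - s^3) * p56"
    unfolding *
    unfolding distrib_left right_diff_distrib c
    by (simp add: scalar_simps free.scalar_rules free.norm)
  show "gen E1^4 * gen E2 - scalar ((r + s) * (r^2 + s^2)) * (gen E1^3 * gen E2 * gen E1)
     + scalar (r * s * (r^2 + s^2) * (r^2 + r * s + s^2)) * (gen E1^2 * gen E2 * gen E1^2)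
     - scalar ((r * s)^3 * (r + s) * (r^2 + s^2)) * (gen E1 * gen E2 * gen E1^3)
     + scalar ((r * s)^6) * (gen E2 * gen E1^4)
   = scalar ((r - s) * (r^2 - s^2) * (r^3 - s^3)) * p12"
    using free.serre_quartic by (simp only: scalar_simps mult.assoc)
qed

lemma p12_in_J: "p12 \<in> J" and p56_in_J: "p56 \<in> J"
proof -
  have "scalar ((r - s) * (r^2 - s^2) * (r^3 - s^3)) * p12 \<in> J"
    unfolding serre_relations_eq(2)[symmetric]
    by (rule subsetD[OF serre_relations_in_J]) (simp add: serre_relations_def Let_def)
  then show "p12 \<in> J" by (rule J_scalar_cancel[rotated]) (use nonzero in auto)
  have "scalar (r^3 - s^3) * p56 \<in> J"
    unfolding serre_relations_eq(1)[symmetric]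
    by (rule J_left, rule subsetD[OF serre_relations_in_J]) (simp add: serre_relations_def Let_def)
  then show "p56 \<in> J" by (rule J_scalar_cancel[rotated]) (use nonzero in auto)
qed

end

subsection \<open>The module of ordered monomials\<close>

context two_param
begin

abbreviation "L1 \<equiv> term_op terms1"
abbreviation "L2 \<equiv> term_op terms2"
abbreviation "L3 \<equiv> term_op terms3"
abbreviation "L4 \<equiv> term_op terms4"
abbreviation "L5 \<equiv> term_op terms5"
abbreviation "L6 \<equiv> term_op terms6"

section \<open>The action of the free algebra\<close>

definition act :: "free2 \<Rightarrow> vec \<Rightarrow> vec" where
  "act x v = lext (\<lambda>w. word_act L1 L6 w v) x"

lemma lin_word_act: "lin (word_act L1 L6 w)"
proof (induction w)
  case Nil
  then show ?case by (simp add: word_act_def lin_def)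
next
  case (Cons l w)
  then show ?case
    by (cases l) (simp_all add: word_act_def lin_def lin_simps[OF lin_term_op])
qed

lemma lin_act: "lin (act x)"
  unfolding act_def by (intro lin_lext_fun lin_word_act)

lemma lin_act_left: "lin (\<lambda>x. act x v)"
  unfolding act_def by (rule lin_lext)

lemma act_delta: "act (delta w) v = word_act L1 L6 w v"
  by (simp add: act_def)

lemma act_mult: "act (x * y) v = act x (act y v)"
proof (rule lin_eqI[where f = "\<lambda>x. act (x * y) v"])
  show "lin (\<lambda>x. act (x * y) v)" "lin (\<lambda>x. act x (act y v))"
    by (rule lin_comp[OF lin_act_left lin_mult_right] lin_act_left)+
  fix w
  show "act (delta w * y) v = act (delta w) (act y v)"
  proof (rule lin_eqI[where f = "\<lambda>y. act (delta w * y) v"])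
    show "lin (\<lambda>y. act (delta w * y) v)" "lin (\<lambda>y. act (delta w) (act y v))"
      by (rule lin_comp[OF lin_act_left lin_mult_left] lin_comp[OF lin_act lin_act_left])+
    fix w'
    show "act (delta w * delta w') v = act (delta w) (act (delta w') v)"
      by (simp add: mult_single plus_list_def act_delta word_act_def)
  qed
qed

lemma act_simps:
  "act (x + y) v = act x v + act y v" "act (x - y) v = act x v - act y v"
  "act (scalar c) v = scale c v" "act 1 v = v" "act 0 v = 0"
  "act (gen E1) v = L1 v" "act (gen E2) v = L6 v"
proof -
  show "act (x + y) v = act x v + act y v" "act (x - y) v = act x v - act y v" "act 0 v = 0"
    by (rule lin_simps[OF lin_act_left])+
  have 1: "act (delta []) v = v"
    by (simp add: act_delta word_act_def)
  then show "act 1 v = v"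
    by (simp add: zero_list_def flip: single_one)
  have "scalar c = scale c (delta [])"
    by (simp add: scalar_def scale_delta)
  then show "act (scalar c) v = scale c v"
    by (simp add: lin_scale[OF lin_act_left] 1)
  show "act (gen E1) v = L1 v" "act (gen E2) v = L6 v"
    by (simp_all add: gen_def act_delta word_act_def)
qed

lemma act_scalar_power: "act (scalar c ^ n) v = scale (c ^ n) v"
  by (simp add: act_simps flip: scalar_power)

lemmas act_rules = act_mult act_simps act_scalar_power lin_simps[OF lin_term_op]

lemma act_y: "act y5 v = L5 v" "act y3 v = L3 v" "act y2 v = L2 v" "act y4 v = L4 v"
proof -
  show 5: "act y5 v = L5 v" for v
    using nonzero by (simp add: y5_def act_rules op16 scale_distrib[symmetric])
  show 3: "act y3 v = L3 v" for v
    using nonzero by (simp add: y3_def act_rules 5 op15 scale_distrib[symmetric])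
  show 2: "act y2 v = L2 v" for v
    using nonzero by (simp add: y2_def act_rules 3 op13 scale_distrib[symmetric])
  show 4: "act y4 v = L4 v" for v
    using nonzero by (simp add: y4_def act_rules 3 5 op35 scale_distrib[symmetric])
qed

lemma act_p: "act p12 v = 0" "act p56 v = 0"
  by (simp_all add: act_rules act_y op12 op56)

text \<open>The elements that act as zero form a two-sided ideal. It contains the Serre relations
  because nonzero multiples of these are multiples of \<open>p12\<close> and
  \<open>p56\<close>.\<close>

lemma act_J: "x \<in> J \<Longrightarrow> act x v = 0"
proof -
  interpret ring "free_algebra :: (complex, free2) module" by (rule ring_free_algebra)
  let ?K = "{x. \<forall>v. act x v = 0}"
  have "ideal ?K (free_algebra :: (complex, free2) module)"
  proof (rule idealI[OF ring_free_algebra])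
    show "subgroup ?K (add_monoid (free_algebra :: (complex, free2) module))"
    proof (rule add.subgroupI)
      show "?K \<noteq> {}" using act_simps(5) by blast
      show "\<ominus>\<^bsub>free_algebra\<^esub> a \<in> ?K" if "a \<in> ?K" for a
        using that by (simp add: free_algebra_minus lin_uminus[OF lin_act_left])
    qed (simp_all add: act_simps)
  qed (simp_all add: act_mult lin_zero[OF lin_act])
  moreover have "serre_relations r s \<subseteq> ?K"
  proof -
    have *: "x \<in> ?K" if "scalar c * x = scalar d * y" "c \<noteq> 0" "\<And>v. act y v = 0" for c d x y
    proof -
      have "act (scalar c * x) v = 0" for v
        unfolding that(1) by (simp add: act_mult that(3) lin_zero[OF lin_act])
      then have "scale c (act x v) = scale c 0" for v by (simp add: act_rules)
      then show ?thesis using scale_eq_iff[OF that(2)] by blast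
    qed
    show ?thesis
      unfolding serre_relations_def Let_def
      using *[OF serre_relations_eq(1) _ act_p(2)]
        *[of 1, unfolded scalar_hom mult_1_left, OF serre_relations_eq(2) _ act_p(1)] r0 s0
      by simp
  qed
  ultimately have "J \<subseteq> ?K"
    unfolding serre_ideal_def by (rule genideal_minimal)
  then show "x \<in> J \<Longrightarrow> act x v = 0" by blast
qed

text \<open>The orbit map of the empty monomial; by \<open>act_J\<close> it factors through the
  quotient. The map \<open>psi\<close> will turn out to be its inverse modulo
  \<open>J\<close>.\<close>

definition phi :: "free2 \<Rightarrow> vec" where
  "phi x = act x (delta (0, 0, 0, 0, 0, 0))"

definition psi :: "vec \<Rightarrow> free2" where
  "psi = lext (\<lambda>(a1, a2, a3, a4, a5, a6).
     gen E2 ^ a6 * (y5 ^ a5 * (y4 ^ a4 * (y3 ^ a3 * (y2 ^ a2 * gen E1 ^ a1)))))"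

lemma lin_phi: "lin phi"
  unfolding phi_def by (rule lin_act_left)

lemma lin_psi: "lin psi"
  unfolding psi_def by (rule lin_lext)

lemma psi_delta: "psi (delta (a1, a2, a3, a4, a5, a6)) =
    gen E2 ^ a6 * (y5 ^ a5 * (y4 ^ a4 * (y3 ^ a3 * (y2 ^ a2 * gen E1 ^ a1))))"
  by (simp add: psi_def)

lemma phi_mult: "phi (gen E1 * x) = L1 (phi x)" "phi (y2 * x) = L2 (phi x)"
  "phi (y3 * x) = L3 (phi x)" "phi (y4 * x) = L4 (phi x)" "phi (y5 * x) = L5 (phi x)"
  "phi (gen E2 * x) = L6 (phi x)"
  by (simp_all add: phi_def act_rules act_y)

lemma L_raise:
  "L1 (delta (a1, 0, 0, 0, 0, 0)) = delta (Suc a1, 0, 0, 0, 0, 0)"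
  "L2 (delta (a1, a2, 0, 0, 0, 0)) = delta (a1, Suc a2, 0, 0, 0, 0)"
  "L3 (delta (a1, a2, a3, 0, 0, 0)) = delta (a1, a2, Suc a3, 0, 0, 0)"
  "L4 (delta (a1, a2, a3, a4, 0, 0)) = delta (a1, a2, a3, Suc a4, 0, 0)"
  "L5 (delta (a1, a2, a3, a4, a5, 0)) = delta (a1, a2, a3, a4, Suc a5, 0)"
  "L6 (delta (a1, a2, a3, a4, a5, a6)) = delta (a1, a2, a3, a4, a5, Suc a6)"
  by (simp_all add: term_op_delta terms_defs zi_def zn_def nat_add_distrib)

end

subsection \<open>Straightening\<close>

text \<open>Iterated over the six generators, starting from \<open>S0\<close>, this yields the span
  of the ordered monomials together with \<open>J\<close>, in a form that allows induction without
  keeping track of coefficients.\<close>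

inductive_set powers_times :: "free2 \<Rightarrow> free2 set \<Rightarrow> free2 set" for y A where
  base: "w \<in> A \<Longrightarrow> w \<in> powers_times y A"
| mult: "w \<in> powers_times y A \<Longrightarrow> y * w \<in> powers_times y A"
| add: "v \<in> powers_times y A \<Longrightarrow> w \<in> powers_times y A \<Longrightarrow> v + w \<in> powers_times y A"

context two_param
begin

definition subspace_J :: "free2 set \<Rightarrow> bool" where
  "subspace_J A \<longleftrightarrow> J \<subseteq> A \<and> (\<forall>u\<in>A. \<forall>v\<in>A. u + v \<in> A) \<and> (\<forall>c. \<forall>u\<in>A. scalar c * u \<in> A)"

lemma subspace_J_powers_times:
  assumes "subspace_J A"
  shows "subspace_J (powers_times y A)"
  unfolding subspace_J_def
proof (intro conjI ballI allI)
  show "J \<subseteq> powers_times y A"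
    using assms by (auto simp: subspace_J_def intro: powers_times.base)
  show "u + v \<in> powers_times y A" if "u \<in> powers_times y A" "v \<in> powers_times y A" for u v
    using that by (rule powers_times.add)
  show "scalar c * u \<in> powers_times y A" if "u \<in> powers_times y A" for c u
    using that
  proof induction
    case (base w)
    then show ?case using assms by (auto simp: subspace_J_def intro: powers_times.base)
  next
    case (mult w)
    have "scalar c * (y * w) = y * (scalar c * w)"
      by (simp add: mult.assoc[symmetric] scalar_central)
    then show ?case using mult.IH by (simp add: powers_times.mult)
  next
    case (add v w)
    then show ?case by (simp add: distrib_left powers_times.add)
  qed
qed

text \<open>The relation moves \<open>x\<close> through the powers of \<open>y\<close> one at a
  time. Its correction \<open>z\<close> must already preserve the larger set, which dictates the
  order of the steps in \<open>S6_closed\<close>.\<close>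

lemma powers_times_closed:
  assumes A: "subspace_J A"
    and x: "\<And>w. w \<in> A \<Longrightarrow> x * w \<in> A"
    and z: "\<And>w. w \<in> powers_times y A \<Longrightarrow> z * w \<in> powers_times y A"
    and rel: "x * y - (scalar c * (y * x) + scalar d * z) \<in> J"
    and w: "w \<in> powers_times y A"
  shows "x * w \<in> powers_times y A"
  using w
proof induction
  case (base w)
  then show ?case by (intro powers_times.base x)
next
  case (mult w)
  note sub = subspace_J_powers_times[OF A, of y, unfolded subspace_J_def]
  have "x * (y * w) = scalar c * (y * (x * w)) + scalar d * (z * w)
      + (x * y - (scalar c * (y * x) + scalar d * z)) * w"
    by (simp add: algebra_simps)
  also have "\<dots> \<in> powers_times y A"
    using sub z[OF mult.hyps] powers_times.mult[OF mult.IH] J_right[OF rel, of w] by blast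
  finally show ?case .
next
  case (add v w)
  then show ?case by (simp add: distrib_left powers_times.add)
qed

lemma powers_times_closed0:
  assumes A: "subspace_J A" and x: "\<And>w. w \<in> A \<Longrightarrow> x * w \<in> A"
    and rel: "x * y - scalar c * (y * x) \<in> J" and w: "w \<in> powers_times y A"
  shows "x * w \<in> powers_times y A"
proof (rule powers_times_closed[OF A x _ _ w])
  show "0 * v \<in> powers_times y A" for v
    using subspace_J_powers_times[OF A, of y] J_0 by (auto simp: subspace_J_def)
  show "x * y - (scalar c * (y * x) + scalar 0 * 0) \<in> J"
    using rel by simp
qed

text \<open>These are the relations met when \<open>gen E1\<close> is moved to the right through an
  ordered monomial: \<open>gen E1\<close> past every other factor, and each resulting correction
  past the factors to its right. Those that are not definitions or Serre relations are reached in
  the order 36, 26, 25, 14, 23, 45, 34, each from earlier ones.\<close>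

lemma relations_in_J:
  "gen E1 * gen E2 - (scalar (s^3) * (gen E2 * gen E1) + scalar (r^3 - s^3) * y5) \<in> J"
  "gen E1 * y5 - (scalar (r * s^2) * (y5 * gen E1) + scalar (r^2 - s^2) * y3) \<in> J"
  "gen E1 * y3 - (scalar (r^2 * s) * (y3 * gen E1) + scalar (r - s) * y2) \<in> J"
  "y3 * y5 - (scalar (r^2 * s) * (y5 * y3) + scalar (r - s) * y4) \<in> J"
  "gen E1 * y2 - scalar (r^3) * (y2 * gen E1) \<in> J"
  "y5 * gen E2 - scalar (r^3) * (gen E2 * y5) \<in> J"
  "gen E1 * y4 - (scalar (r^3 * s^3) * (y4 * gen E1) + scalar (r * (r^3 - s^3)) * (y3 * y3)) \<in> J"
  "y2 * y3 - scalar (r^3) * (y3 * y2) \<in> J"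
  "y4 * y5 - scalar (r^3) * (y5 * y4) \<in> J"
  "y3 * y4 - scalar (r^3) * (y4 * y3) \<in> J"
proof -
  let ?r = "scalar r" and ?s = "scalar s" and ?y1 = "gen E1" and ?y6 = "gen E2"
  let ?K3 = "?r^3 - ?s^3"
  let ?p36 = "y3 * ?y6 - (?r^3 * ?s^3 * ?y6 * y3 + ?r * ?K3 * y5 * y5)"
  let ?p26 = "y2 * ?y6 - (?r^3 * ?s^6 * ?y6 * y2
      + ?r^2 * ?s * (?r^2 + ?r * ?s + ?s^2) * ?K3 * y5 * y3
      + ?r * (?r^2 - ?r * ?s - ?s^2) * ?K3 * y4)"
  let ?p25 = "y2 * y5 - (?r^3 * ?s^3 * y5 * y2 + ?r * ?K3 * y3 * y3)"
  let ?p14 = "?y1 * y4 - (?r^3 * ?s^3 * y4 * ?y1 + ?r * ?K3 * y3 * y3)"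
  \<comment> \<open>Supplied to the relations of \<open>pbw_ring\<close>, this instantiates the
    defect in their hypotheses by the difference of the two sides.\<close>
  have split: "x = y + (x - y)" for x y :: free2 by simp
  note nz = nonzero r0 s0 and prods = J_right[OF J_left]
  have 36: "?p36 \<in> J"
  proof (rule J_scalar_cancel)
    show "scalar (r^2 - s^2) * ?p36 \<in> J"
      unfolding scalar_simps free.rel36
      by (intro J_diff J_left[OF p56_in_J] prods p56_in_J)
  qed (use nz in simp)
  have 26: "?p26 \<in> J"
  proof (rule J_scalar_cancel)
    show "scalar (r - s) * ?p26 \<in> J"
      unfolding scalar_simps free.rel26[OF split]
      by (intro J_diff J_left[OF 36] prods 36)
  qed (use nz in simp)
  have e14: "?y1 * y4 = ?r^3 * ?s^3 * y4 * ?y1 + y2 * y5 - ?r^3 * ?s^3 * y5 * y2"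
    using free.ex14 scalar_cancel[OF nonzero(1)] by (simp only: scalar_simps)
  have 25: "?p25 \<in> J"
  proof (rule J_scalar_cancel)
    show "scalar (r * s * (r + s) * (r^3 - s^3)) * ?p25 \<in> J"
      unfolding scalar_simps free.rel25[OF e14 split]
      by (intro J_add J_diff J_left[OF 26] prods 26 J_left[OF p12_in_J] J_right[OF p12_in_J])
  qed (use nz in simp)
  have 14: "?p14 \<in> J"
    using 25 unfolding e14 by (simp add: algebra_simps)
  have 23: "y2 * y3 - ?r^3 * y3 * y2 \<in> J"
  proof (rule J_scalar_cancel)
    show "scalar (r * s * (r - s) * (r^2 + s^2)) * (y2 * y3 - ?r^3 * y3 * y2) \<in> J"
      unfolding scalar_simps free.rel23[OF split]
      by (intro J_add J_diff J_left[OF 25] prods 25 J_left[OF p12_in_J] J_right[OF p12_in_J])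
  qed (use nz in simp)
  have 45: "y4 * y5 - ?r^3 * y5 * y4 \<in> J"
  proof (rule J_scalar_cancel)
    show "scalar (r^2 * s^2 * (r^2 - r * s + s^2) * (r^3 - s^3)) * (y4 * y5 - ?r^3 * y5 * y4) \<in> J"
      unfolding scalar_simps free.rel45[OF split split split]
      by (intro J_add J_diff J_left[OF 25] J_left[OF 26] prods 26 36 J_left[OF 36] J_left[OF p56_in_J]
          J_right[OF 25] p56_in_J J_left[OF J_add] )
  qed (use nz in simp)
  have 34: "y3 * y4 - ?r^3 * y4 * y3 \<in> J"
  proof (rule J_scalar_cancel)
    show "scalar (r * s * (r - s) * (r^2 + s^2)) * (y3 * y4 - ?r^3 * y4 * y3) \<in> J"
      unfolding scalar_simps free.rel34[OF split split]
      by (intro J_add J_diff J_left[OF 45] prods 45 J_left[OF 14] J_right[OF 14])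
  qed (use nz in simp)
  show "?y1 * ?y6 - (scalar (s^3) * (?y6 * ?y1) + scalar (r^3 - s^3) * y5) \<in> J"
    "?y1 * y5 - (scalar (r * s^2) * (y5 * ?y1) + scalar (r^2 - s^2) * y3) \<in> J"
    "?y1 * y3 - (scalar (r^2 * s) * (y3 * ?y1) + scalar (r - s) * y2) \<in> J"
    "y3 * y5 - (scalar (r^2 * s) * (y5 * y3) + scalar (r - s) * y4) \<in> J"
    by (simp_all add: scalar_simps free.h16 free.h15 free.h13 free.h35 J_0 mult.assoc)
  show "?y1 * y2 - scalar (r^3) * (y2 * ?y1) \<in> J" "y5 * ?y6 - scalar (r^3) * (?y6 * y5) \<in> J"
    "y2 * y3 - scalar (r^3) * (y3 * y2) \<in> J" "y4 * y5 - scalar (r^3) * (y5 * y4) \<in> J"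
    "y3 * y4 - scalar (r^3) * (y4 * y3) \<in> J"
    "?y1 * y4 - (scalar (r^3 * s^3) * (y4 * ?y1) + scalar (r * (r^3 - s^3)) * (y3 * y3)) \<in> J"
    using p12_in_J p56_in_J 23 45 34 14 by (simp_all add: scalar_simps mult.assoc)
qed

definition "S0 = {scalar c + j | c j. j \<in> J}"
definition "S1 = powers_times (gen E1) S0"
definition "S2 = powers_times y2 S1"
definition "S3 = powers_times y3 S2"
definition "S4 = powers_times y4 S3"
definition "S5 = powers_times y5 S4"
definition "S6 = powers_times (gen E2) S5"

lemma subspace_S: "subspace_J S0" "subspace_J S1" "subspace_J S2" "subspace_J S3" "subspace_J S4"
  "subspace_J S5" "subspace_J S6"
proof -
  show "subspace_J S0"
    unfolding subspace_J_def
  proof (intro conjI ballI allI subsetI)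
    show "j \<in> S0" if "j \<in> J" for j
      using that unfolding S0_def by (intro CollectI exI[of _ 0] exI[of _ j]) (simp add: scalar_hom)
    show "u + v \<in> S0" if "u \<in> S0" "v \<in> S0" for u v
    proof -
      from that obtain c d j k where "u = scalar c + j" "v = scalar d + k" "j \<in> J" "k \<in> J"
        unfolding S0_def by blast
      then show ?thesis
        unfolding S0_def by (intro CollectI exI[of _ "c + d"] exI[of _ "j + k"]) (simp add: scalar_hom J_add)
    qed
    show "scalar c * u \<in> S0" if "u \<in> S0" for c u
    proof -
      from that obtain d j where "u = scalar d + j" "j \<in> J"
        unfolding S0_def by blast
      then show ?thesis
        unfolding S0_def
        by (intro CollectI exI[of _ "c * d"] exI[of _ "scalar c * j"])
            (simp add: scalar_hom distrib_left J_left)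
    qed
  qed
  then show 1: "subspace_J S1" unfolding S1_def by (rule subspace_J_powers_times)
  then show 2: "subspace_J S2" unfolding S2_def by (rule subspace_J_powers_times)
  then show 3: "subspace_J S3" unfolding S3_def by (rule subspace_J_powers_times)
  then show 4: "subspace_J S4" unfolding S4_def by (rule subspace_J_powers_times)
  then show 5: "subspace_J S5" unfolding S5_def by (rule subspace_J_powers_times)
  then show 6: "subspace_J S6" unfolding S6_def by (rule subspace_J_powers_times)
qed

lemma S6_closed: "w \<in> S6 \<Longrightarrow> gen E1 * w \<in> S6" "w \<in> S6 \<Longrightarrow> gen E2 * w \<in> S6"
proof -
  note c0 = powers_times_closed0 and c = powers_times_closed
  \<comment> \<open>The name \<open>ij\<close> records that the generator of index i maps
    \<open>Sj\<close> into itself. A pair is treated after the facts about the corrections in its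
    relation.\<close>
  have 11: "gen E1 * w \<in> S1" if "w \<in> S1" for w
    using that unfolding S1_def by (rule powers_times.mult)
  have 22: "y2 * w \<in> S2" if "w \<in> S2" for w
    using that unfolding S2_def by (rule powers_times.mult)
  have 33: "y3 * w \<in> S3" if "w \<in> S3" for w
    using that unfolding S3_def by (rule powers_times.mult)
  have 44: "y4 * w \<in> S4" if "w \<in> S4" for w
    using that unfolding S4_def by (rule powers_times.mult)
  have 55: "y5 * w \<in> S5" if "w \<in> S5" for w
    using that unfolding S5_def by (rule powers_times.mult)
  show "w \<in> S6 \<Longrightarrow> gen E2 * w \<in> S6"
    unfolding S6_def by (rule powers_times.mult)
  have 12: "gen E1 * w \<in> S2" if "w \<in> S2" for w
    unfolding S2_def by (rule c0[OF subspace_S(2) _ relations_in_J(5) that[unfolded S2_def]]) (rule 11)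
  have 23: "y2 * w \<in> S3" if "w \<in> S3" for w
    unfolding S3_def by (rule c0[OF subspace_S(3) _ relations_in_J(8) that[unfolded S3_def]]) (rule 22)
  have 13: "gen E1 * w \<in> S3" if "w \<in> S3" for w
    unfolding S3_def by (rule c[OF subspace_S(3) _ _ relations_in_J(3) that[unfolded S3_def]]; erule 12
        23[unfolded S3_def])
  have 34: "y3 * w \<in> S4" if "w \<in> S4" for w
    unfolding S4_def by (rule c0[OF subspace_S(4) _ relations_in_J(10) that[unfolded S4_def]]) (rule 33)
  have 334: "(y3 * y3) * w \<in> S4" if "w \<in> S4" for w
    using 34[OF 34[OF that]] by (simp only: mult.assoc)
  have 14: "gen E1 * w \<in> S4" if "w \<in> S4" for w
    unfolding S4_def by (rule c[OF subspace_S(4) _ _ relations_in_J(7) that[unfolded S4_def]]; erule 13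
        334[unfolded S4_def])
  have 45: "y4 * w \<in> S5" if "w \<in> S5" for w
    unfolding S5_def by (rule c0[OF subspace_S(5) _ relations_in_J(9) that[unfolded S5_def]]) (rule 44)
  have 35: "y3 * w \<in> S5" if "w \<in> S5" for w
    unfolding S5_def by (rule c[OF subspace_S(5) _ _ relations_in_J(4) that[unfolded S5_def]]; erule 34
        45[unfolded S5_def])
  have 15: "gen E1 * w \<in> S5" if "w \<in> S5" for w
    unfolding S5_def by (rule c[OF subspace_S(5) _ _ relations_in_J(2) that[unfolded S5_def]]; erule 14
        35[unfolded S5_def])
  have 56: "y5 * w \<in> S6" if "w \<in> S6" for w
    unfolding S6_def by (rule c0[OF subspace_S(6) _ relations_in_J(6) that[unfolded S6_def]]) (rule 55)
  show "gen E1 * w \<in> S6" if "w \<in> S6"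
    unfolding S6_def by (rule c[OF subspace_S(6) _ _ relations_in_J(1) that[unfolded S6_def]]; erule 15
        56[unfolded S6_def])
qed

lemma S6_UNIV: "x \<in> S6"
proof (induction x rule: basis_induct)
  case (delta w)
  show ?case
  proof (induction w)
    case Nil
    have "1 \<in> S0"
      unfolding S0_def by (intro CollectI exI[of _ 1] exI[of _ 0]) (simp add: scalar_hom J_0)
    then have "1 \<in> S6"
      unfolding S6_def S5_def S4_def S3_def S2_def S1_def by (intro powers_times.base)
    then show ?case by (simp flip: single_one zero_list_def)
  next
    case (Cons l w)
    have "delta (l # w) = gen l * delta w"
      by (simp add: gen_def mult_single plus_list_def)
    then show ?case using Cons S6_closed by (cases l) simp_all
  qed
next
  case (add u v)
  then show ?case using subspace_S(7) by (simp add: subspace_J_def)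
next
  case (scale c v)
  then show ?case using subspace_S(7) by (simp add: subspace_J_def scale_eq_scalar)
next
  case zero
  then show ?case using subspace_S(7) J_0 by (auto simp: subspace_J_def)
qed

lemma straighten_step:
  assumes A: "\<And>x. x \<in> A \<Longrightarrow> keys (phi x) \<subseteq> K \<and> psi (phi x) - x \<in> J"
    and K: "K \<subseteq> K'"
    and step: "\<And>a. a \<in> K' \<Longrightarrow> L (delta a) = delta (a + e) \<and> a + e \<in> K' \<and> psi (delta (a + e))
        = y * psi (delta a)"
    and phi: "\<And>w. phi (y * w) = L (phi w)" and L: "lin L"
    and x: "x \<in> powers_times y A"
  shows "keys (phi x) \<subseteq> K' \<and> psi (phi x) - x \<in> J"
  using x
proof induction
  case (base w)
  then show ?case using A[of w] K by (intro conjI subset_trans[OF _ K]) simp_all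
next
  case (mult w)
  have step': "L (delta k) = delta (k + e)" "k + e \<in> K'" "psi (delta (k + e)) = y * psi (delta k)"
    if "k \<in> keys v" "keys v \<subseteq> K'" for k v
    using step[OF subsetD[OF that(2,1)]] by simp_all
  have "keys (L v) \<subseteq> K'" if v: "keys v \<subseteq> K'" for v
  proof (rule subsetI)
    fix j assume "j \<in> keys (L v)"
    then have "j \<in> keys (lext (\<lambda>k. L (delta k)) v)"
      using lin_lext_unique[OF L, of v] by simp
    then obtain k where "k \<in> keys v" "j \<in> keys (L (delta k))" by (rule keys_lext)
    then show "j \<in> K'" using step'[OF _ v, of k] by simp
  qed
  moreover have "psi (L v) = y * psi v" if v: "keys v \<subseteq> K'" for v
  proof (rule lin_eqI[where f = "\<lambda>v. psi (L v)"])
    show "lin (\<lambda>v. psi (L v))" "lin (\<lambda>v. y * psi v)"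
      by (rule lin_comp[OF lin_psi L] lin_comp[OF lin_mult_left lin_psi])+
    show "psi (L (delta k)) = y * psi (delta k)" if "k \<in> keys v" for k
      using step'[OF that v] by simp
  qed
  ultimately show ?case
    using mult.IH J_left[of "psi (phi w) - w" y] by (simp add: phi right_diff_distrib)
next
  case (add v w)
  have "keys (phi (v + w)) \<subseteq> keys (phi v) \<union> keys (phi w)"
    unfolding lin_add[OF lin_phi] by (rule keys_add)
  also have "\<dots> \<subseteq> K'" using add.IH by (intro Un_least) simp_all
  finally have "keys (phi (v + w)) \<subseteq> K'" .
  moreover have "psi (phi (v + w)) - (v + w) = (psi (phi v) - v) + (psi (phi w) - w)"
    by (simp only: lin_add[OF lin_phi] lin_add[OF lin_psi] add_diff_add)
  moreover have "(psi (phi v) - v) + (psi (phi w) - w) \<in> J"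
    using add.IH by (intro J_add) simp_all
  ultimately show ?case by (simp only: simp_thms)
qed

lemma psi_phi: "psi (phi x) - x \<in> J"
proof -
  define K0 :: "idx set" where "K0 = {(0, 0, 0, 0, 0, 0)}"
  define K1 :: "idx set" where "K1 = {(a1, 0, 0, 0, 0, 0) | a1. True}"
  define K2 :: "idx set" where "K2 = {(a1, a2, 0, 0, 0, 0) | a1 a2. True}"
  define K3 :: "idx set" where "K3 = {(a1, a2, a3, 0, 0, 0) | a1 a2 a3. True}"
  define K4 :: "idx set" where "K4 = {(a1, a2, a3, a4, 0, 0) | a1 a2 a3 a4. True}"
  define K5 :: "idx set" where "K5 = {(a1, a2, a3, a4, a5, 0) | a1 a2 a3 a4 a5. True}"
  have 0: "keys (phi x) \<subseteq> K0 \<and> psi (phi x) - x \<in> J" if "x \<in> S0" for x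
  proof -
    from that obtain c j where x: "x = scalar c + j" "j \<in> J" unfolding S0_def by blast
    then have phi: "phi x = scale c (delta (0, 0, 0, 0, 0, 0))"
      by (simp add: phi_def act_rules act_J)
    then have "psi (phi x) = scalar c"
      by (simp add: lin_scale[OF lin_psi] psi_delta scale_eq_scalar)
    then have "psi (phi x) - x = - j" by (simp add: x)
    then show ?thesis
      using J_uminus[OF x(2)] by (simp add: phi scale_delta K0_def)
  qed
  have 1: "keys (phi x) \<subseteq> K1 \<and> psi (phi x) - x \<in> J" if "x \<in> S1" for x
    by (rule straighten_step[OF 0 _ _ phi_mult(1) lin_term_op that[unfolded S1_def], where e
        = "(1, 0, 0, 0, 0, 0)"])
      (auto simp: K0_def K1_def L_raise psi_delta)
  have 2: "keys (phi x) \<subseteq> K2 \<and> psi (phi x) - x \<in> J" if "x \<in> S2" for x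
    by (rule straighten_step[OF 1 _ _ phi_mult(2) lin_term_op that[unfolded S2_def], where e
        = "(0, 1, 0, 0, 0, 0)"])
      (auto simp: K1_def K2_def L_raise psi_delta mult.assoc)
  have 3: "keys (phi x) \<subseteq> K3 \<and> psi (phi x) - x \<in> J" if "x \<in> S3" for x
    by (rule straighten_step[OF 2 _ _ phi_mult(3) lin_term_op that[unfolded S3_def], where e
        = "(0, 0, 1, 0, 0, 0)"])
      (auto simp: K2_def K3_def L_raise psi_delta mult.assoc)
  have 4: "keys (phi x) \<subseteq> K4 \<and> psi (phi x) - x \<in> J" if "x \<in> S4" for x
    by (rule straighten_step[OF 3 _ _ phi_mult(4) lin_term_op that[unfolded S4_def], where e
        = "(0, 0, 0, 1, 0, 0)"])
      (auto simp: K3_def K4_def L_raise psi_delta mult.assoc)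
  have 5: "keys (phi x) \<subseteq> K5 \<and> psi (phi x) - x \<in> J" if "x \<in> S5" for x
    by (rule straighten_step[OF 4 _ _ phi_mult(5) lin_term_op that[unfolded S5_def], where e
        = "(0, 0, 0, 0, 1, 0)"])
      (auto simp: K4_def K5_def L_raise psi_delta mult.assoc)
  have "keys (phi x) \<subseteq> UNIV \<and> psi (phi x) - x \<in> J"
    by (rule straighten_step[OF 5 _ _ phi_mult(6) lin_term_op S6_UNIV[unfolded S6_def],
          where e = "(0, 0, 0, 0, 0, 1)"])
      (auto simp: split_paired_all L_raise psi_delta mult.assoc)
  then show ?thesis by simp
qed

lemma phi_eq_0_iff: "phi x = 0 \<longleftrightarrow> x \<in> J"
proof
  assume "phi x = 0"
  then show "x \<in> J" using psi_phi[of x] J_uminus[of "- x"] by (simp add: lin_zero[OF lin_psi])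
qed (simp add: phi_def act_J)

section \<open>The product on the space of ordered monomials\<close>

lemma funpow_raise:
  "(L1 ^^ n) (delta (a1, 0, 0, 0, 0, 0)) = delta (n + a1, 0, 0, 0, 0, 0)"
  "(L2 ^^ n) (delta (a1, a2, 0, 0, 0, 0)) = delta (a1, n + a2, 0, 0, 0, 0)"
  "(L3 ^^ n) (delta (a1, a2, a3, 0, 0, 0)) = delta (a1, a2, n + a3, 0, 0, 0)"
  "(L4 ^^ n) (delta (a1, a2, a3, a4, 0, 0)) = delta (a1, a2, a3, n + a4, 0, 0)"
  "(L5 ^^ n) (delta (a1, a2, a3, a4, a5, 0)) = delta (a1, a2, a3, a4, n + a5, 0)"
  "(L6 ^^ n) (delta (a1, a2, a3, a4, a5, a6)) = delta (a1, a2, a3, a4, a5, n + a6)"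
  by (induction n) (simp_all add: L_raise)

lemma act_power: "act (x ^ n) v = (act x ^^ n) v"
  by (induction n arbitrary: v) (simp_all add: act_rules)

lemma act_eq_L: "act (gen E1) = L1" "act (gen E2) = L6" "act y5 = L5" "act y3 = L3"
  "act y2 = L2" "act y4 = L4"
  by (simp_all add: fun_eq_iff act_simps act_y)

text \<open>The product of \<open>U\<close> read in the basis of ordered monomials; by
  \<open>delta_star\<close>, computing with it means applying the operators \<open>L1\<close> to
  \<open>L6\<close>.\<close>

definition star :: "vec \<Rightarrow> vec \<Rightarrow> vec" (infixl "\<star>" 70) where
  "u \<star> v = act (psi u) v"

abbreviation one :: vec ("\<^bold>1") where
  "\<^bold>1 \<equiv> delta (0, 0, 0, 0, 0, 0)"

lemma delta_star:
  "delta (a1, a2, a3, a4, a5, a6) \<star> v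
   = (L6 ^^ a6) ((L5 ^^ a5) ((L4 ^^ a4) ((L3 ^^ a3) ((L2 ^^ a2) ((L1 ^^ a1) v)))))"
  by (simp add: star_def psi_delta act_mult act_power act_eq_L)

lemma star_one: "v \<star> \<^bold>1 = v"
proof -
  have "lin (\<lambda>v. v \<star> \<^bold>1)"
    unfolding star_def by (rule lin_comp[OF lin_act_left lin_psi])
  then show ?thesis
  proof (rule lin_eqI[OF _ lin_id])
    show "delta k \<star> \<^bold>1 = delta k" for k
      by (cases k rule: prod_cases6) (simp add: delta_star funpow_raise)
  qed
qed

text \<open>This is the linear independence of the ordered monomials: applied to the unit, the
  operators of an ordered monomial produce exactly its own exponent. Together with
  \<open>psi_phi\<close> it is the PBW theorem for \<open>U\<close>.\<close>

lemma phi_psi: "phi (psi v) = v"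
  using star_one by (simp add: phi_def star_def)

lemma act_phi: "phi x \<star> v = act x v"
  using act_J[OF psi_phi, of x v] by (simp add: star_def act_simps)

lemma phi_star: "phi (x * y) = phi x \<star> phi y"
  by (simp add: act_phi) (simp add: phi_def act_mult)

lemma phi_1: "phi 1 = \<^bold>1"
  by (simp add: phi_def act_simps)

lemma one_star: "\<^bold>1 \<star> v = v"
  using act_phi[of 1 v] by (simp add: phi_1 act_simps)

lemma star_assoc: "u \<star> v \<star> w = u \<star> (v \<star> w)"
  using phi_star[of "psi u" "psi v"] act_phi[of "psi u * psi v" w]
  by (simp add: phi_psi act_mult) (simp add: star_def)

lemma lin_star_left: "lin (\<lambda>u. u \<star> v)"
  unfolding star_def by (rule lin_comp[OF lin_act_left lin_psi])

lemma lin_star_right: "lin (\<lambda>v. u \<star> v)"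
  unfolding star_def by (rule lin_act)

lemmas star_simps = lin_simps[OF lin_star_left] lin_simps[OF lin_star_right]

abbreviation x1 :: vec where "x1 \<equiv> delta (1, 0, 0, 0, 0, 0)"
abbreviation x6 :: vec where "x6 \<equiv> delta (0, 0, 0, 0, 0, 1)"

lemma phi_gen: "phi (gen E1) = x1" "phi (gen E2) = x6"
  using L_raise(1)[of 0] L_raise(6)[of 0 0 0 0 0 0] by (simp_all add: phi_def act_simps)

lemma generators_induct [case_names one x1 x6 add scale]:
  assumes "P \<^bold>1" and "\<And>v. P v \<Longrightarrow> P (x1 \<star> v)" and "\<And>v. P v \<Longrightarrow> P (x6 \<star> v)"
    and "\<And>u v. P u \<Longrightarrow> P v \<Longrightarrow> P (u + v)" and "\<And>c v. P v \<Longrightarrow> P (scale c v)"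
  shows "P v"
proof -
  have "P (phi x)" for x
  proof (induction x rule: basis_induct)
    case (delta w)
    show ?case
    proof (induction w)
      case Nil
      then show ?case using assms(1) phi_1 by (simp flip: single_one zero_list_def)
    next
      case (Cons l w)
      have "delta (l # w) = gen l * delta w"
        by (simp add: gen_def mult_single plus_list_def)
      then show ?case using Cons assms(2,3) by (cases l) (simp_all add: phi_star phi_gen)
    qed
  next
    case zero
    then show ?case using assms(5)[OF assms(1), of 0] by (simp add: lin_zero[OF lin_phi])
  qed (auto simp: lin_add[OF lin_phi] lin_scale[OF lin_phi] intro: assms(4,5))
  from this[of "psi v"] show ?thesis by (simp add: phi_psi)
qed

end

subsection \<open>Grading and leading terms\<close>

text \<open>The weights of \<open>X\<^sub>1\<close> to \<open>X\<^sub>6\<close> are the positive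
  roots of G2, in coordinates that count the occurrences of \<open>e\<^sub>1\<close> and
  \<open>e\<^sub>2\<close>.\<close>

definition degz :: "zidx \<Rightarrow> int \<times> int" where
  "degz = (\<lambda>(a1, a2, a3, a4, a5, a6).
     (a1 + 3 * a2 + 2 * a3 + 3 * a4 + a5, a2 + a3 + 2 * a4 + a5 + a6))"

definition deg :: "idx \<Rightarrow> int \<times> int" where
  "deg a = degz (zi a)"

definition hom_deg :: "int \<times> int \<Rightarrow> vec \<Rightarrow> bool" where
  "hom_deg d v \<longleftrightarrow> (\<forall>k\<in>keys v. deg k = d)"

definition component :: "int \<times> int \<Rightarrow> vec \<Rightarrow> vec" where
  "component d = lext (\<lambda>k. if deg k = d then delta k else 0)"

lemma degz_add: "degz (a + b) = degz a + degz b"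
  by (cases a rule: prod_cases6, cases b rule: prod_cases6) (simp add: degz_def)

lemma deg_add: "deg (a + b) = deg a + deg b"
  by (simp add: deg_def zi_add degz_add)

lemma deg_eq: "deg (a1, a2, a3, a4, a5, a6) =
  (int a1 + 3 * int a2 + 2 * int a3 + 3 * int a4 + int a5, int a2 + int a3 + 2 * int a4 + int a5 + int a6)"
  by (simp add: deg_def degz_def zi_def)

lemma hom_deg_delta: "hom_deg (deg k) (delta k)"
  and hom_deg_0: "hom_deg d 0"
  and hom_deg_scale: "hom_deg d v \<Longrightarrow> hom_deg d (scale c v)"
  by (auto simp: hom_deg_def in_keys_iff lookup_single when_def)

lemma hom_deg_add: "hom_deg d u \<Longrightarrow> hom_deg d v \<Longrightarrow> hom_deg d (u + v)"
  using keys_add[of u v] by (auto simp: hom_deg_def)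

lemma hom_deg_diff: "hom_deg d u \<Longrightarrow> hom_deg d v \<Longrightarrow> hom_deg d (u - v)"
  using hom_deg_add[of d u "scale (- 1) v"] hom_deg_scale[of d v "- 1"] by (simp add: scale_distrib)

lemma hom_deg_lext:
  assumes "\<And>k. k \<in> keys v \<Longrightarrow> hom_deg d (f k)"
  shows "hom_deg d (lext f v)"
  unfolding hom_deg_def
proof
  fix j assume "j \<in> keys (lext f v)"
  then obtain k where "k \<in> keys v" "j \<in> keys (f k)" by (rule keys_lext)
  then show "deg j = d" using assms[of k] by (simp add: hom_deg_def)
qed

lemma lin_component: "lin (component d)"
  unfolding component_def by (rule lin_lext)

lemma lookup_component: "lookup (component d v) k = (if deg k = d then lookup v k else 0)"
proof (induction v rule: basis_induct)
  case (delta j)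
  then show ?case by (auto simp: component_def lookup_single when_def)
qed (auto simp: lin_simps[OF lin_component] lookup_add)

lemma hom_deg_component: "hom_deg d (component d v)"
  by (auto simp: hom_deg_def in_keys_iff lookup_component split: if_splits)

lemma component_hom_deg: "hom_deg d v \<Longrightarrow> component e v = (if e = d then v else 0)"
  by (rule poly_mapping_eqI) (auto simp: lookup_component hom_deg_def in_keys_iff)

lemma sum_components:
  assumes "finite A" "deg ` keys v \<subseteq> A"
  shows "(\<Sum>d\<in>A. component d v) = v"
proof (rule poly_mapping_eqI)
  fix k
  have "lookup (\<Sum>d\<in>A. component d v) k = (\<Sum>d\<in>A. if deg k = d then lookup v k else 0)"
    by (simp add: lookup_sum lookup_component)
  also have "\<dots> = lookup v k"
    using assms by (auto simp: sum.delta' in_keys_iff image_subset_iff)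
  finally show "lookup (\<Sum>d\<in>A. component d v) k = lookup v k" .
qed

lemma hom_deg_term_op:
  assumes "valid ts" "\<And>t. t \<in> fst ` set ts \<Longrightarrow> degz t = e" "hom_deg d v"
  shows "hom_deg (e + d) (term_op ts v)"
  unfolding hom_deg_def
proof
  fix k assume "k \<in> keys (term_op ts v)"
  then obtain a t where "a \<in> keys v" "t \<in> fst ` set ts" "zi k = zi a + t"
    using keys_term_op[OF assms(1)] by blast
  then show "deg k = e + d"
    using assms(2,3) by (simp add: hom_deg_def deg_def degz_add)
qed

lemma hom_deg_funpow:
  assumes "\<And>d v. hom_deg d v \<Longrightarrow> hom_deg (e + d) (f v)" "hom_deg d v"
  shows "hom_deg ((of_nat n * fst e, of_nat n * snd e) + d) ((f ^^ n) v)"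
proof (induction n)
  case (Suc n)
  have eq: "e + ((int n * fst e, int n * snd e) + d) = (int (Suc n) * fst e, int (Suc n) * snd e) + d"
    by (simp add: prod_eq_iff algebra_simps)
  show ?case using assms(1)[OF Suc] unfolding eq funpow.simps comp_apply .
qed (simp add: assms(2) flip: zero_prod_def)

text \<open>The exponent \<open>n\<close> need not occur in \<open>v\<close>. Allowing a zero
  coefficient there makes the notion stable under differences and lets top coefficients be compared
  linearly.\<close>

definition bounded_by :: "vec \<Rightarrow> idx \<Rightarrow> bool" where
  "bounded_by v n \<longleftrightarrow> (\<forall>k\<in>keys v. k \<le> n)"

text \<open>The order on \<open>idx\<close> is lexicographic, with the exponent of \<open>X\<^sub>1\<close> most significant.\<close>

definition tops :: "(vec \<Rightarrow> vec) \<Rightarrow> idx \<Rightarrow> (idx \<Rightarrow> complex) \<Rightarrow> bool" where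
  "tops f e c \<longleftrightarrow> (\<forall>v n. bounded_by v n \<longrightarrow>
     bounded_by (f v) (e + n) \<and> lookup (f v) (e + n) = c n * lookup v n)"

lemma zidx_add_mono:
  assumes "(a :: zidx) \<le> b" "c \<le> d"
  shows "a + c \<le> b + d"
proof -
  have *: "x + y \<le> x + z \<longleftrightarrow> y \<le> z" for x y z :: zidx
    by (cases x rule: prod_cases6, cases y rule: prod_cases6, cases z rule: prod_cases6) simp
  have "a + c \<le> a + d" using assms(2) by (simp only: *)
  also have "a + d = d + a" by (rule add.commute)
  also have "d + a \<le> d + b" using assms(1) by (simp only: *)
  also have "d + b = b + d" by (rule add.commute)
  finally show ?thesis .
qed

lemma zidx_add_less_mono:
  assumes "(a :: zidx) \<le> b" "c < d"
  shows "a + c < b + d"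
proof -
  have "a + c < a + d" using assms(2) by (simp only: zidx_add_less_iff)
  also have "a + d \<le> b + d" using assms(1) by (rule zidx_add_mono) (rule order_refl)
  finally show ?thesis .
qed

lemma zi_le_iff: "zi a \<le> zi b \<longleftrightarrow> a \<le> b"
  by (simp only: not_less[symmetric] zi_less_iff)

lemma split_top:
  assumes "bounded_by v n"
  obtains v' where "v = scale (lookup v n) (delta n) + v'" "\<And>k. k \<in> keys v' \<Longrightarrow> k < n"
proof
  show "v = scale (lookup v n) (delta n) + (v - scale (lookup v n) (delta n))" by simp
  fix k assume "k \<in> keys (v - scale (lookup v n) (delta n))"
  then have "k \<in> keys v" "k \<noteq> n"
    by (auto simp: in_keys_iff lookup_minus lookup_single when_def split: if_splits)
  then show "k < n" using assms[unfolded bounded_by_def] by (intro le_neq_trans) (rule bspec)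
qed

text \<open>The lexicographic order is translation invariant, so \<open>e + n\<close> is reached
  only from \<open>n\<close> by the dominant shift: smaller exponents of the argument and smaller
  shifts in \<open>us\<close> both end strictly below it.\<close>

lemma tops_term_op:
  assumes ts: "ts = (zi e, w) # us" and v: "valid ts" and less: "\<And>t. t \<in> fst ` set us \<Longrightarrow> t < zi e"
  shows "tops (term_op ts) e (\<lambda>n. w (zi n))"
  unfolding tops_def
proof (intro allI impI conjI)
  fix x n assume x: "bounded_by x n"
  have le: "t \<le> zi e" if "t \<in> fst ` set ts" for t
  proof -
    from that have "t = zi e \<or> t \<in> fst ` set us"
      by (simp only: ts list.set image_insert fst_conv insert_iff)
    then show ?thesis using less[of t] order_less_imp_le[of t "zi e"] by blast
  qed
  show "bounded_by (term_op ts x) (e + n)"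
    unfolding bounded_by_def
  proof
    fix k assume "k \<in> keys (term_op ts x)"
    then obtain a t where a: "a \<in> keys x" and t: "t \<in> fst ` set ts" and k: "zi k = zi a + t"
      using keys_term_op[OF v] by blast
    have "zi a \<le> zi n" using a x by (simp only: bounded_by_def zi_le_iff)
    then have "zi k \<le> zi n + zi e" unfolding k using le[OF t] by (rule zidx_add_mono)
    then show "k \<le> e + n" by (simp only: zi_add[symmetric] zi_le_iff add.commute)
  qed
  obtain x' where x': "x = scale (lookup x n) (delta n) + x'" "\<And>k. k \<in> keys x' \<Longrightarrow> k < n"
    using split_top[OF x] by blast
  have 1: "lookup (term_op ts x') (e + n) = 0"
  proof (rule ccontr)
    assume "lookup (term_op ts x') (e + n) \<noteq> 0"
    then have "e + n \<in> keys (term_op ts x')" by (simp add: in_keys_iff)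
    then obtain a t where a: "a \<in> keys x'" and t: "t \<in> fst ` set ts" and k: "zi (e + n) = zi a + t"
      using keys_term_op[OF v] by blast
    have "zi a < zi n" using x'(2)[OF a] by (simp only: zi_less_iff)
    then have "t + zi a < zi e + zi n" by (rule zidx_add_less_mono[OF le[OF t]])
    then show False using k by (simp add: zi_add add.commute)
  qed
  have vus: "valid us" using v by (simp add: ts valid_def)
  have 2: "lookup (term_op us (delta n)) (e + n) = 0"
  proof (rule ccontr)
    assume "lookup (term_op us (delta n)) (e + n) \<noteq> 0"
    then have "e + n \<in> keys (term_op us (delta n))" by (simp add: in_keys_iff)
    then obtain a t where a: "a \<in> keys (delta n)" and t: "t \<in> fst ` set us" and k: "zi (e + n) = zi a + t"
      using keys_term_op[OF vus] by blast
    have "zi n + t < zi n + zi e" by (rule zidx_add_less_mono[OF order_refl less[OF t]])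
    then show False using k a by (simp add: zi_add add.commute)
  qed
  have "term_op ts (delta n) = Poly_Mapping.single (e + n) (w (zi n)) + term_op us (delta n)"
    unfolding term_op_delta ts by (simp add: add.commute flip: zi_add)
  then show "lookup (term_op ts x) (e + n) = w (zi n) * lookup x n"
    by (subst x'(1)) (simp add: lin_simps[OF lin_term_op] lookup_add 1 2)
qed

lemma tops_comp:
  assumes "tops f e c" "tops g e' c'"
  shows "tops (\<lambda>v. f (g v)) (e + e') (\<lambda>n. c (e' + n) * c' n)"
  using assms by (simp add: tops_def add.assoc)

lemma tops_id: "tops (\<lambda>v. v) 0 (\<lambda>n. 1)"
  by (simp add: tops_def)

context two_param
begin

text \<open>The scalars that appear when \<open>X\<^sub>i\<close> is moved past an ordered monomial.\<close>

definition kappa1 :: "idx \<Rightarrow> complex" where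
  "kappa1 n = snd (hd terms1) (zi n)"
definition kappa2 :: "idx \<Rightarrow> complex" where
  "kappa2 n = snd (hd terms2) (zi n)"
definition kappa3 :: "idx \<Rightarrow> complex" where
  "kappa3 n = snd (hd terms3) (zi n)"
definition kappa4 :: "idx \<Rightarrow> complex" where
  "kappa4 n = snd (hd terms4) (zi n)"
definition kappa5 :: "idx \<Rightarrow> complex" where
  "kappa5 n = snd (hd terms5) (zi n)"

lemmas kappa_defs = kappa1_def kappa2_def kappa3_def kappa4_def kappa5_def

lemma tops_L:
  "tops L1 (1, 0, 0, 0, 0, 0) kappa1" "tops L2 (0, 1, 0, 0, 0, 0) kappa2"
  "tops L3 (0, 0, 1, 0, 0, 0) kappa3" "tops L4 (0, 0, 0, 1, 0, 0) kappa4"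
  "tops L5 (0, 0, 0, 0, 1, 0) kappa5" "tops L6 (0, 0, 0, 0, 0, 1) (\<lambda>n. 1)"
proof -
  have *: "tops (term_op ts) e (\<lambda>n. snd (hd ts) (zi n))"
    if "valid ts" "ts \<noteq> []" "fst (hd ts) = zi e" "\<forall>t\<in>set (map fst (tl ts)). t < zi e" for ts e
  proof (rule tops_term_op[OF _ that(1)])
    show "ts = (zi e, snd (hd ts)) # tl ts" using that(2,3) by (metis prod.collapse list.collapse)
  qed (use that(4) in auto)
  note d = terms_defs list.map list.sel prod.sel ball_set_Cons zi_def
  show "tops L1 (1, 0, 0, 0, 0, 0) kappa1"
    unfolding kappa1_def[abs_def] by (rule *[OF valid_terms(1)]) (unfold d, simp_all)
  show "tops L2 (0, 1, 0, 0, 0, 0) kappa2"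
    unfolding kappa2_def[abs_def] by (rule *[OF valid_terms(2)]) (unfold d, simp_all)
  show "tops L3 (0, 0, 1, 0, 0, 0) kappa3"
    unfolding kappa3_def[abs_def] by (rule *[OF valid_terms(3)]) (unfold d, simp_all)
  show "tops L4 (0, 0, 0, 1, 0, 0) kappa4"
    unfolding kappa4_def[abs_def] by (rule *[OF valid_terms(4)]) (unfold d, simp_all)
  show "tops L5 (0, 0, 0, 0, 1, 0) kappa5"
    unfolding kappa5_def[abs_def] by (rule *[OF valid_terms(5)]) (unfold d, simp_all)
  have "tops L6 (0, 0, 0, 0, 0, 1) (\<lambda>n. snd (hd terms6) (zi n))"
    by (rule *[OF valid_terms(6)]) (unfold d, simp_all)
  then show "tops L6 (0, 0, 0, 0, 0, 1) (\<lambda>n. 1)"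
    by (simp add: terms_defs zi_def case_prod_unfold)
qed

lemma kappa_eq:
  "kappa1 (n1, n2, n3, n4, n5, n6)
      = r ^ (n2 * 3 + n3 * 2 + n4 * 3 + n5) * s ^ (n3 + n4 * 3 + n5 * 2 + n6 * 3)"
  "kappa2 (n1, n2, n3, n4, n5, n6) = r ^ (n3 * 3 + n4 * 6 + n5 * 3 + n6 * 3) * s ^ (n4 * 3 + n5 * 3 + n6 * 6)"
  "kappa3 (n1, n2, n3, n4, n5, n6) = r ^ (n4 * 3 + n5 * 2 + n6 * 3) * s ^ (n5 + n6 * 3)"
  "kappa4 (n1, n2, n3, n4, n5, n6) = r ^ (n5 * 3 + n6 * 6) * s ^ (n6 * 3)"
  "kappa5 (n1, n2, n3, n4, n5, n6) = r ^ (n6 * 3)"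
  by (simp_all add: kappa_defs terms_defs zi_def power_add flip: power_mult)

definition kappa :: "idx \<Rightarrow> idx \<Rightarrow> complex" where
  "kappa = (\<lambda>(a1, a2, a3, a4, a5, a6) n.
     kappa1 n ^ a1 * kappa2 n ^ a2 * kappa3 n ^ a3 * kappa4 n ^ a4 * kappa5 n ^ a5)"

lemma kappa_nonzero: "kappa a n \<noteq> 0"
  using r0 s0 by (cases a rule: prod_cases6, cases n rule: prod_cases6) (simp add: kappa_def kappa_eq)

text \<open>The scalar picked up by \<open>X\<^sub>i\<close> depends only on the exponents of the
  factors to the left of \<open>X\<^sub>i\<close> in an ordered monomial, and these do not change
  while further copies of \<open>X\<^sub>i\<close> are multiplied on. This is what the second
  assumption expresses.\<close>

lemma tops_funpow:
  assumes "tops f (e1, e2, e3, e4, e5, e6) c"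
    and "\<And>m n. c ((m * e1, m * e2, m * e3, m * e4, m * e5, m * e6) + n) = c n"
  shows "tops (f ^^ m) (m * e1, m * e2, m * e3, m * e4, m * e5, m * e6) (\<lambda>n. c n ^ m)"
proof (induction m)
  case 0
  have "(f ^^ 0) = (\<lambda>v. v)" by (simp add: fun_eq_iff)
  then show ?case using tops_id by (simp add: zero_prod_def)
next
  case (Suc m)
  have "(f ^^ Suc m) = (\<lambda>v. f ((f ^^ m) v))" by (simp add: fun_eq_iff)
  then show ?case using tops_comp[OF assms(1) Suc] by (simp add: assms(2))
qed

lemma tops_delta_star: "tops (\<lambda>v. delta a \<star> v) a (kappa a)"
proof -
  obtain a1 a2 a3 a4 a5 a6 where a: "a = (a1, a2, a3, a4, a5, a6)" by (rule prod_cases6)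
  have c: "kappa1 ((m, 0, 0, 0, 0, 0) + n) = kappa1 n" "kappa2 ((m, m', 0, 0, 0, 0) + n) = kappa2 n"
    "kappa3 ((m, m', m'', 0, 0, 0) + n) = kappa3 n" "kappa4 ((m, m', m'', i, 0, 0) + n) = kappa4 n"
    "kappa5 ((m, m', m'', i, i', 0) + n) = kappa5 n" for m m' m'' i i' n
    by (cases n rule: prod_cases6; simp add: kappa_eq)+
  have t1: "tops (L1 ^^ a1) (a1, 0, 0, 0, 0, 0) (\<lambda>n. kappa1 n ^ a1)"
    using tops_funpow[OF tops_L(1), of a1] by (simp add: c)
  have t2: "tops (L2 ^^ a2) (0, a2, 0, 0, 0, 0) (\<lambda>n. kappa2 n ^ a2)"
    using tops_funpow[OF tops_L(2), of a2] by (simp add: c)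
  have t3: "tops (L3 ^^ a3) (0, 0, a3, 0, 0, 0) (\<lambda>n. kappa3 n ^ a3)"
    using tops_funpow[OF tops_L(3), of a3] by (simp add: c)
  have t4: "tops (L4 ^^ a4) (0, 0, 0, a4, 0, 0) (\<lambda>n. kappa4 n ^ a4)"
    using tops_funpow[OF tops_L(4), of a4] by (simp add: c)
  have t5: "tops (L5 ^^ a5) (0, 0, 0, 0, a5, 0) (\<lambda>n. kappa5 n ^ a5)"
    using tops_funpow[OF tops_L(5), of a5] by (simp add: c)
  have t6: "tops (L6 ^^ a6) (0, 0, 0, 0, 0, a6) (\<lambda>n. 1)"
    using tops_funpow[OF tops_L(6), of a6] by simp
  have "tops (\<lambda>v. delta a \<star> v) a (\<lambda>n. kappa a n)"
    using tops_comp[OF t6 tops_comp[OF t5 tops_comp[OF t4 tops_comp[OF t3 tops_comp[OF t2 t1]]]]]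
    by (simp add: a delta_star c kappa_def mult_ac flip: add.assoc)
  then show ?thesis .
qed

text \<open>In other words, the associated graded algebra for the filtration by leading exponents is
  a quantum affine space with structure constants \<open>kappa\<close>.\<close>

lemma star_top:
  assumes "bounded_by u m" "bounded_by v n"
  shows "bounded_by (u \<star> v) (m + n)"
    and "lookup (u \<star> v) (m + n) = lookup u m * lookup v n * kappa m n"
proof -
  have keys: "\<exists>a\<in>keys u. k \<le> a + n" if "k \<in> keys (u \<star> v)" for k u
  proof -
    have "u \<star> v = lext (\<lambda>a. delta a \<star> v) u"
      by (rule lin_lext_unique[OF lin_star_left])
    with that obtain a where "a \<in> keys u" "k \<in> keys (delta a \<star> v)"
      using keys_lext by metis
    moreover have "bounded_by (delta a \<star> v) (a + n)"
      using tops_delta_star[of a] assms(2) by (simp only: tops_def)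
    ultimately show ?thesis unfolding bounded_by_def by blast
  qed
  show "bounded_by (u \<star> v) (m + n)"
    unfolding bounded_by_def
  proof
    fix k assume "k \<in> keys (u \<star> v)"
    then obtain a where "a \<in> keys u" "k \<le> a + n" using keys by blast
    moreover from this have "a + n \<le> m + n"
      using assms(1)[unfolded bounded_by_def] by (intro idx_add_mono order_refl) (rule bspec)
    ultimately show "k \<le> m + n" by (intro order_trans[of k "a + n" "m + n"])
  qed
  obtain u' where u': "u = scale (lookup u m) (delta m) + u'" "\<And>k. k \<in> keys u' \<Longrightarrow> k < m"
    using split_top[OF assms(1)] by blast
  have "lookup (u' \<star> v) (m + n) = 0"
  proof (rule ccontr)
    assume "lookup (u' \<star> v) (m + n) \<noteq> 0"
    then have "m + n \<in> keys (u' \<star> v)" by (simp add: in_keys_iff)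
    then obtain a where "a \<in> keys u'" and le: "m + n \<le> a + n" using keys by blast
    then have "n + a < n + m" using u'(2) by (simp only: idx_add_less_iff)
    then show False using le by (simp add: add.commute leD)
  qed
  moreover have "lookup (delta m \<star> v) (m + n) = kappa m n * lookup v n"
    using tops_delta_star[of m] assms(2) by (simp only: tops_def)
  ultimately show "lookup (u \<star> v) (m + n) = lookup u m * lookup v n * kappa m n"
    by (subst u'(1)) (simp add: star_simps lookup_add)
qed

lemma hom_deg_L:
  "hom_deg d v \<Longrightarrow> hom_deg ((1, 0) + d) (L1 v)" "hom_deg d v \<Longrightarrow> hom_deg ((3, 1) + d) (L2 v)"
  "hom_deg d v \<Longrightarrow> hom_deg ((2, 1) + d) (L3 v)" "hom_deg d v \<Longrightarrow> hom_deg ((3, 2) + d) (L4 v)"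
  "hom_deg d v \<Longrightarrow> hom_deg ((1, 1) + d) (L5 v)" "hom_deg d v \<Longrightarrow> hom_deg ((0, 1) + d) (L6 v)"
proof -
  have *: "hom_deg (e + d) (term_op ts v)"
    if "valid ts" "\<forall>t\<in>set (map fst ts). degz t = e" "hom_deg d v" for ts e d v
    using hom_deg_term_op[OF that(1) _ that(3)] that(2) by simp
  note d = terms_defs list.map list.sel prod.sel ball_set_Cons
  show "hom_deg d v \<Longrightarrow> hom_deg ((1, 0) + d) (L1 v)"
    by (rule *[OF valid_terms(1)]) (unfold d, simp_all add: degz_def)
  show "hom_deg d v \<Longrightarrow> hom_deg ((3, 1) + d) (L2 v)"
    by (rule *[OF valid_terms(2)]) (unfold d, simp_all add: degz_def)
  show "hom_deg d v \<Longrightarrow> hom_deg ((2, 1) + d) (L3 v)"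
    by (rule *[OF valid_terms(3)]) (unfold d, simp_all add: degz_def)
  show "hom_deg d v \<Longrightarrow> hom_deg ((3, 2) + d) (L4 v)"
    by (rule *[OF valid_terms(4)]) (unfold d, simp_all add: degz_def)
  show "hom_deg d v \<Longrightarrow> hom_deg ((1, 1) + d) (L5 v)"
    by (rule *[OF valid_terms(5)]) (unfold d, simp_all add: degz_def)
  show "hom_deg d v \<Longrightarrow> hom_deg ((0, 1) + d) (L6 v)"
    by (rule *[OF valid_terms(6)]) (unfold d, simp_all add: degz_def)
qed

lemma hom_deg_delta_star: "hom_deg d v \<Longrightarrow> hom_deg (deg a + d) (delta a \<star> v)"
proof -
  assume v: "hom_deg d v"
  obtain a1 a2 a3 a4 a5 a6 where a: "a = (a1, a2, a3, a4, a5, a6)" by (rule prod_cases6)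
  note f = hom_deg_funpow
  show ?thesis
    using f[where n = a6, OF hom_deg_L(6) f[where n = a5, OF hom_deg_L(5)
      f[where n = a4, OF hom_deg_L(4) f[where n = a3, OF hom_deg_L(3)
      f[where n = a2, OF hom_deg_L(2) f[where n = a1, OF hom_deg_L(1) v]]]]]]
    by (cases d) (simp add: a delta_star deg_eq algebra_simps)
qed

lemma hom_deg_star:
  assumes "hom_deg d u" "hom_deg e v"
  shows "hom_deg (d + e) (u \<star> v)"
proof -
  have "u \<star> v = lext (\<lambda>a. delta a \<star> v) u"
    by (rule lin_lext_unique[OF lin_star_left])
  moreover have "hom_deg (d + e) (delta a \<star> v)" if "a \<in> keys u" for a
    using hom_deg_delta_star[OF assms(2), of a] assms(1) that by (simp add: hom_deg_def)
  ultimately show ?thesis by (simp add: hom_deg_lext)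
qed

end

subsection \<open>Two normal elements\<close>

text \<open>Explicit vectors as lists, with repeated keys allowed, so that an equation between
  computed products reduces to finitely many equations between scalars.\<close>

definition vec_of :: "(idx \<times> complex) list \<Rightarrow> vec" where
  "vec_of xs = (\<Sum>(k, c)\<leftarrow>xs. Poly_Mapping.single k c)"

lemma vec_of_simps:
  "Poly_Mapping.single k c = vec_of [(k, c)]" "vec_of xs + vec_of ys = vec_of (xs @ ys)"
  "scale d (vec_of xs) = vec_of (map (\<lambda>(k, c). (k, d * c)) xs)"
proof -
  show "scale d (vec_of xs) = vec_of (map (\<lambda>(k, c). (k, d * c)) xs)"
    by (induction xs) (auto simp: vec_of_def scale_distrib scale_single)
qed (simp_all add: vec_of_def)

lemma lookup_vec_of: "lookup (vec_of xs) k = (\<Sum>(j, c)\<leftarrow>xs. if j = k then c else 0)"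
  by (induction xs) (auto simp: vec_of_def lookup_add lookup_single when_def)

lemma lookup_vec_of_simps:
  "lookup (vec_of []) k = 0" "lookup (vec_of ((j, c) # xs)) k
      = (if j = k then c else 0) + lookup (vec_of xs) k"
  by (simp_all add: lookup_vec_of)

lemma vec_of_eqI:
  assumes "\<forall>k\<in>set (map fst (xs @ ys)). lookup (vec_of xs) k = lookup (vec_of ys) k"
  shows "vec_of xs = vec_of ys"
proof (rule poly_mapping_eqI)
  fix k
  show "lookup (vec_of xs) k = lookup (vec_of ys) k"
  proof (cases "k \<in> set (map fst (xs @ ys))")
    case False
    have "lookup (vec_of zs) k = 0" if "k \<notin> set (map fst zs)" for zs
      using that
    proof (induction zs)
      case (Cons z zs)
      then show ?case by (cases z) (auto simp: lookup_vec_of_simps)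
    qed (simp add: lookup_vec_of_simps)
    then show ?thesis using False by simp
  qed (use assms in blast)
qed

lemma term_op_single:
  "term_op ts (Poly_Mapping.single b c) = (\<Sum>(t, w)\<leftarrow>ts. Poly_Mapping.single (zn (zi b + t)) (c * w (zi b)))"
proof -
  have "term_op ts (Poly_Mapping.single b c) = scale c (term_op ts (delta b))"
    by (simp only: lin_scale[OF lin_term_op, symmetric] scale_delta)
  also have "\<dots> = (\<Sum>(t, w)\<leftarrow>ts. Poly_Mapping.single (zn (zi b + t)) (c * w (zi b)))"
    unfolding term_op_delta by (induction ts) (auto simp: scale_distrib scale_single)
  finally show ?thesis .
qed

context two_param
begin

text \<open>The degrees (4, 2) of \<open>z1\<close> and (6, 4) of \<open>z2\<close> are twice the
  two fundamental weights of G2, the weights in which the one-parameter algebra has its central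
  generators. Accordingly the commutation scalars found below are powers of
  \<open>r * s\<close>.\<close>

definition z1 :: vec where
  "z1 = delta (1, 0, 1, 0, 1, 0) + scale (1 / r^4) (delta (0, 0, 2, 0, 0, 0))
    + scale (- 1 / r^2) (delta (1, 0, 0, 1, 0, 0)) + scale (- 1 / r^2) (delta (0, 1, 0, 0, 1, 0))"

definition z2 :: vec where
  "z2 = delta (0, 1, 0, 1, 0, 1) + scale (1 / (r^9 * s^3)) (delta (0, 0, 0, 2, 0, 0))
    + scale (- (r^2 + r * s + s^2) / (r^6 * s^3)) (delta (0, 0, 1, 1, 1, 0))
    + scale ((r^2 + r * s + s^2) / (r^5 * s^2)) (delta (0, 0, 2, 0, 2, 0))
    + scale (- 1 / r^3) (delta (0, 1, 0, 0, 3, 0)) + scale (- 1 / r^3) (delta (0, 0, 3, 0, 0, 1))"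

lemma single_star: "Poly_Mapping.single (a1, a2, a3, a4, a5, a6) c \<star> v
   = scale c ((L6 ^^ a6) ((L5 ^^ a5) ((L4 ^^ a4) ((L3 ^^ a3) ((L2 ^^ a2) ((L1 ^^ a1) v))))))"
  unfolding delta_star[symmetric] lin_scale[OF lin_star_left, symmetric] scale_delta ..

lemmas compute_star = lin_add[OF lin_star_left] lin_add[OF lin_star_right] single_star
    lin_simps[OF lin_term_op] term_op_single terms_defs
  zi_def zn_def numeral_2_eq_2 numeral_3_eq_3

lemma z1_x1: "z1 \<star> x1 = scale (1 / (r * s)^3) (x1 \<star> z1)"
  apply (simp add: z1_def r0 s0 scale_delta scale_single scale_distrib compute_star)
  apply (simp only: vec_of_simps list.map append.simps prod.case)
  apply (rule vec_of_eqI)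
  apply (unfold append.simps list.map prod.sel ball_set_Cons)
  apply (intro conjI TrueI)
  apply (simp_all add: lookup_vec_of_simps)
  apply (simp_all add: divide_simps r0 s0)
  apply ((((rule disjI2)+)?, Groebner_Basis.algebra)+)
  done

lemma z1_x6: "z1 \<star> x6 = scale ((r * s)^6) (x6 \<star> z1)"
  apply (simp add: z1_def r0 s0 scale_delta scale_single scale_distrib compute_star)
  apply (simp only: vec_of_simps list.map append.simps prod.case)
  apply (rule vec_of_eqI)
  apply (unfold append.simps list.map prod.sel ball_set_Cons)
  apply (intro conjI TrueI)
  apply (simp_all add: lookup_vec_of_simps)
  apply (simp_all add: divide_simps r0 s0)
  apply ((((rule disjI2)+)?, Groebner_Basis.algebra)+)
  done

lemma z2_x1: "z2 \<star> x1 = scale (1 / (r * s)^6) (x1 \<star> z2)"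
  apply (simp add: z2_def r0 s0 scale_delta scale_single scale_distrib compute_star)
  apply (simp only: vec_of_simps list.map append.simps prod.case)
  apply (rule vec_of_eqI)
  apply (unfold append.simps list.map prod.sel ball_set_Cons)
  apply (intro conjI TrueI)
  apply (simp_all add: lookup_vec_of_simps)
  apply (simp_all add: divide_simps r0 s0)
  apply ((((rule disjI2)+)?, Groebner_Basis.algebra)+)
  done

lemma z2_x6: "z2 \<star> x6 = scale ((r * s)^9) (x6 \<star> z2)"
  apply (simp add: z2_def r0 s0 scale_delta scale_single scale_distrib compute_star)
  apply (simp only: vec_of_simps list.map append.simps prod.case)
  apply (rule vec_of_eqI)
  apply (unfold append.simps list.map prod.sel ball_set_Cons)
  apply (intro conjI TrueI)
  apply (simp_all add: lookup_vec_of_simps)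
  apply (simp_all add: divide_simps r0 s0)
  apply ((((rule disjI2)+)?, Groebner_Basis.algebra)+)
  done

section \<open>Characters of the grading group and normality\<close>

definition twist :: "int \<times> int \<Rightarrow> int \<times> int \<Rightarrow> complex" where
  "twist e d = (r * s) powi (fst e * fst d + snd e * snd d)"

lemma twist_add: "twist e (d + d') = twist e d * twist e d'"
  and twist_nonzero: "twist e d \<noteq> 0" and twist_0: "twist e 0 = 1"
  using r0 s0 by (simp_all add: twist_def power_int_add algebra_simps)

text \<open>As a power of \<open>r * s\<close>, the twist adds the same amount to both exponents.
  Genericity then separates one equation between scalars into two linear ones.\<close>

lemma power_eq_twist:
  assumes "r ^ a * s ^ b = twist e d * (r ^ a' * s ^ b')"
  shows "int a = fst e * fst d + snd e * snd d + int a'" "int b = fst e * fst d + snd e * snd d + int b'"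
proof -
  let ?t = "fst e * fst d + snd e * snd d"
  have "r powi int a * s powi int b = r powi (?t + int a') * s powi (?t + int b')"
    using assms r0 s0 by (simp add: twist_def power_int_mult_distrib power_int_add mult_ac)
  then have "r powi (int a - (?t + int a')) * s powi (int b - (?t + int b')) = 1"
    using r0 s0 by (simp add: power_int_diff)
  from generic[OF this]
  show "int a = ?t + int a'" "int b = ?t + int b'" by simp_all
qed

lemma twist_eq_1_iff: "twist e d = 1 \<longleftrightarrow> fst e * fst d + snd e * snd d = 0"
  using power_eq_twist[of 0 0 e d 0 0] by (auto simp: twist_def)

definition normal :: "int \<times> int \<Rightarrow> vec \<Rightarrow> bool" where
  "normal e z \<longleftrightarrow> (\<forall>d v. hom_deg d v \<longrightarrow> z \<star> v = scale (twist e d) (v \<star> z))"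

lemma hom_deg_x1: "hom_deg (1, 0) x1" and hom_deg_x6: "hom_deg (0, 1) x6"
  using hom_deg_delta[of "(1, 0, 0, 0, 0, 0)"] hom_deg_delta[of "(0, 0, 0, 0, 0, 1)"]
  by (simp_all add: deg_eq)

text \<open>The map \<open>sigma\<close> below is the grading automorphism given by the character.
  The identity \<open>z \<star> v = sigma v \<star> z\<close> is multiplicative in \<open>v\<close>,
  so it spreads from the two generators to the whole algebra.\<close>

lemma normalI:
  assumes 1: "z \<star> x1 = scale (twist e (1, 0)) (x1 \<star> z)"
    and 6: "z \<star> x6 = scale (twist e (0, 1)) (x6 \<star> z)"
  shows "normal e z"
proof -
  define sigma where "sigma = lext (\<lambda>k. scale (twist e (deg k)) (delta k))"
  have lin_sigma: "lin sigma" unfolding sigma_def by (rule lin_lext)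
  have hom: "sigma v = scale (twist e d) v" if "hom_deg d v" for d v
    by (rule lin_eqI[OF lin_sigma lin_scaled[OF lin_id]]) (use that in \<open>simp add: sigma_def hom_deg_def\<close>)
  have gen: "sigma (x \<star> v) = scale (twist e d) (x \<star> sigma v)" if "hom_deg d x" for x d v
  proof (rule lin_eqI[where f = "\<lambda>v. sigma (x \<star> v)"])
    show "lin (\<lambda>v. sigma (x \<star> v))" by (rule lin_comp[OF lin_sigma lin_star_right])
    show "lin (\<lambda>v. scale (twist e d) (x \<star> sigma v))"
      by (rule lin_scaled[OF lin_comp[OF lin_star_right lin_sigma]])
    show "sigma (x \<star> delta k) = scale (twist e d) (x \<star> sigma (delta k))" for k
      using hom[OF hom_deg_star[OF that hom_deg_delta]] hom[OF hom_deg_delta]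
      by (simp add: star_simps twist_add)
  qed
  have "z \<star> v = sigma v \<star> z" for v
  proof (induction v rule: generators_induct)
    case one
    have "hom_deg 0 \<^bold>1" using hom_deg_delta[of "(0, 0, 0, 0, 0, 0)"] by (simp add: deg_eq zero_prod_def)
    then show ?case by (simp add: hom twist_0 star_one one_star)
  next
    case (x1 v)
    then show ?case
      by (simp add: gen[OF hom_deg_x1] star_simps star_assoc[of _ "sigma v"] del: One_nat_def)
        (simp add: 1 star_simps star_assoc del: One_nat_def flip: star_assoc[of z])
  next
    case (x6 v)
    then show ?case
      by (simp add: gen[OF hom_deg_x6] star_simps star_assoc[of _ "sigma v"] del: One_nat_def)
        (simp add: 6 star_simps star_assoc del: One_nat_def flip: star_assoc[of z])
  qed (simp_all add: lin_simps[OF lin_sigma] star_simps)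
  then show ?thesis by (simp add: normal_def hom star_simps)
qed

lemma normal_z1: "normal (-3, 6) z1" and normal_z2: "normal (-6, 9) z2"
  by (rule normalI; simp add: z1_x1 z1_x6 z2_x1 z2_x6 twist_def power_int_minus divide_inverse del:
      One_nat_def)+

lemma hom_deg_z: "hom_deg (4, 2) z1" "hom_deg (6, 4) z2"
proof -
  have *: "hom_deg d (delta k)" if "deg k = d" for d k
    using that hom_deg_delta[of k] by simp
  show "hom_deg (4, 2) z1" "hom_deg (6, 4) z2"
    unfolding z1_def z2_def by (intro hom_deg_add hom_deg_scale *; simp add: deg_eq)+
qed

lemma top_z:
  "bounded_by z1 (1, 0, 1, 0, 1, 0)" "lookup z1 (1, 0, 1, 0, 1, 0) = 1"
  "bounded_by z2 (0, 1, 0, 1, 0, 1)" "lookup z2 (0, 1, 0, 1, 0, 1) = 1"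
proof -
  have add: "bounded_by (u + v) n" if "bounded_by u n" "bounded_by v n" for u v n
    using that keys_add[of u v] by (auto simp: bounded_by_def)
  have single: "bounded_by (scale c (delta k)) n" if "k \<le> n" for c k n
    using that by (simp add: bounded_by_def scale_delta)
  have delta: "bounded_by (delta k) n" if "k \<le> n" for k n
    using that by (simp add: bounded_by_def)
  show "bounded_by z1 (1, 0, 1, 0, 1, 0)" "bounded_by z2 (0, 1, 0, 1, 0, 1)"
    unfolding z1_def z2_def by (intro add single delta; simp)+
  show "lookup z1 (1, 0, 1, 0, 1, 0) = 1" "lookup z2 (0, 1, 0, 1, 0, 1) = 1"
    by (simp_all add: z1_def z2_def lookup_add lookup_single)
qed

end

subsection \<open>Derivations of the algebra of ordered monomials\<close>

context two_param
begin

section \<open>Absence of zero divisors\<close>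

lemma exists_top:
  assumes "v \<noteq> 0"
  shows "\<exists>n. bounded_by v n \<and> lookup v n \<noteq> 0"
proof -
  have ne: "keys v \<noteq> {}"
    using assms by (metis in_keys_iff lookup_zero poly_mapping_eqI empty_iff)
  show ?thesis
  proof (intro exI conjI)
    show "bounded_by v (Max (keys v))" by (simp add: bounded_by_def)
    show "lookup v (Max (keys v)) \<noteq> 0"
      using Max_in[OF finite_keys ne] unfolding in_keys_iff .
  qed
qed

lemma bounded_by_lookup: "bounded_by v n \<Longrightarrow> lookup v k \<noteq> 0 \<Longrightarrow> k \<le> n"
  by (simp add: bounded_by_def in_keys_iff)

lemma bounded_by_scale: "bounded_by v n \<Longrightarrow> bounded_by (scale c v) n"
  by (auto simp: bounded_by_def in_keys_iff)

lemma bounded_by_diff: "bounded_by u n \<Longrightarrow> bounded_by v n \<Longrightarrow> bounded_by (u - v) n"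
proof -
  assume *: "bounded_by u n" "bounded_by v n"
  have "k \<le> n" if "lookup (u - v) k \<noteq> 0" for k
  proof (cases "lookup u k = 0")
    case True
    then have "lookup v k \<noteq> 0" using that by (simp add: lookup_minus)
    then show ?thesis by (rule bounded_by_lookup[OF *(2)])
  qed (rule bounded_by_lookup[OF *(1)])
  then show ?thesis by (simp only: bounded_by_def in_keys_iff) blast
qed

lemma bounded_by_delta: "bounded_by (delta k) k"
  by (simp add: bounded_by_def)

lemma top_star:
  assumes "bounded_by u m" "lookup u m \<noteq> 0" "bounded_by v n" "lookup v n \<noteq> 0"
  shows "bounded_by (u \<star> v) (m + n)" "lookup (u \<star> v) (m + n) \<noteq> 0"
  using star_top[OF assms(1,3)] assms(2,4) kappa_nonzero by simp_all

lemma star_eq_0: "u \<star> v = 0 \<Longrightarrow> u = 0 \<or> v = 0"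
proof (rule ccontr)
  assume 0: "u \<star> v = 0" and "\<not> (u = 0 \<or> v = 0)"
  then obtain m n where "bounded_by u m" "lookup u m \<noteq> 0" "bounded_by v n" "lookup v n \<noteq> 0"
    using exists_top[of u] exists_top[of v] by blast
  from top_star(2)[OF this] show False by (simp add: 0)
qed

lemma component_star:
  assumes "hom_deg e v"
  shows "component (d + e) (u \<star> v) = component d u \<star> v" "component (e + d) (v \<star> u) = v \<star> component d u"
proof -
  show "component (d + e) (u \<star> v) = component d u \<star> v"
  proof (rule lin_eqI[where f = "\<lambda>u. component (d + e) (u \<star> v)"])
    show "lin (\<lambda>u. component (d + e) (u \<star> v))" by (rule lin_comp[OF lin_component lin_star_left])
    show "lin (\<lambda>u. component d u \<star> v)" by (rule lin_comp[OF lin_star_left lin_component])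
    show "component (d + e) (delta k \<star> v) = component d (delta k) \<star> v" for k
      using component_hom_deg[OF hom_deg_star[OF hom_deg_delta assms], of "d + e" k]
        component_hom_deg[OF hom_deg_delta, of d k] by (simp add: star_simps)
  qed
  show "component (e + d) (v \<star> u) = v \<star> component d u"
  proof (rule lin_eqI[where f = "\<lambda>u. component (e + d) (v \<star> u)"])
    show "lin (\<lambda>u. component (e + d) (v \<star> u))" by (rule lin_comp[OF lin_component lin_star_right])
    show "lin (\<lambda>u. v \<star> component d u)" by (rule lin_comp[OF lin_star_right lin_component])
    show "component (e + d) (v \<star> delta k) = v \<star> component d (delta k)" for k
      using component_hom_deg[OF hom_deg_star[OF assms hom_deg_delta], of "e + d" k]
        component_hom_deg[OF hom_deg_delta, of d k] by (simp add: star_simps)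
  qed
qed

section \<open>Derivations, inner derivations and degree derivations\<close>

definition derivation :: "(vec \<Rightarrow> vec) \<Rightarrow> bool" where
  "derivation d \<longleftrightarrow> lin d \<and> (\<forall>u v. d (u \<star> v) = d u \<star> v + u \<star> d v)"

definition inner :: "vec \<Rightarrow> vec \<Rightarrow> vec" where
  "inner g v = g \<star> v - v \<star> g"

definition euler :: "complex \<Rightarrow> complex \<Rightarrow> vec \<Rightarrow> vec" where
  "euler a b = lext (\<lambda>k. scale (a * of_int (fst (deg k)) + b * of_int (snd (deg k))) (delta k))"

lemma derivation_lin: "derivation d \<Longrightarrow> lin d"
  and derivation_star: "derivation d \<Longrightarrow> d (u \<star> v) = d u \<star> v + u \<star> d v"
  by (simp_all add: derivation_def)

lemma derivationI:
  assumes "lin d" "\<And>a b. d (delta a \<star> delta b) = d (delta a) \<star> delta b + delta a \<star> d (delta b)"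
  shows "derivation d"
  unfolding derivation_def
proof (intro conjI allI assms(1))
  fix u v
  have 1: "d (delta a \<star> v) = d (delta a) \<star> v + delta a \<star> d v" for a
    by (rule lin_eqI[where f = "\<lambda>v. d (delta a \<star> v)"])
      (rule lin_comp[OF assms(1) lin_star_right] assms(2)
        lin_plus[OF lin_star_right lin_comp[OF lin_star_right assms(1)]])+
  show "d (u \<star> v) = d u \<star> v + u \<star> d v"
    by (rule lin_eqI[where f = "\<lambda>u. d (u \<star> v)"])
      (rule lin_comp[OF assms(1) lin_star_left] 1
        lin_plus[OF lin_comp[OF lin_star_left assms(1)] lin_star_left])+
qed

lemma lin_inner: "lin (inner g)"
  unfolding inner_def[abs_def] by (rule lin_minus[OF lin_star_right lin_star_left])

lemma lin_inner_left: "lin (\<lambda>g. inner g v)"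
  unfolding inner_def by (rule lin_minus[OF lin_star_left lin_star_right])

lemma lin_euler: "lin (euler a b)"
  unfolding euler_def by (rule lin_lext)

lemma euler_hom_deg:
  "hom_deg d v \<Longrightarrow> euler a b v = scale (a * of_int (fst d) + b * of_int (snd d)) v"
  by (rule lin_eqI[OF lin_euler lin_scaled[OF lin_id]]) (simp add: euler_def hom_deg_def)

lemma derivation_euler: "derivation (euler a b)"
proof (rule derivationI[OF lin_euler])
  fix j k
  show "euler a b (delta j \<star> delta k) = euler a b (delta j) \<star> delta k + delta j \<star> euler a b (delta k)"
    using euler_hom_deg[OF hom_deg_star[OF hom_deg_delta hom_deg_delta], of a b j k]
      euler_hom_deg[OF hom_deg_delta]
    by (simp add: star_simps algebra_simps flip: scale_distrib)
qed

lemma derivation_add: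
  assumes "derivation d" "derivation d'"
  shows "derivation (\<lambda>v. d v + d' v)"
  using assms by (simp add: derivation_def lin_plus star_simps algebra_simps)

lemma derivation_zero: "derivation (\<lambda>v. 0)"
  by (simp add: derivation_def lin_def star_simps)

lemma derivation_sum: "finite A \<Longrightarrow> (\<And>i. i \<in> A \<Longrightarrow> derivation (d i)) \<Longrightarrow> derivation (\<lambda>v. \<Sum>i\<in>A. d i v)"
  by (induction A rule: finite_induct) (auto simp: derivation_zero intro: derivation_add)

lemma derivation_one:
  assumes "derivation d" shows "d \<^bold>1 = 0"
  using derivation_star[OF assms, of "\<^bold>1" "\<^bold>1"] by (simp add: one_star star_one)

lemma derivation_eqI:
  assumes "derivation d" "derivation d'" "d x1 = d' x1" "d x6 = d' x6"
  shows "d v = d' v"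
proof (induction v rule: generators_induct)
  case one
  show ?case by (simp only: derivation_one[OF assms(1)] derivation_one[OF assms(2)])
next
  case (x1 v)
  then show ?case by (simp only: derivation_star[OF assms(1)] derivation_star[OF assms(2)] assms(3))
next
  case (x6 v)
  then show ?case by (simp only: derivation_star[OF assms(1)] derivation_star[OF assms(2)] assms(4))
next
  case (add u v)
  then show ?case by (simp only: lin_add[OF derivation_lin[OF assms(1)]]
      lin_add[OF derivation_lin[OF assms(2)]])
next
  case (scale c v)
  then show ?case by (simp only: lin_scale[OF derivation_lin[OF assms(1)]]
      lin_scale[OF derivation_lin[OF assms(2)]])
qed

text \<open>
  \<open>v\<close> skew-commutes with everything modulo the normal element \<open>z\<close>. If \<open>z\<close> did not divide \<open>v\<close>, then
  some remainder of \<open>v\<close> would have a leading exponent \<open>m\<close> not divisible by that of \<open>z\<close>; multiplying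
  by generators \<open>X\<^sub>i\<close> not occurring in the leading monomial of \<open>z\<close> keeps it so, and \<open>m\<close> is then
  pinned down by comparing leading coefficients.
\<close>

lemma normal_divides:
  assumes z: "bounded_by z l" "lookup z l = 1" "hom_deg dz z" "normal e z"
    and v: "hom_deg (c + dz) v"
    and comm: "\<And>i. i \<in> G \<Longrightarrow> \<exists>w. v \<star> delta i - scale (twist e (deg i)) (delta i \<star> v) = w \<star> z"
    and G: "\<And>i m k. i \<in> G \<Longrightarrow> m + i = k + l \<Longrightarrow> \<exists>k'. m = k' + l"
    and lead: "\<And>m. deg m = c + dz \<Longrightarrow> (\<And>i. i \<in> G \<Longrightarrow> kappa m i = twist e (deg i) * kappa i m) \<Longrightarrow> False"
    and l: "deg l = dz"
  shows "\<exists>u. v = u \<star> z"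
proof (rule ccontr)
  assume "\<nexists>u. v = u \<star> z"
  then have ne: "v - u \<star> z \<noteq> 0" for u by auto
  \<comment> \<open>The exponents that can lead a remainder of \<open>v\<close> modulo
    \<open>z\<close>. The lexicographic order on \<open>idx\<close> is a well-order, so there is a
    least one. Taking \<open>u\<close> of degree \<open>c\<close> keeps the remainder homogeneous,
    as \<open>lead\<close> requires.\<close>
  define P where "P m \<longleftrightarrow> (\<exists>u. hom_deg c u \<and> bounded_by (v - u \<star> z) m \<and> lookup (v - u \<star> z) m \<noteq> 0)" for m
  obtain n where "bounded_by (v - 0 \<star> z) n" "lookup (v - 0 \<star> z) n \<noteq> 0"
    using exists_top[OF ne] by blast
  then have "P n" unfolding P_def using hom_deg_0 by blast
  define m where "m = (LEAST m. P m)"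
  have "P m" unfolding m_def by (rule LeastI[of P, OF \<open>P n\<close>])
  have least: "m \<le> n" if "P n" for n unfolding m_def using that by (rule Least_le)
  obtain u where u: "hom_deg c u" and top: "bounded_by (v - u \<star> z) m" "lookup (v - u \<star> z) m \<noteq> 0"
    using \<open>P m\<close> unfolding P_def by blast
  define v' where "v' = v - u \<star> z"
  note top = top[folded v'_def]
  have hom: "hom_deg (c + dz) v'"
    unfolding v'_def by (rule hom_deg_diff[OF v hom_deg_star[OF u z(3)]])
  have m: "deg m = c + dz" using hom top(2) by (simp add: hom_deg_def in_keys_iff)
  have nodvd: "m \<noteq> k + l" for k
  proof
    assume k: "m = k + l"
    define a where "a = lookup v' m / kappa k l"
    let ?u = "u + scale a (delta k)"
    have kz: "bounded_by (delta k \<star> z) m" "lookup (delta k \<star> z) m = kappa k l"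
      using star_top[OF bounded_by_delta[of k] z(1)] z(2) by (simp_all add: k)
    have eq: "v - ?u \<star> z = v' - scale a (delta k \<star> z)"
      by (simp add: v'_def star_simps)
    have b: "bounded_by (v - ?u \<star> z) m"
      unfolding eq by (intro bounded_by_diff bounded_by_scale top(1) kz(1))
    have "lookup (v - ?u \<star> z) m = 0"
      unfolding eq using kappa_nonzero by (simp add: lookup_minus kz(2) a_def)
    obtain n where n: "bounded_by (v - ?u \<star> z) n" "lookup (v - ?u \<star> z) n \<noteq> 0"
      using exists_top[OF ne] by blast
    have "deg k = c" using m l by (simp add: k deg_add)
    then have "hom_deg c ?u" using hom_deg_delta[of k] by (intro hom_deg_add u hom_deg_scale) simp
    with n have "P n" unfolding P_def by blast
    then have "m \<le> n" by (rule least)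
    moreover have "n \<le> m" using b n(2) by (rule bounded_by_lookup)
    ultimately show False using n(2) \<open>lookup (v - ?u \<star> z) m = 0\<close> by simp
  qed
  have "kappa m i = twist e (deg i) * kappa i m" if i: "i \<in> G" for i
  proof (rule ccontr)
    assume neq: "kappa m i \<noteq> twist e (deg i) * kappa i m"
    let ?t = "twist e (deg i)"
    obtain w where w: "v \<star> delta i - scale ?t (delta i \<star> v) = w \<star> z" using comm[OF i] by blast
    have zi: "z \<star> delta i = scale ?t (delta i \<star> z)"
      using z(4) hom_deg_delta by (simp only: normal_def)
    \<comment> \<open>Since \<open>z\<close> is normal, subtracting \<open>u \<star> z\<close> from
      \<open>v\<close> changes the skew commutator with \<open>delta i\<close> only by a multiple of
      \<open>z\<close>.\<close>
    define w' where "w' = w - scale ?t (u \<star> delta i - delta i \<star> u)"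
    have eq: "v' \<star> delta i - scale ?t (delta i \<star> v') = w' \<star> z"
    proof -
      have "v' \<star> delta i - scale ?t (delta i \<star> v')
          = (v \<star> delta i - scale ?t (delta i \<star> v)) - (u \<star> (z \<star> delta i) - scale ?t (delta i \<star> (u \<star> z)))"
        by (simp add: v'_def star_simps star_assoc scale_distrib)
      also have "\<dots> = w' \<star> z"
        unfolding w zi w'_def by (simp add: star_simps star_assoc scale_distrib)
      finally show ?thesis .
    qed
    have b1: "bounded_by (v' \<star> delta i) (m + i)" "lookup (v' \<star> delta i) (m + i) = lookup v' m * kappa m i"
      using star_top[OF top(1) bounded_by_delta[of i]] by simp_all
    have b2: "bounded_by (delta i \<star> v') (m + i)" "lookup (delta i \<star> v') (m + i) = lookup v' m * kappa i m"
      using star_top[OF bounded_by_delta[of i] top(1)] by (simp_all add: add.commute[of i m])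
    have b: "bounded_by (w' \<star> z) (m + i)"
      unfolding eq[symmetric] by (intro bounded_by_diff bounded_by_scale b1(1) b2(1))
    have "lookup (w' \<star> z) (m + i) = lookup v' m * (kappa m i - ?t * kappa i m)"
      unfolding eq[symmetric] lookup_minus lookup_scale b1(2) b2(2) by (simp add: algebra_simps)
    then have nz: "lookup (w' \<star> z) (m + i) \<noteq> 0" using neq top(2) by simp
    then have "w' \<noteq> 0" by (auto simp: star_simps)
    then obtain k where k: "bounded_by w' k" "lookup w' k \<noteq> 0" using exists_top by blast
    have kl: "bounded_by (w' \<star> z) (k + l)" "lookup (w' \<star> z) (k + l) \<noteq> 0"
      using top_star[OF k z(1)] z(2) by simp_all
    have "m + i = k + l"
      using bounded_by_lookup[OF kl(1) nz] bounded_by_lookup[OF b kl(2)] by (rule order_antisym)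
    then show False using G[OF i] nodvd by blast
  qed
  then show False using lead[OF m] by blast
qed

lemma normal_kills_degree:
  assumes d: "derivation d" and hom: "\<And>e v. hom_deg e v \<Longrightarrow> hom_deg (c + e) (d v)"
    and c: "twist e c \<noteq> 1"
    and z: "bounded_by z l" "lookup z l = 1" "hom_deg dz z" "normal e z"
    and G: "\<And>i m k. i \<in> G \<Longrightarrow> m + i = k + l \<Longrightarrow> \<exists>k'. m = k' + l"
    and lead: "\<And>m. deg m = c + dz \<Longrightarrow> (\<And>i. i \<in> G \<Longrightarrow> kappa m i = twist e (deg i) * kappa i m) \<Longrightarrow> False"
    and l: "deg l = dz"
  shows "\<exists>g. \<forall>v. d v = inner g v"
proof -
  have main: "d z \<star> delta i - scale (twist e (deg i)) (delta i \<star> d z)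
      = scale (twist e (deg i) * (1 - twist e c)) (d (delta i) \<star> z)" for i
  proof -
    let ?t = "twist e (deg i)"
    have 1: "z \<star> delta i = scale ?t (delta i \<star> z)"
      using z(4) hom_deg_delta by (simp only: normal_def)
    \<comment> \<open>The image of \<open>delta i\<close> has degree \<open>c + deg i\<close>, which
      produces the additional factor \<open>twist e c\<close>.\<close>
    have 2: "z \<star> d (delta i) = scale (twist e c * ?t) (d (delta i) \<star> z)"
      using z(4)[unfolded normal_def, rule_format, OF hom[OF hom_deg_delta]] by (simp only: twist_add)
    have "d z \<star> delta i + z \<star> d (delta i) = scale ?t (d (delta i) \<star> z + delta i \<star> d z)"
      using arg_cong[OF 1, of d] by (simp only: derivation_star[OF d] lin_scale[OF derivation_lin[OF d]])
    then show ?thesis unfolding 2 by (simp add: scale_distrib algebra_simps)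
  qed
  have "\<exists>u. d z = u \<star> z"
  proof (rule normal_divides[OF z hom[OF z(3)] _ G lead l])
    fix i
    show "\<exists>w. d z \<star> delta i - scale (twist e (deg i)) (delta i \<star> d z) = w \<star> z"
      unfolding main
      by (rule exI[of _ "scale (twist e (deg i) * (1 - twist e c)) (d (delta i))"]) (simp add: star_simps)
  qed
  then obtain u where u: "d z = u \<star> z" ..
  have "d v = inner (scale (1 / (1 - twist e c)) u) v" for v
  proof (rule lin_eqI[OF derivation_lin[OF d] lin_inner])
    fix i
    let ?t = "twist e (deg i)"
    have zi: "z \<star> delta i = scale ?t (delta i \<star> z)"
      using z(4) hom_deg_delta by (simp only: normal_def)
    have "scale ?t (inner u (delta i) \<star> z) = u \<star> (z \<star> delta i) - scale ?t (delta i \<star> (u \<star> z))"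
      unfolding zi by (simp add: inner_def star_simps star_assoc scale_distrib)
    also have "\<dots> = scale (?t * (1 - twist e c)) (d (delta i) \<star> z)"
      using main[of i] by (simp only: u star_assoc)
    also have "\<dots> = scale ?t (scale (1 - twist e c) (d (delta i)) \<star> z)"
      by (simp add: star_simps)
    finally have "inner u (delta i) \<star> z = scale (1 - twist e c) (d (delta i)) \<star> z"
      by (simp only: scale_eq_iff[OF twist_nonzero])
    \<comment> \<open>There are no zero divisors, so \<open>z\<close> can be cancelled.\<close>
    then have "(inner u (delta i) - scale (1 - twist e c) (d (delta i))) \<star> z = 0"
      by (simp only: lin_diff[OF lin_star_left] diff_self)
    moreover have "z \<noteq> 0" using z(2) by auto
    ultimately have "inner u (delta i) = scale (1 - twist e c) (d (delta i))"
      using star_eq_0 by fastforce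
    then show "d (delta i) = inner (scale (1 / (1 - twist e c)) u) (delta i)"
      using c by (simp add: lin_scale[OF lin_inner_left])
  qed
  then show ?thesis by blast
qed

section \<open>Degrees determined by commutation factors\<close>

lemma power_eq_twist_iff:
  "r ^ a * s ^ b = twist e d * (r ^ a' * s ^ b') \<longleftrightarrow>
   int a = fst e * fst d + snd e * snd d + int a' \<and> int b = fst e * fst d + snd e * snd d + int b'"
proof
  assume *: "int a = fst e * fst d + snd e * snd d + int a' \<and> int b = fst e * fst d + snd e * snd d + int b'"
  have "r powi int a * s powi int b = twist e d * (r powi int a' * s powi int b')"
    unfolding conjunct1[OF *] conjunct2[OF *] using r0 s0
    by (simp add: twist_def power_int_mult_distrib power_int_add mult_ac)
  then show "r ^ a * s ^ b = twist e d * (r ^ a' * s ^ b')" by simp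
qed (use power_eq_twist in blast)

text \<open>The three \<open>i\<close> are the generators absent from the leading monomial of
  \<open>z1\<close>. Comparing exponents of \<open>r\<close> and of \<open>s\<close> turns the
  assumptions into six linear equations for the entries of \<open>m\<close>. The leading exponent of
  \<open>z1\<close> is one solution, and every solution has the same degree.\<close>

lemma lead_z1:
  assumes "\<And>i. i \<in> {(0, 1, 0, 0, 0, 0), (0, 0, 0, 1, 0, 0), (0, 0, 0, 0, 0, 1)}
    \<Longrightarrow> kappa m i = twist (-3, 6) (deg i) * kappa i m"
  shows "deg m = (4, 2)"
proof -
  obtain m1 m2 m3 m4 m5 m6 where m: "m = (m1, m2, m3, m4, m5, m6)" by (rule prod_cases6)
  have "r ^ (3 * m1) * s ^ 0 = twist (-3, 6) (3, 1)
      * (r ^ (m3 * 3 + m4 * 6 + m5 * 3 + m6 * 3) * s ^ (m4 * 3 + m5 * 3 + m6 * 6))"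
    using assms[of "(0, 1, 0, 0, 0, 0)"] by (simp add: m kappa_def kappa_eq deg_eq flip: power_mult)
  note 2 = this[unfolded power_eq_twist_iff fst_conv snd_conv]
  have "r ^ (3 * m1 + 6 * m2 + 3 * m3) * s ^ (3 * m1 + 3 * m2) = twist (-3, 6) (3, 2)
      * (r ^ (m5 * 3 + m6 * 6) * s ^ (m6 * 3))"
    using assms[of "(0, 0, 0, 1, 0, 0)"]
    by (simp add: m kappa_def kappa_eq deg_eq power_add power_mult_distrib mult_ac flip: power_mult)
  note 4 = this[unfolded power_eq_twist_iff fst_conv snd_conv]
  have "r ^ (3 * m2 + 3 * m3 + 6 * m4 + 3 * m5) * s ^ (3 * m1 + 6 * m2 + 3 * m3 + 3 * m4)
      = twist (-3, 6) (0, 1) * (r ^ 0 * s ^ 0)"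
    using assms[of "(0, 0, 0, 0, 0, 1)"]
    by (simp add: m kappa_def kappa_eq deg_eq power_add power_mult_distrib mult_ac flip: power_mult)
  note 6 = this[unfolded power_eq_twist_iff fst_conv snd_conv]
  show ?thesis using 2 4 6 unfolding m deg_eq prod.inject by (simp; linarith)
qed

lemma lead_z2:
  assumes "\<And>i. i \<in> {(1, 0, 0, 0, 0, 0), (0, 0, 1, 0, 0, 0), (0, 0, 0, 0, 1, 0)}
    \<Longrightarrow> kappa m i = twist (-6, 9) (deg i) * kappa i m"
  shows "deg m = (6, 4)"
proof -
  obtain m1 m2 m3 m4 m5 m6 where m: "m = (m1, m2, m3, m4, m5, m6)" by (rule prod_cases6)
  have "r ^ 0 * s ^ 0 = twist (-6, 9) (1, 0)
      * (r ^ (m2 * 3 + m3 * 2 + m4 * 3 + m5) * s ^ (m3 + m4 * 3 + m5 * 2 + m6 * 3))"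
    using assms[of "(1, 0, 0, 0, 0, 0)"] by (simp add: m kappa_def kappa_eq deg_eq flip: power_mult)
  note 1 = this[unfolded power_eq_twist_iff fst_conv snd_conv]
  have "r ^ (2 * m1 + 3 * m2) * s ^ m1 = (r^2 * s) ^ m1 * (r^3) ^ m2"
    by (simp only: power_add power_mult[of r] power_mult_distrib) (simp only: mult_ac)
  also have "\<dots> = twist (-6, 9) (2, 1) * (r ^ (m4 * 3 + m5 * 2 + m6 * 3) * s ^ (m5 + m6 * 3))"
    using assms[of "(0, 0, 1, 0, 0, 0)"]
    by (simp add: m kappa_def kappa_eq deg_eq power2_eq_square)
  finally have "r ^ (2 * m1 + 3 * m2) * s ^ m1 = twist (-6, 9) (2, 1)
      * (r ^ (m4 * 3 + m5 * 2 + m6 * 3) * s ^ (m5 + m6 * 3))" .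
  note 3 = this[unfolded power_eq_twist_iff fst_conv snd_conv]
  have "r ^ (m1 + 3 * m2 + 2 * m3 + 3 * m4) * s ^ (2 * m1 + 3 * m2 + m3)
      = (r * s^2) ^ m1 * (r^3 * s^3) ^ m2 * (r^2 * s) ^ m3 * (r^3) ^ m4"
    by (simp only: power_add power_mult[of r] power_mult[of s] power_mult_distrib) (simp only: mult_ac)
  also have "\<dots> = twist (-6, 9) (1, 1) * (r ^ (m6 * 3) * s ^ 0)"
    using assms[of "(0, 0, 0, 0, 1, 0)"]
    by (simp add: m kappa_def kappa_eq deg_eq power2_eq_square)
  finally have "r ^ (m1 + 3 * m2 + 2 * m3 + 3 * m4) * s ^ (2 * m1 + 3 * m2 + m3)
      = twist (-6, 9) (1, 1) * (r ^ (m6 * 3) * s ^ 0)" .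
  note 5 = this[unfolded power_eq_twist_iff fst_conv snd_conv]
  show ?thesis using 1 3 5 unfolding m deg_eq prod.inject by (simp; linarith)
qed

text \<open>The vectors (-3, 6) and (-6, 9) are linearly independent and \<open>r * s\<close> is not
  a root of unity, so at least one of the two characters differs from 1 at \<open>c\<close>.\<close>

lemma homogeneous_derivation_inner:
  assumes d: "derivation d" and hom: "\<And>e v. hom_deg e v \<Longrightarrow> hom_deg (c + e) (d v)" and c: "c \<noteq> (0, 0)"
  shows "\<exists>g. \<forall>v. d v = inner g v"
proof (cases "twist (-3, 6) c = 1")
  case False
  show ?thesis
  proof (rule normal_kills_degree[OF d hom False top_z(1,2) hom_deg_z(1) normal_z1,
        where G = "{(0, 1, 0, 0, 0, 0), (0, 0, 0, 1, 0, 0), (0, 0, 0, 0, 0, 1)}"])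
    show "\<exists>k'. m = k' + (1, 0, 1, 0, 1, 0)"
      if "i \<in> {(0, 1, 0, 0, 0, 0), (0, 0, 0, 1, 0, 0), (0, 0, 0, 0, 0, 1)}"
        "m + i = k + (1, 0, 1, 0, 1, 0)" for i m k :: idx
    proof -
      obtain m1 m2 m3 m4 m5 m6 where m: "m = (m1, m2, m3, m4, m5, m6)" by (rule prod_cases6)
      obtain k1 k2 k3 k4 k5 k6 where k: "k = (k1, k2, k3, k4, k5, k6)" by (rule prod_cases6)
      \<comment> \<open>The truncated subtractions are exact: \<open>i\<close> vanishes wherever the
        leading exponent of \<open>z1\<close> is 1, so \<open>m\<close> is at least 1 there.\<close>
      have "m = (m1 - 1, m2, m3 - 1, m4, m5 - 1, m6) + (1, 0, 1, 0, 1, 0)"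
        using that by (auto simp: m k)
      then show ?thesis ..
    qed
  next
    fix m assume "deg m = c + (4, 2)"
      and "\<And>i. i \<in> {(0, 1, 0, 0, 0, 0), (0, 0, 0, 1, 0, 0), (0, 0, 0, 0, 0, 1)}
        \<Longrightarrow> kappa m i = twist (-3, 6) (deg i) * kappa i m"
    then show False using lead_z1[of m] c by (cases c) simp
  qed (simp_all add: deg_eq)
next
  case True
  have ne: "twist (-6, 9) c \<noteq> 1"
    using True c by (cases c) (simp add: twist_eq_1_iff)
  show ?thesis
  proof (rule normal_kills_degree[OF d hom ne top_z(3,4) hom_deg_z(2) normal_z2,
        where G = "{(1, 0, 0, 0, 0, 0), (0, 0, 1, 0, 0, 0), (0, 0, 0, 0, 1, 0)}"])
    show "\<exists>k'. m = k' + (0, 1, 0, 1, 0, 1)"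
      if "i \<in> {(1, 0, 0, 0, 0, 0), (0, 0, 1, 0, 0, 0), (0, 0, 0, 0, 1, 0)}"
        "m + i = k + (0, 1, 0, 1, 0, 1)" for i m k :: idx
    proof -
      obtain m1 m2 m3 m4 m5 m6 where m: "m = (m1, m2, m3, m4, m5, m6)" by (rule prod_cases6)
      obtain k1 k2 k3 k4 k5 k6 where k: "k = (k1, k2, k3, k4, k5, k6)" by (rule prod_cases6)
      have "m = (m1, m2 - 1, m3, m4 - 1, m5, m6 - 1) + (0, 1, 0, 1, 0, 1)"
        using that by (auto simp: m k)
      then show ?thesis ..
    qed
  next
    fix m assume "deg m = c + (6, 4)"
      and "\<And>i. i \<in> {(1, 0, 0, 0, 0, 0), (0, 0, 1, 0, 0, 0), (0, 0, 0, 0, 1, 0)}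
        \<Longrightarrow> kappa m i = twist (-6, 9) (deg i) * kappa i m"
    then show False using lead_z2[of m] c by (cases c) simp
  qed (simp_all add: deg_eq)
qed

section \<open>Homogeneous components of a derivation\<close>

definition component_map :: "int \<times> int \<Rightarrow> (vec \<Rightarrow> vec) \<Rightarrow> vec \<Rightarrow> vec" where
  "component_map c d = lext (\<lambda>k. component (c + deg k) (d (delta k)))"

lemma component_map_hom_deg:
  assumes "lin d" "hom_deg e v"
  shows "component_map c d v = component (c + e) (d v)"
  unfolding component_map_def
  by (rule lin_eqI[OF lin_lext lin_comp[OF lin_component assms(1)]])
    (use assms(2) in \<open>simp add: hom_deg_def\<close>)

lemma hom_deg_component_map:
  assumes "lin d" "hom_deg e v"
  shows "hom_deg (c + e) (component_map c d v)"
  unfolding component_map_hom_deg[OF assms] by (rule hom_deg_component)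

lemma derivation_component_map:
  assumes d: "derivation d"
  shows "derivation (component_map c d)"
proof (rule derivationI)
  show "lin (component_map c d)" unfolding component_map_def by (rule lin_lext)
  fix j k
  note eq = component_map_hom_deg[OF derivation_lin[OF d]]
  have "component_map c d (delta j \<star> delta k) = component (c + deg j + deg k) (d (delta j) \<star> delta k)
      + component (deg j + (c + deg k)) (delta j \<star> d (delta k))"
    by (simp add: eq[OF hom_deg_star[OF hom_deg_delta hom_deg_delta]] derivation_star[OF d]
        lin_add[OF lin_component] add_ac)
  also have "\<dots> = component_map c d (delta j) \<star> delta k + delta j \<star> component_map c d (delta k)"
    by (simp only: component_star[OF hom_deg_delta] eq[OF hom_deg_delta])
  finally show "component_map c d (delta j \<star> delta k)
      = component_map c d (delta j) \<star> delta k + delta j \<star> component_map c d (delta k)" .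
qed

lemma deg_eq_generator:
  "deg k = (1, 0) \<Longrightarrow> k = (1, 0, 0, 0, 0, 0)" "deg k = (0, 1) \<Longrightarrow> k = (0, 0, 0, 0, 0, 1)"
  "deg k = (0, 0) \<Longrightarrow> k = (0, 0, 0, 0, 0, 0)"
  by (cases k rule: prod_cases6; simp add: deg_eq; linarith)+

lemma hom_deg_single:
  assumes "hom_deg (deg k) v" "\<And>j. deg j = deg k \<Longrightarrow> j = k"
  shows "v = scale (lookup v k) (delta k)"
proof (rule poly_mapping_eqI)
  fix j
  show "lookup v j = lookup (scale (lookup v k) (delta k)) j"
  proof (cases "j = k")
    case False
    then have "deg j \<noteq> deg k" using assms(2) by blast
    then have "j \<notin> keys v" using assms(1) unfolding hom_deg_def by blast
    then show ?thesis using False by (simp add: in_keys_iff lookup_single_not_eq)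
  qed simp
qed

text \<open>A linear map could have infinitely many homogeneous components. A derivation is
  determined by its values on the two generators, and these have finite support, so finitely many
  components already add up to it.\<close>

theorem derivation_decomposition:
  assumes d: "derivation d"
  shows "\<exists>g a b. \<forall>v. d v = inner g v + euler a b v"
proof -
  \<comment> \<open>The degrees by which \<open>d\<close> moves a generator. The degree (0, 0) is
    inserted so that its component can always be split off.\<close>
  define A where "A = insert (0, 0) ((\<lambda>k. deg k - (1, 0)) ` keys (d x1) \<union> (\<lambda>k. deg k - (0, 1)) ` keys (d x6))"
  have fin: "finite A" by (simp add: A_def)
  let ?d = "\<lambda>c. component_map c d"
  note eq = component_map_hom_deg[OF derivation_lin[OF d]]
  have der: "derivation (?d c)" for c by (rule derivation_component_map[OF d])
  have shift: "(\<Sum>c\<in>A. component (c + e) v) = v" if "(\<lambda>k. deg k - e) ` keys v \<subseteq> A" for e v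
  proof -
    have "deg ` keys v \<subseteq> (\<lambda>c. c + e) ` A"
    proof (rule image_subsetI)
      fix k assume "k \<in> keys v"
      then have "deg k - e \<in> A" using that by blast
      then show "deg k \<in> (\<lambda>c. c + e) ` A" by (rule rev_image_eqI) simp
    qed
    then have "v = (\<Sum>c\<in>(\<lambda>c. c + e) ` A. component c v)"
      using fin by (intro sum_components[symmetric]) auto
    also have "\<dots> = (\<Sum>c\<in>A. component (c + e) v)"
      by (subst sum.reindex) (auto simp: inj_on_def)
    finally show ?thesis ..
  qed
  have sum: "d v = (\<Sum>c\<in>A. ?d c v)" for v
  proof (rule derivation_eqI[OF d derivation_sum[OF fin der]])
    show "d x1 = (\<Sum>c\<in>A. ?d c x1)"
      unfolding eq[OF hom_deg_x1] by (rule shift[symmetric]) (auto simp: A_def)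
    show "d x6 = (\<Sum>c\<in>A. ?d c x6)"
      unfolding eq[OF hom_deg_x6] by (rule shift[symmetric]) (auto simp: A_def)
  qed
  have "\<exists>g. \<forall>v. ?d c v = inner g v" if "c \<noteq> (0, 0)" for c
    by (rule homogeneous_derivation_inner[OF der hom_deg_component_map[OF derivation_lin[OF d]] that])
  then obtain g where g: "?d c v = inner (g c) v" if "c \<noteq> (0, 0)" for c v by metis
  define h where "h = (\<Sum>c\<in>A - {(0, 0)}. g c)"
  have inner: "(\<Sum>c\<in>A - {(0, 0)}. ?d c v) = inner h v" for v
    unfolding h_def lin_sum[OF lin_inner_left] using g by (intro sum.cong) auto
  \<comment> \<open>The degrees (1, 0) and (0, 1) contain a single monomial each, so the component
    of degree zero multiplies the generators by these scalars.\<close>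
  define a where "a = lookup (d x1) (1, 0, 0, 0, 0, 0)"
  define b where "b = lookup (d x6) (0, 0, 0, 0, 0, 1)"
  have 0: "?d (0, 0) v = euler a b v" for v
  proof (rule derivation_eqI[OF der derivation_euler])
    have "?d (0, 0) x1 = scale a x1"
      unfolding eq[OF hom_deg_x1]
      by (subst hom_deg_single[of "(1, 0, 0, 0, 0, 0)"])
        (simp_all add: hom_deg_component deg_eq lookup_component a_def deg_eq_generator[simplified])
    then show "?d (0, 0) x1 = euler a b x1" by (simp add: euler_hom_deg[OF hom_deg_x1] del: One_nat_def)
    have "?d (0, 0) x6 = scale b x6"
      unfolding eq[OF hom_deg_x6]
      by (subst hom_deg_single[of "(0, 0, 0, 0, 0, 1)"])
        (simp_all add: hom_deg_component deg_eq lookup_component b_def deg_eq_generator[simplified])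
    then show "?d (0, 0) x6 = euler a b x6" by (simp add: euler_hom_deg[OF hom_deg_x6] del: One_nat_def)
  qed
  have "d v = inner h v + euler a b v" for v
  proof -
    have "(0, 0) \<in> A" by (simp add: A_def)
    then show ?thesis
      unfolding sum[of v] sum.remove[OF fin \<open>(0, 0) \<in> A\<close>] by (simp only: 0 inner add.commute)
  qed
  then show ?thesis by blast
qed

text \<open>The part of degree zero consists of scalars, so the degree-preserving part of
  \<open>inner g\<close> is the commutator with a scalar and vanishes. Since \<open>euler\<close>
  preserves degrees, nothing can cancel it.\<close>

theorem euler_not_inner:
  assumes "\<And>v. inner g v + euler a b v = 0"
  shows "a = 0" "b = 0"
proof -
  obtain c where c: "component (0, 0) g = scale c \<^bold>1"
    using hom_deg_single[of "(0, 0, 0, 0, 0, 0)" "component (0, 0) g"] hom_deg_component[of "(0, 0)" g]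
      deg_eq_generator(3) by (auto simp: deg_eq)
  have *: "component e (inner g v) = 0" if "hom_deg e v" for e v
  proof -
    have "component ((0, 0) + e) (g \<star> v) = scale c v" "component (e + (0, 0)) (v \<star> g) = scale c v"
      unfolding component_star[OF that] c by (simp_all add: star_simps one_star star_one)
    then show ?thesis by (cases e) (simp add: inner_def lin_diff[OF lin_component])
  qed
  have **: "scale (a * of_int (fst e) + b * of_int (snd e)) v = 0" if "hom_deg e v" for e v
  proof -
    have "component e (inner g v + euler a b v) = 0"
      using assms by (simp add: lin_zero[OF lin_component])
    then show ?thesis
      using *[OF that] component_hom_deg[OF hom_deg_scale[OF that]]
      by (simp add: lin_add[OF lin_component] euler_hom_deg[OF that])
  qed
  show "a = 0" using arg_cong[OF **[OF hom_deg_x1], of "\<lambda>v. lookup v (1, 0, 0, 0, 0, 0)"] by simp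
  show "b = 0" using arg_cong[OF **[OF hom_deg_x6], of "\<lambda>v. lookup v (0, 0, 0, 0, 0, 1)"] by simp
qed

end

subsection \<open>Transport to the quotient algebra\<close>

context two_param
begin

definition cl :: "free2 \<Rightarrow> free2 set" where
  "cl x = J +>\<^bsub>free_algebra\<^esub> x"

lemma cl_eq_iff: "cl x = cl y \<longleftrightarrow> x - y \<in> J"
proof -
  interpret ideal J "free_algebra :: (complex, free2) module" by (rule ideal_J)
  have mem: "x \<in> cl y \<longleftrightarrow> x - y \<in> J" for x y
  proof
    assume "x - y \<in> J"
    then have "x - y + y \<in> cl y" unfolding cl_def a_r_coset_def' by fastforce
    then show "x \<in> cl y" by simp
  qed (auto simp: cl_def a_r_coset_def')
  show ?thesis
  proof
    assume "cl x = cl y"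
    moreover have "x \<in> cl x" by (simp add: mem J_0)
    ultimately show "x - y \<in> J" by (simp add: mem)
  next
    assume xy: "x - y \<in> J"
    show "cl x = cl y"
    proof (intro equalityI subsetI)
      show "z \<in> cl y" if "z \<in> cl x" for z
        using J_add[OF that[unfolded mem] xy] by (simp add: mem)
      show "z \<in> cl x" if "z \<in> cl y" for z
        using J_diff[OF that[unfolded mem] xy] by (simp add: mem algebra_simps)
    qed
  qed
qed

lemma U_carrier: "carrier (U r s) = range cl"
  and U_mult: "cl x \<otimes>\<^bsub>U r s\<^esub> cl y = cl (x * y)"
  and U_add: "cl x \<oplus>\<^bsub>U r s\<^esub> cl y = cl (x + y)"
  and U_smult: "c \<odot>\<^bsub>U r s\<^esub> cl x = cl (scale c x)"
  and U_zero: "\<zero>\<^bsub>U r s\<^esub> = cl 0"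
  and U_one: "\<one>\<^bsub>U r s\<^esub> = cl 1"
proof -
  interpret ideal J "free_algebra :: (complex, free2) module" by (rule ideal_J)
  note defs = U_def quotient_algebra_def ring.defs module.defs serre_ideal_def[symmetric] FactRing_def
  show "carrier (U r s) = range cl"
    by (auto simp: defs A_RCOSETS_def' cl_def)
  show "cl x \<otimes>\<^bsub>U r s\<^esub> cl y = cl (x * y)"
    using rcoset_mult_add[of x y] by (simp add: defs cl_def)
  show "cl x \<oplus>\<^bsub>U r s\<^esub> cl y = cl (x + y)"
    using a_rcos_sum[of x y] by (simp add: defs cl_def)
  show "\<zero>\<^bsub>U r s\<^esub> = cl 0"
    using a_coset_add_zero[of J] by (simp add: defs cl_def)
  show "\<one>\<^bsub>U r s\<^esub> = cl 1"
    by (simp add: defs cl_def)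
  \<comment> \<open>Scalar multiplication in the quotient is a union over representatives, each of
    which yields the same coset.\<close>
  have "cl (scale c y) = cl (scale c x)" if "y \<in> cl x" for y
  proof -
    have "cl y = cl x" using that a_repr_independence'[of y x] by (simp add: cl_def)
    then have "scalar c * (y - x) \<in> J" by (simp add: cl_eq_iff J_left)
    then show ?thesis by (simp add: cl_eq_iff scale_eq_scalar algebra_simps)
  qed
  moreover have "x \<in> cl x" unfolding cl_def by (rule a_rcos_self) simp
  ultimately have "(\<Union>y\<in>cl x. cl (scale c y)) = cl (scale c x)" by blast
  then show "c \<odot>\<^bsub>U r s\<^esub> cl x = cl (scale c x)"
    by (simp add: defs cl_def)
qed

lemma ring_U: "ring (U r s)"
proof (rule ringI)
  show "abelian_group (U r s)"
  proof (rule abelian_groupI)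
    fix x assume "x \<in> carrier (U r s)"
    then obtain a where "x = cl a" by (auto simp: U_carrier)
    then show "\<exists>y\<in>carrier (U r s). y \<oplus>\<^bsub>U r s\<^esub> x = \<zero>\<^bsub>U r s\<^esub>"
      by (intro bexI[of _ "cl (- a)"]) (simp_all add: U_carrier U_add U_zero)
  qed (auto simp: U_carrier U_add U_zero algebra_simps)
  show "Group.monoid (U r s)"
    by (rule monoidI) (auto simp: U_carrier U_mult U_one algebra_simps)
qed (auto simp: U_carrier U_add U_mult algebra_simps)

text \<open>By the PBW theorem this becomes an isomorphism from the algebra of ordered monomials
  onto \<open>U\<close>, along which derivations are transported.\<close>

definition Psi :: "vec \<Rightarrow> free2 set" where
  "Psi v = cl (psi v)"

lemma cl_eq_Psi: "cl x = Psi (phi x)"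
  using psi_phi[of x] J_uminus[of "psi (phi x) - x"] by (simp add: Psi_def cl_eq_iff)

lemma U_carrier_Psi: "carrier (U r s) = range Psi"
  unfolding U_carrier using cl_eq_Psi by (auto simp: Psi_def)

lemma Psi_carrier [simp]: "Psi v \<in> carrier (U r s)"
  by (simp add: U_carrier_Psi)

lemma Psi_eq_iff [simp]: "Psi u = Psi v \<longleftrightarrow> u = v"
proof
  assume "Psi u = Psi v"
  then have "phi (psi u - psi v) = 0" by (simp add: Psi_def cl_eq_iff phi_eq_0_iff)
  then show "u = v" by (simp add: lin_diff[OF lin_phi] phi_psi)
qed simp

lemma Psi_hom:
  "Psi u \<otimes>\<^bsub>U r s\<^esub> Psi v = Psi (u \<star> v)" "Psi u \<oplus>\<^bsub>U r s\<^esub> Psi v = Psi (u + v)"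
  "c \<odot>\<^bsub>U r s\<^esub> Psi v = Psi (scale c v)" "\<zero>\<^bsub>U r s\<^esub> = Psi 0" "Psi u \<ominus>\<^bsub>U r s\<^esub> Psi v = Psi (u - v)"
proof -
  show *: "Psi u \<otimes>\<^bsub>U r s\<^esub> Psi v = Psi (u \<star> v)" "Psi u \<oplus>\<^bsub>U r s\<^esub> Psi v = Psi (u + v)"
    "c \<odot>\<^bsub>U r s\<^esub> Psi v = Psi (scale c v)" "\<zero>\<^bsub>U r s\<^esub> = Psi 0" for u v c
    using U_mult[of "psi u" "psi v"] U_add[of "psi u" "psi v"] U_smult[of c "psi v"] U_zero
    by (simp_all add: Psi_def[symmetric] cl_eq_Psi phi_star phi_psi lin_add[OF lin_phi]
        lin_scale[OF lin_phi] lin_zero[OF lin_phi])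
  interpret ring "U r s" by (rule ring_U)
  have "\<ominus>\<^bsub>U r s\<^esub> Psi v = Psi (- v)"
    by (rule minus_equality) (simp_all add: *)
  then show "Psi u \<ominus>\<^bsub>U r s\<^esub> Psi v = Psi (u - v)"
    by (simp add: a_minus_def *)
qed

lemma X1_Psi: "X1 r s = Psi x1" and X6_Psi: "X6 r s = Psi x6"
  by (simp_all add: X1_def X6_def cl_eq_Psi[unfolded cl_def] phi_gen del: One_nat_def)

section \<open>Transport of derivations\<close>

definition lift :: "(vec \<Rightarrow> vec) \<Rightarrow> free2 set \<Rightarrow> free2 set" where
  "lift d = (\<lambda>X\<in>carrier (U r s). Psi (d (inv_into UNIV Psi X)))"

lemma lift_Psi [simp]: "lift d (Psi v) = Psi (d v)"
proof -
  have "inj Psi" by (rule injI) simp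
  then show ?thesis by (simp add: lift_def)
qed

lemma lift_extensional: "lift d \<in> extensional (carrier (U r s))"
  by (simp add: lift_def)

lemma extensional_Psi_eqI:
  assumes "f \<in> extensional (carrier (U r s))" "g \<in> extensional (carrier (U r s))" "\<And>v. f (Psi v) = g (Psi v)"
  shows "f = g"
  by (rule extensionalityI[OF assms(1,2)]) (use assms(3) in \<open>auto simp: U_carrier_Psi\<close>)

lemma lift_derivation:
  assumes "derivation d"
  shows "lift d \<in> derivations (U r s)"
  using lift_extensional[of d]
  by (auto simp: derivations_def U_carrier_Psi Psi_hom PiE_def lin_simps[OF derivation_lin[OF assms]]
      derivation_star[OF assms])

lemma derivation_lift:
  assumes "D \<in> derivations (U r s)"
  shows "\<exists>d. derivation d \<and> D = lift d"
proof -
  have ex: "\<exists>w. D (Psi v) = Psi w" for v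
  proof -
    have "D (Psi v) \<in> carrier (U r s)" using assms by (auto simp: derivations_def PiE_def Pi_def)
    then show ?thesis by (auto simp: U_carrier_Psi)
  qed
  then obtain d where d: "D (Psi v) = Psi (d v)" for v by metis
  have D: "D (Psi u \<oplus>\<^bsub>U r s\<^esub> Psi v) = D (Psi u) \<oplus>\<^bsub>U r s\<^esub> D (Psi v)"
    "D (c \<odot>\<^bsub>U r s\<^esub> Psi v) = c \<odot>\<^bsub>U r s\<^esub> D (Psi v)"
    "D (Psi u \<otimes>\<^bsub>U r s\<^esub> Psi v) = D (Psi u) \<otimes>\<^bsub>U r s\<^esub> Psi v \<oplus>\<^bsub>U r s\<^esub> Psi u \<otimes>\<^bsub>U r s\<^esub> D (Psi v)" for u v c
    using assms by (simp_all add: derivations_def)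
  have "derivation d"
    unfolding derivation_def lin_def using D by (simp add: Psi_hom d)
  moreover have "D = lift d"
    using assms by (intro extensional_Psi_eqI lift_extensional) (auto simp: derivations_def PiE_def d)
  ultimately show ?thesis by blast
qed

lemma ad_Psi: "ad (U r s) (Psi g) (Psi v) = Psi (inner g v)"
  by (simp add: ad_def Psi_hom inner_def)

text \<open>Only degrees matter here: \<open>euler\<close> multiplies a homogeneous vector by a
  scalar, so the prescribed values of \<open>D5\<close> and \<open>D6\<close> can be checked without
  expanding these elements in the basis.\<close>

lemma X_hom:
  "\<exists>w. X5 r s = Psi w \<and> hom_deg (1, 1) w" "\<exists>w. X3 r s = Psi w \<and> hom_deg (2, 1) w"
  "\<exists>w. X2 r s = Psi w \<and> hom_deg (3, 1) w" "\<exists>w. X4 r s = Psi w \<and> hom_deg (3, 2) w"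
proof -
  have bracket: "\<exists>w. Psi u \<otimes>\<^bsub>U r s\<^esub> Psi v \<ominus>\<^bsub>U r s\<^esub> c \<odot>\<^bsub>U r s\<^esub> (Psi v \<otimes>\<^bsub>U r s\<^esub> Psi u) = Psi w \<and> hom_deg e w"
    if "hom_deg d u" "hom_deg d' v" "d + d' = e" for d d' e c u v
    using hom_deg_diff[OF hom_deg_star[OF that(1,2)]
        hom_deg_scale[OF hom_deg_star[OF that(2,1)[folded]], of c,
          unfolded add.commute[of d' d]]]
    by (auto simp: Psi_hom that(3))
  show 5: "\<exists>w. X5 r s = Psi w \<and> hom_deg (1, 1) w"
    unfolding X5_def X1_Psi X6_Psi by (rule bracket[OF hom_deg_x1 hom_deg_x6]) simp
  then obtain w5 where w5: "X5 r s = Psi w5" "hom_deg (1, 1) w5" by blast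
  show "\<exists>w. X3 r s = Psi w \<and> hom_deg (2, 1) w"
    unfolding X3_def X1_Psi w5(1) by (rule bracket[OF hom_deg_x1 w5(2)]) simp
  then obtain w3 where w3: "X3 r s = Psi w3" "hom_deg (2, 1) w3" by blast
  show "\<exists>w. X2 r s = Psi w \<and> hom_deg (3, 1) w"
    unfolding X2_def X1_Psi w3(1) by (rule bracket[OF hom_deg_x1 w3(2)]) simp
  show "\<exists>w. X4 r s = Psi w \<and> hom_deg (3, 2) w"
    unfolding X4_def w5(1) w3(1) by (rule bracket[OF w3(2) w5(2)]) simp
qed

lemma lift_euler_values:
  assumes "X = Psi w" "hom_deg d w" "c = a * of_int (fst d) + b * of_int (snd d)"
  shows "lift (euler a b) X = c \<odot>\<^bsub>U r s\<^esub> X"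
  by (simp add: assms euler_hom_deg[OF assms(2)] Psi_hom)

lemma derivations_eqI:
  assumes "D \<in> derivations (U r s)" "D' \<in> derivations (U r s)"
    "D (X1 r s) = D' (X1 r s)" "D (X6 r s) = D' (X6 r s)"
  shows "D = D'"
proof -
  obtain d d' where d: "derivation d" "D = lift d" "derivation d'" "D' = lift d'"
    using derivation_lift assms(1,2) by metis
  have "d x1 = d' x1" "d x6 = d' x6"
    using assms(3,4) by (simp_all add: d X1_Psi X6_Psi del: One_nat_def)
  then have "d v = d' v" for v by (rule derivation_eqI[OF d(1,3)])
  then have "d = d'" by (rule ext)
  then show ?thesis by (simp add: d)
qed

lemma one_smult: "1 \<odot>\<^bsub>U r s\<^esub> Psi v = Psi v" and zero_smult: "0 \<odot>\<^bsub>U r s\<^esub> Psi v = \<zero>\<^bsub>U r s\<^esub>"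
  by (simp_all add: Psi_hom)

text \<open>\<open>D5\<close> is the degree in \<open>e\<^sub>1\<close>, and \<open>D6\<close> the
  degree in \<open>e\<^sub>2\<close> minus that in \<open>e\<^sub>1\<close>. The six prescribed
  values are these functionals on the positive roots, and the values at \<open>X1\<close> and
  \<open>X6\<close> already give uniqueness.\<close>

lemma D5_eq: "D5 r s = lift (euler 1 0)" and D6_eq: "D6 r s = lift (euler (- 1) 1)"
proof -
  obtain w5 w3 w2 w4 where w: "X5 r s = Psi w5" "hom_deg (1, 1) w5" "X3 r s = Psi w3" "hom_deg (2, 1) w3"
    "X2 r s = Psi w2" "hom_deg (3, 1) w2" "X4 r s = Psi w4" "hom_deg (3, 2) w4"
    using X_hom by metis
  note val = lift_euler_values[OF X1_Psi hom_deg_x1] lift_euler_values[OF w(5,6)]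
    lift_euler_values[OF w(3,4)] lift_euler_values[OF w(7,8)] lift_euler_values[OF w(1,2)]
    lift_euler_values[OF X6_Psi hom_deg_x6]
  have one: "1 \<odot>\<^bsub>U r s\<^esub> X1 r s = X1 r s" "1 \<odot>\<^bsub>U r s\<^esub> X5 r s = X5 r s" "1 \<odot>\<^bsub>U r s\<^esub> X6 r s = X6 r s"
    "0 \<odot>\<^bsub>U r s\<^esub> X5 r s = \<zero>\<^bsub>U r s\<^esub>" "0 \<odot>\<^bsub>U r s\<^esub> X6 r s = \<zero>\<^bsub>U r s\<^esub>"
    unfolding X1_Psi X6_Psi w(1) by (rule one_smult zero_smult)+
  have P5: "lift (euler 1 0) \<in> derivations (U r s) \<and> lift (euler 1 0) (X1 r s) = X1 r s \<and>
     lift (euler 1 0) (X2 r s) = 3 \<odot>\<^bsub>U r s\<^esub> X2 r s \<and> lift (euler 1 0) (X3 r s) = 2 \<odot>\<^bsub>U r s\<^esub> X3 r s \<and>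
     lift (euler 1 0) (X4 r s) = 3 \<odot>\<^bsub>U r s\<^esub> X4 r s \<and> lift (euler 1 0) (X5 r s) = X5 r s \<and>
     lift (euler 1 0) (X6 r s) = \<zero>\<^bsub>U r s\<^esub>"
    using val(1)[of 1 1 0] val(2)[of 3 1 0] val(3)[of 2 1 0] val(4)[of 3 1 0] val(5)[of 1 1 0]
        val(6)[of 0 1 0]
    by (simp add: lift_derivation[OF derivation_euler] one)
  have P6: "lift (euler (- 1) 1) \<in> derivations (U r s) \<and> lift (euler (- 1) 1) (X1 r s)
      = (- 1) \<odot>\<^bsub>U r s\<^esub> X1 r s \<and>
     lift (euler (- 1) 1) (X2 r s) = (- 2) \<odot>\<^bsub>U r s\<^esub> X2 r s \<and>
     lift (euler (- 1) 1) (X3 r s) = (- 1) \<odot>\<^bsub>U r s\<^esub> X3 r s \<and>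
     lift (euler (- 1) 1) (X4 r s) = (- 1) \<odot>\<^bsub>U r s\<^esub> X4 r s \<and>
     lift (euler (- 1) 1) (X5 r s) = \<zero>\<^bsub>U r s\<^esub> \<and> lift (euler (- 1) 1) (X6 r s) = X6 r s"
    using val(1)[of "- 1" "- 1" 1] val(2)[of "- 2" "- 1" 1] val(3)[of "- 1" "- 1" 1]
      val(4)[of "- 1" "- 1" 1] val(5)[of 0 "- 1" 1] val(6)[of 1 "- 1" 1]
    by (simp add: lift_derivation[OF derivation_euler] one)
  show "D5 r s = lift (euler 1 0)"
    unfolding D5_def
  proof (rule the_equality, rule P5, elim conjE)
    fix D assume "D \<in> derivations (U r s)" "D (X1 r s) = X1 r s" "D (X6 r s) = \<zero>\<^bsub>U r s\<^esub>"
    then show "D = lift (euler 1 0)" using P5 by (intro derivations_eqI) simp_all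
  qed
  show "D6 r s = lift (euler (- 1) 1)"
    unfolding D6_def
  proof (rule the_equality, rule P6, elim conjE)
    fix D assume "D \<in> derivations (U r s)" "D (X1 r s) = (- 1) \<odot>\<^bsub>U r s\<^esub> X1 r s" "D (X6 r s) = X6 r s"
    then show "D = lift (euler (- 1) 1)" using P6 by (intro derivations_eqI) simp_all
  qed
qed

lemma euler_combination: "scale a (euler 1 0 v) + scale b (euler (- 1) 1 v) = euler (a - b) b v"
proof (rule lin_eqI[where g = "euler (a - b) b"])
  show "lin (\<lambda>v. scale a (euler 1 0 v) + scale b (euler (- 1) 1 v))"
    by (intro lin_plus lin_scaled lin_euler)
  show "scale a (euler 1 0 (delta k)) + scale b (euler (- 1) 1 (delta k)) = euler (a - b) b (delta k)" for k
    by (simp add: euler_def algebra_simps flip: scale_distrib)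
qed (rule lin_euler)

lemma decomposes_iff:
  "decomposes r s (lift d) (Psi h) a b \<longleftrightarrow> (\<forall>v. d v = inner h v + euler (a - b) b v)"
proof -
  let ?E = "\<lambda>x\<in>carrier (U r s). ad (U r s) (Psi h) x \<oplus>\<^bsub>U r s\<^esub> a \<odot>\<^bsub>U r s\<^esub> D5 r s x \<oplus>\<^bsub>U r s\<^esub> b \<odot>\<^bsub>U r s\<^esub> D6
      r s x"
  have E: "?E (Psi v) = Psi (inner h v + euler (a - b) b v)" for v
    by (simp add: ad_Psi D5_eq D6_eq Psi_hom add.assoc euler_combination)
  have "lift d = ?E \<longleftrightarrow> (\<forall>v. lift d (Psi v) = ?E (Psi v))"
  proof
    show "\<forall>v. lift d (Psi v) = ?E (Psi v)" if "lift d = ?E" by (rule allI, rule fun_cong[OF that])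
    show "lift d = ?E" if "\<forall>v. lift d (Psi v) = ?E (Psi v)"
      by (rule extensional_Psi_eqI[OF lift_extensional restrict_extensional that[THEN spec]])
  qed
  then show ?thesis unfolding decomposes_def E lift_Psi Psi_eq_iff by simp
qed

end

theorem theorem3p2:
  fixes r s :: complex and D :: "free2 set \<Rightarrow> free2 set"
  assumes "r \<noteq> 0" and "s \<noteq> 0"
    and "\<And>m n :: int. r powi m * s powi n = 1 \<Longrightarrow> m = 0 \<and> n = 0"
    and "D \<in> derivations (U r s)"
  shows "(\<exists>g \<mu>5 \<mu>6. decomposes r s D g \<mu>5 \<mu>6) \<and>
    (\<forall>g \<mu>5 \<mu>6 g' \<mu>5' \<mu>6'.
       decomposes r s D g \<mu>5 \<mu>6 \<and> decomposes r s D g' \<mu>5' \<mu>6' \<longrightarrow>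
       ad (U r s) g = ad (U r s) g' \<and> \<mu>5 = \<mu>5' \<and> \<mu>6 = \<mu>6')"
proof -
  interpret two_param r s by unfold_locales (fact assms)+
  obtain d where d: "derivation d" and D: "D = lift d" using derivation_lift[OF assms(4)] by blast
  have "\<exists>g \<mu>5 \<mu>6. decomposes r s D g \<mu>5 \<mu>6"
  proof -
    obtain g a b where "\<forall>v. d v = inner g v + euler a b v" using derivation_decomposition[OF d] by blast
    \<comment> \<open>\<open>D6\<close> contributes \<open>- b\<close> to the degree in
      \<open>e\<^sub>1\<close>, which the coefficient \<open>a + b\<close> of \<open>D5\<close>
      compensates.\<close>
    then have "decomposes r s D (Psi g) (a + b) b" unfolding D decomposes_iff by simp
    then show ?thesis by blast
  qed
  moreover have "ad (U r s) g = ad (U r s) g' \<and> \<mu>5 = \<mu>5' \<and> \<mu>6 = \<mu>6'"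
    if dec: "decomposes r s D g \<mu>5 \<mu>6" "decomposes r s D g' \<mu>5' \<mu>6'" for g \<mu>5 \<mu>6 g' \<mu>5' \<mu>6'
  proof -
    obtain h h' where h: "g = Psi h" "g' = Psi h'"
      using dec by (auto simp: decomposes_def U_carrier_Psi)
    have eq: "d v = inner h v + euler (\<mu>5 - \<mu>6) \<mu>6 v" "d v = inner h' v + euler (\<mu>5' - \<mu>6') \<mu>6' v" for v
      using dec unfolding h D decomposes_iff by blast+
    \<comment> \<open>By linearity, the difference of two decompositions of \<open>d\<close>
      decomposes the zero map.\<close>
    have "inner (h - h') v + euler ((\<mu>5 - \<mu>6) - (\<mu>5' - \<mu>6')) (\<mu>6 - \<mu>6') v = 0" for v
    proof -
      have euler_diff: "euler (a - a') (b - b') v = euler a b v - euler a' b' v" for a a' b b'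
        by (rule lin_eqI[OF lin_euler lin_minus[OF lin_euler lin_euler]])
          (simp add: euler_def algebra_simps flip: scale_distrib)
      have "inner h v + euler (\<mu>5 - \<mu>6) \<mu>6 v = inner h' v + euler (\<mu>5' - \<mu>6') \<mu>6' v"
        by (simp only: eq[symmetric])
      then show ?thesis
        unfolding euler_diff lin_diff[OF lin_inner_left] by (simp add: algebra_simps)
    qed
    from euler_not_inner[OF this] have \<mu>: "\<mu>5 = \<mu>5'" "\<mu>6 = \<mu>6'" by simp_all
    have "inner h v = inner h' v" for v using eq[of v] by (simp add: \<mu>)
    then have "ad (U r s) g = ad (U r s) g'"
      unfolding h by (intro extensional_Psi_eqI) (simp_all add: ad_Psi, simp_all add: ad_def)
    with \<mu> show ?thesis by simp
  qed
  ultimately show ?thesis by blast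
qed

end
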